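(* Let $\mathbb{F}$ be a topological field and $\mathbb{K}$ a topological field extending $\mathbb{F}$ (that is, $\mathbb{F}\subseteq\mathbb{K}$ is a subfield and the inclusion map $\mathbb{F}\to\mathbb{K}$ is continuous). Let $E$, $F$, $H$ and $\widetilde Z$ be topological $\mathbb{K}$-vector spaces, $P\subseteq H$ an open subset, $r,k\in\mathbb{N}_0\cup\{\infty\}$, $\widetilde M$ a $C^{r+k}_{\mathbb{K}}$-manifold modeled on $\widetilde Z$, and $\tilde f\colon\widetilde M\times E\times P\to F$ a map of class $C^{r+k}_{\mathbb{K}}$. Let $M$ be a $C^r_{\mathbb{F}}$-manifold modeled on a topological $\mathbb{F}$-vector space $Z$. Given a $C^r_{\mathbb{F}}$-map $\sigma\colon M\to\widetilde M$, define $f:=\tilde f\circ(\sigma\times\mathrm{id}_E\times\mathrm{id}_P)\colon M\times E\times P\to F$. Then $$\phi\colon C^r(M,E)\times P\to C^r(M,F),\qquad \phi(\gamma,p)(x):=f(x,\gamma(x),p)\quad(x\in M)$$ is a map of class $C^k_{\mathbb{K}}$.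
   Context: All topological spaces, topological fields and topological vector spaces are Hausdorff; topological fields are non-discrete. Differential calculus over a topological field $\mathbb{K}$: For a topological $\mathbb{K}$-vector space $E$ and $U\subseteq E$ open, put $U^{[0]}:=U$, $U^{[1]}:=\{(x,y,t)\in U\times E\times\mathbb{K}: x+ty\in U\}$ and $U^{[j+1]}:=(U^{[j]})^{[1]}$. A map $f\colon U\to F$ into a topological $\mathbb{K}$-vector space is $C^0_{\mathbb{K}}$ if it is continuous ($f^{[0]}:=f$); it is $C^1_{\mathbb{K}}$ if it is continuous and there is a (necessarily unique) continuous map $f^{[1]}\colon U^{[1]}\to F$ with $f^{[1]}(x,y,t)=\frac1t(f(x+ty)-f(x))$ for all $(x,y,t)\in U^{[1]}$ with $t\neq0$; for $k\ge2$ it is $C^k_{\mathbb{K}}$ if it is $C^{k-1}_{\mathbb{K}}$ and $f^{[k-1]}$ is $C^1_{\mathbb{K}}$, and then $f^{[k]}:=(f^{[k-1]})^{[1]}$; it is $C^\infty_{\mathbb{K}}$ if it is $C^k_{\mathbb{K}}$ for all $k$. $C^k_{\mathbb{K}}$-manifolds modeled on topological $\mathbb{K}$-vector spaces and $C^k_{\mathbb{K}}$-maps between them are defined as usual via charts. $\mathbb{K}$-vector spaces and $\mathbb{K}$-manifolds are also regarded as objects over $\mathbb{F}$ by restriction of scalars. Function spaces: Let $E$ be a topological $\mathbb{K}$-vector space. For $V$ open in a topological $\mathbb{F}$-vector space, $C^r(V,E)$ is the $\mathbb{K}$-vector space of $C^r_{\mathbb{F}}$-maps $V\to E$ with the initial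 topology with respect to the maps $\gamma\mapsto\gamma^{[j]}\in C(V^{[j]},E)$, $j\in\mathbb{N}_0$, $j\le r$ ($\gamma^{[j]}$ and $V^{[j]}$ formed over $\mathbb{F}$), where $C(V^{[j]},E)$ carries the compact-open topology. For a $C^r_{\mathbb{F}}$-manifold $M$, $C^r(M,E)$ is the space of $C^r_{\mathbb{F}}$-maps $M\to E$ with the initial topology with respect to the maps $\gamma\mapsto\gamma|_U\circ\kappa^{-1}\in C^r(V,E)$, for $\kappa\colon U\to V$ ranging through the charts of $M$. This is a topological $\mathbb{K}$-vector space. *)

theory Defs
  imports "HOL-Analysis.Analysis" "HOL-Library.Function_Algebras" "HOL-Library.Extended_Nat"
begin

section \<open>Topological fields and topological vector spaces\<close>

text \<open>
  All structures are carried by explicit topologies; the underlying set is the \<open>topspace\<close>.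
  This is needed because function spaces are themselves topological vector spaces below.
  Closure of the carriers under the operations is part of \<^const>\<open>continuous_map\<close>.
  A subfield with its own topology is a second topology on the same field type, so that
  restriction of scalars leaves the data of a vector space unchanged.
\<close>

definition topological_field :: "'k::field topology \<Rightarrow> bool" where
  "topological_field \<K> \<longleftrightarrow>
     1 \<in> topspace \<K> \<and>
     continuous_map (prod_topology \<K> \<K>) \<K> (\<lambda>(a, b). a + b) \<and>
     continuous_map \<K> \<K> uminus \<and>
     continuous_map (prod_topology \<K> \<K>) \<K> (\<lambda>(a, b). a * b) \<and>
     continuous_map (subtopology \<K> (topspace \<K> - {0})) \<K> inverse \<and>
     Hausdorff_space \<K> \<and>
     \<K> \<noteq> discrete_topology (topspace \<K>)"

definition topological_field_extension :: "'k::field topology \<Rightarrow> 'k topology \<Rightarrow> bool" where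
  "topological_field_extension \<F> \<K> \<longleftrightarrow>
     topological_field \<F> \<and> topological_field \<K> \<and>
     topspace \<F> \<subseteq> topspace \<K> \<and> continuous_map \<F> \<K> (\<lambda>a. a)"

record ('v, 'k) tvs =
  vtop :: "'v topology"
  scale :: "'k \<Rightarrow> 'v \<Rightarrow> 'v"

abbreviation carrier :: "('v, 'k) tvs \<Rightarrow> 'v set" where
  "carrier E \<equiv> topspace (vtop E)"

text \<open>Addition and zero are those of the type; only scalars in \<open>topspace \<K>\<close> are relevant.\<close>

definition topological_vector_space ::
    "'k::field topology \<Rightarrow> ('v::ab_group_add, 'k) tvs \<Rightarrow> bool" where
  "topological_vector_space \<K> E \<longleftrightarrow>
     0 \<in> carrier E \<and>
     continuous_map (prod_topology (vtop E) (vtop E)) (vtop E) (\<lambda>(v, w). v + w) \<and>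
     continuous_map (prod_topology \<K> (vtop E)) (vtop E) (\<lambda>(a, v). scale E a v) \<and>
     Hausdorff_space (vtop E) \<and>
     (\<forall>a\<in>topspace \<K>. \<forall>v\<in>carrier E. \<forall>w\<in>carrier E.
        scale E a (v + w) = scale E a v + scale E a w) \<and>
     (\<forall>a\<in>topspace \<K>. \<forall>b\<in>topspace \<K>. \<forall>v\<in>carrier E.
        scale E (a + b) v = scale E a v + scale E b v \<and>
        scale E (a * b) v = scale E a (scale E b v)) \<and>
     (\<forall>v\<in>carrier E. scale E 1 v = v)"

definition prod_tvs :: "('v, 'k) tvs \<Rightarrow> ('w, 'k) tvs \<Rightarrow> ('v \<times> 'w, 'k) tvs" where
  "prod_tvs E F =
     \<lparr>vtop = prod_topology (vtop E) (vtop F), scale = (\<lambda>a (v, w). (scale E a v, scale F a w))\<rparr>"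


section \<open>Differential calculus over a topological field\<close>

text \<open>
  With \<open>E\<^sub>0 = E\<close> and \<open>E\<^bsub>j+1\<^esub> = E\<^sub>j \<times> E\<^sub>j \<times> \<K>\<close>, the set \<open>U\<^bsup>[j]\<^esup>\<close> is a subset of \<open>E\<^sub>j\<close>. As the type
  would depend on \<open>j\<close>, all \<open>E\<^sub>j\<close> are embedded in one datatype: the elements of \<open>E\<^sub>j\<close> are the
  complete trees of depth \<open>j\<close>, where \<open>Step x y t\<close> stands for the triple \<open>(x, y, t)\<close>.
\<close>

datatype ('v, 'k) tower =
    is_Base: Base (base: 'v)
  | is_Step: Step (pt: "('v, 'k) tower") (dir: "('v, 'k) tower") (par: 'k)

fun tower_add :: "('v::plus, 'k::plus) tower \<Rightarrow> ('v, 'k) tower \<Rightarrow> ('v, 'k) tower" where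
  "tower_add (Base v) (Base w) = Base (v + w)"
| "tower_add (Step x y s) (Step x' y' s') = Step (tower_add x x') (tower_add y y') (s + s')"
| "tower_add _ _ = undefined"

primrec tower_scale ::
    "('k::times \<Rightarrow> 'v \<Rightarrow> 'v) \<Rightarrow> 'k \<Rightarrow> ('v, 'k) tower \<Rightarrow> ('v, 'k) tower" where
  "tower_scale sc a (Base v) = Base (sc a v)"
| "tower_scale sc a (Step x y s) = Step (tower_scale sc a x) (tower_scale sc a y) (a * s)"

primrec tower_top :: "'k topology \<Rightarrow> ('v, 'k) tvs \<Rightarrow> nat \<Rightarrow> ('v, 'k) tower topology" where
  "tower_top \<K> E 0 = pullback_topology {p. is_Base p} base (vtop E)"
| "tower_top \<K> E (Suc j) =
     pullback_topology {p. is_Step p} (\<lambda>p. (pt p, dir p, par p))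
       (prod_topology (tower_top \<K> E j) (prod_topology (tower_top \<K> E j) \<K>))"

text \<open>\<open>U\<^bsup>[1]\<^esup>\<close> for a subset \<open>U\<close> of \<open>E\<^sub>j\<close>.\<close>

definition ext_dom :: "'k::field topology \<Rightarrow> ('v::ab_group_add, 'k) tvs \<Rightarrow> nat \<Rightarrow>
    ('v, 'k) tower set \<Rightarrow> ('v, 'k) tower set" where
  "ext_dom \<K> E j U =
     {Step x y t | x y t. x \<in> U \<and> y \<in> topspace (tower_top \<K> E j) \<and> t \<in> topspace \<K> \<and>
        tower_add x (tower_scale (scale E) t y) \<in> U}"

text \<open>\<open>h\<close> has the properties required of \<open>g\<^bsup>[1]\<^esup>\<close>, for \<open>g\<close> defined on a subset \<open>U\<close> of \<open>E\<^sub>j\<close>.\<close>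

definition is_quotient_ext :: "'k::field topology \<Rightarrow> ('v::ab_group_add, 'k) tvs \<Rightarrow>
    ('w::ab_group_add, 'k) tvs \<Rightarrow> nat \<Rightarrow> ('v, 'k) tower set \<Rightarrow>
    (('v, 'k) tower \<Rightarrow> 'w) \<Rightarrow> (('v, 'k) tower \<Rightarrow> 'w) \<Rightarrow> bool" where
  "is_quotient_ext \<K> E F j U g h \<longleftrightarrow>
     continuous_map (subtopology (tower_top \<K> E (Suc j)) (ext_dom \<K> E j U)) (vtop F) h \<and>
     (\<forall>x y t. Step x y t \<in> ext_dom \<K> E j U \<and> t \<noteq> 0 \<longrightarrow>
        h (Step x y t) =
          scale F (inverse t) (g (tower_add x (tower_scale (scale E) t y)) - g x))"

definition C1 :: "'k::field topology \<Rightarrow> ('v::ab_group_add, 'k) tvs \<Rightarrow>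
    ('w::ab_group_add, 'k) tvs \<Rightarrow> nat \<Rightarrow> ('v, 'k) tower set \<Rightarrow>
    (('v, 'k) tower \<Rightarrow> 'w) \<Rightarrow> bool" where
  "C1 \<K> E F j U g \<longleftrightarrow>
     continuous_map (subtopology (tower_top \<K> E j) U) (vtop F) g \<and>
     (\<exists>h. is_quotient_ext \<K> E F j U g h)"

text \<open>
  The function \<open>g\<^bsup>[1]\<^esup>\<close>. Throughout, functions on a subset are represented by total functions
  vanishing outside it, which makes \<open>g\<^bsup>[1]\<^esup>\<close> unique as a HOL function and function spaces
  subgroups of the function type.
\<close>

definition quotient_ext :: "'k::field topology \<Rightarrow> ('v::ab_group_add, 'k) tvs \<Rightarrow>
    ('w::ab_group_add, 'k) tvs \<Rightarrow> nat \<Rightarrow> ('v, 'k) tower set \<Rightarrow>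
    (('v, 'k) tower \<Rightarrow> 'w) \<Rightarrow> ('v, 'k) tower \<Rightarrow> 'w" where
  "quotient_ext \<K> E F j U g =
     (THE h. is_quotient_ext \<K> E F j U g h \<and> (\<forall>p. p \<notin> ext_dom \<K> E j U \<longrightarrow> h p = 0))"

text \<open>\<open>iter_dom \<K> E U j\<close> is \<open>U\<^bsup>[j]\<^esup>\<close> and \<open>iter_ext \<K> E F U f j\<close> is \<open>f\<^bsup>[j]\<^esup>\<close>.\<close>

primrec iter_dom :: "'k::field topology \<Rightarrow> ('v::ab_group_add, 'k) tvs \<Rightarrow> 'v set \<Rightarrow> nat \<Rightarrow>
    ('v, 'k) tower set" where
  "iter_dom \<K> E U 0 = Base ` U"
| "iter_dom \<K> E U (Suc j) = ext_dom \<K> E j (iter_dom \<K> E U j)"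

primrec iter_ext :: "'k::field topology \<Rightarrow> ('v::ab_group_add, 'k) tvs \<Rightarrow>
    ('w::ab_group_add, 'k) tvs \<Rightarrow> 'v set \<Rightarrow> ('v \<Rightarrow> 'w) \<Rightarrow> nat \<Rightarrow> ('v, 'k) tower \<Rightarrow> 'w" where
  "iter_ext \<K> E F U f 0 = (\<lambda>p. if p \<in> Base ` U then f (base p) else 0)"
| "iter_ext \<K> E F U f (Suc j) = quotient_ext \<K> E F j (iter_dom \<K> E U j) (iter_ext \<K> E F U f j)"

primrec Ck_nat :: "'k::field topology \<Rightarrow> ('v::ab_group_add, 'k) tvs \<Rightarrow>
    ('w::ab_group_add, 'k) tvs \<Rightarrow> 'v set \<Rightarrow> nat \<Rightarrow> ('v \<Rightarrow> 'w) \<Rightarrow> bool" where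
  "Ck_nat \<K> E F U 0 f \<longleftrightarrow> continuous_map (subtopology (vtop E) U) (vtop F) f"
| "Ck_nat \<K> E F U (Suc k) f \<longleftrightarrow>
     Ck_nat \<K> E F U k f \<and> C1 \<K> E F k (iter_dom \<K> E U k) (iter_ext \<K> E F U f k)"

definition Ck :: "'k::field topology \<Rightarrow> ('v::ab_group_add, 'k) tvs \<Rightarrow>
    ('w::ab_group_add, 'k) tvs \<Rightarrow> 'v set \<Rightarrow> enat \<Rightarrow> ('v \<Rightarrow> 'w) \<Rightarrow> bool" where
  "Ck \<K> E F U k f \<longleftrightarrow> (\<forall>j. enat j \<le> k \<longrightarrow> Ck_nat \<K> E F U j f)"


section \<open>Manifolds\<close>

text \<open>
  A manifold is given by its topology, its modelling space and an atlas, not necessarily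
  maximal; its charts are all charts compatible with the atlas. A chart is a pair \<open>(U, \<kappa>)\<close>,
  where the values of \<open>\<kappa>\<close> outside \<open>U\<close> are irrelevant. With this representation
  restriction of scalars from \<open>\<K>\<close> to \<open>\<F>\<close>, or passing to a lower order of differentiability,
  keeps the data and only enlarges the set \<open>charts \<F> k M\<close>.
\<close>

record ('m, 'v, 'k) mfd =
  mtop :: "'m topology"
  model :: "('v, 'k) tvs"
  atlas :: "('m set \<times> ('m \<Rightarrow> 'v)) set"

definition is_chart :: "('m, 'v, 'k) mfd \<Rightarrow> 'm set \<times> ('m \<Rightarrow> 'v) \<Rightarrow> bool" where
  "is_chart M = (\<lambda>(U, \<kappa>).
     openin (mtop M) U \<and> openin (vtop (model M)) (\<kappa> ` U) \<and>
     homeomorphic_map (subtopology (mtop M) U) (subtopology (vtop (model M)) (\<kappa> ` U)) \<kappa>)"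

definition compatible :: "'k::field topology \<Rightarrow> enat \<Rightarrow> ('v::ab_group_add, 'k) tvs \<Rightarrow>
    'm set \<times> ('m \<Rightarrow> 'v) \<Rightarrow> 'm set \<times> ('m \<Rightarrow> 'v) \<Rightarrow> bool" where
  "compatible \<K> k Z = (\<lambda>(U, \<kappa>) (V, \<eta>).
     Ck \<K> Z Z (\<kappa> ` (U \<inter> V)) k (\<eta> \<circ> inv_into U \<kappa>) \<and>
     Ck \<K> Z Z (\<eta> ` (U \<inter> V)) k (\<kappa> \<circ> inv_into V \<eta>))"

definition manifold :: "'k::field topology \<Rightarrow> enat \<Rightarrow> ('v::ab_group_add, 'k) tvs \<Rightarrow>
    ('m, 'v, 'k) mfd \<Rightarrow> bool" where
  "manifold \<K> k Z M \<longleftrightarrow>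
     model M = Z \<and> Hausdorff_space (mtop M) \<and>
     (\<forall>c\<in>atlas M. is_chart M c) \<and>
     topspace (mtop M) = (\<Union>(U, \<kappa>)\<in>atlas M. U) \<and>
     (\<forall>c\<in>atlas M. \<forall>d\<in>atlas M. compatible \<K> k Z c d)"

definition charts :: "'k::field topology \<Rightarrow> enat \<Rightarrow> ('m, 'v::ab_group_add, 'k) mfd \<Rightarrow>
    ('m set \<times> ('m \<Rightarrow> 'v)) set" where
  "charts \<K> k M = {c. is_chart M c \<and> (\<forall>d\<in>atlas M. compatible \<K> k (model M) c d)}"

definition Ck_mfd :: "'k::field topology \<Rightarrow> enat \<Rightarrow> ('m, 'v::ab_group_add, 'k) mfd \<Rightarrow>
    ('n, 'w::ab_group_add, 'k) mfd \<Rightarrow> ('m \<Rightarrow> 'n) \<Rightarrow> bool" where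
  "Ck_mfd \<K> k M N f \<longleftrightarrow>
     continuous_map (mtop M) (mtop N) f \<and>
     (\<forall>(U, \<kappa>)\<in>charts \<K> k M. \<forall>(V, \<eta>)\<in>charts \<K> k N.
        Ck \<K> (model M) (model N) (\<kappa> ` (U \<inter> f -` V)) k (\<eta> \<circ> f \<circ> inv_into U \<kappa>))"

text \<open>An open subset \<open>U\<close> of a topological vector space as a manifold.\<close>

definition open_mfd :: "('v, 'k) tvs \<Rightarrow> 'v set \<Rightarrow> ('v, 'v, 'k) mfd" where
  "open_mfd E U = \<lparr>mtop = subtopology (vtop E) U, model = E, atlas = {(U, \<lambda>x. x)}\<rparr>"

abbreviation tvs_mfd :: "('v, 'k) tvs \<Rightarrow> ('v, 'v, 'k) mfd" where
  "tvs_mfd E \<equiv> open_mfd E (carrier E)"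

definition prod_mfd :: "('m, 'v, 'k) mfd \<Rightarrow> ('n, 'w, 'k) mfd \<Rightarrow> ('m \<times> 'n, 'v \<times> 'w, 'k) mfd" where
  "prod_mfd M N =
     \<lparr>mtop = prod_topology (mtop M) (mtop N), model = prod_tvs (model M) (model N),
      atlas = {(U \<times> V, map_prod \<kappa> \<eta>) | U \<kappa> V \<eta>. (U, \<kappa>) \<in> atlas M \<and> (V, \<eta>) \<in> atlas N}\<rparr>"


section \<open>Function spaces\<close>

text \<open>\<open>S\<close> is included in the subbase since the family of maps may be empty.\<close>

definition initial_topology :: "'a set \<Rightarrow> (('a \<Rightarrow> 'b) \<times> 'b topology) set \<Rightarrow> 'a topology" where
  "initial_topology S I =
     topology_generated_by (insert S {S \<inter> g -` W | g Y W. (g, Y) \<in> I \<and> openin Y W})"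

definition compact_open_topology ::
    "'a topology \<Rightarrow> 'w::zero topology \<Rightarrow> ('a \<Rightarrow> 'w) topology" where
  "compact_open_topology X Y =
     topology_generated_by
       {{f. continuous_map X Y f \<and> (\<forall>x. x \<notin> topspace X \<longrightarrow> f x = 0) \<and> f ` C \<subseteq> W} | C W.
          compactin X C \<and> openin Y W}"

text \<open>The topology of \<open>C\<^sup>r(V, E)\<close> for \<open>V\<close> open in \<open>Z\<close>.\<close>

definition Cr_open_topology :: "'k::field topology \<Rightarrow> enat \<Rightarrow> ('z::ab_group_add, 'k) tvs \<Rightarrow>
    'z set \<Rightarrow> ('e::ab_group_add, 'k) tvs \<Rightarrow> ('z \<Rightarrow> 'e) topology" where
  "Cr_open_topology \<F> r Z V E =
     initial_topology {\<gamma>. Ck \<F> Z E V r \<gamma> \<and> (\<forall>z. z \<notin> V \<longrightarrow> \<gamma> z = 0)}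
       {(\<lambda>\<gamma>. iter_ext \<F> Z E V \<gamma> j,
         compact_open_topology (subtopology (tower_top \<F> Z j) (iter_dom \<F> Z V j)) (vtop E)) | j.
          enat j \<le> r}"

text \<open>\<open>C\<^sup>r(M, E)\<close>, with pointwise operations.\<close>

definition Cr_space :: "'k::field topology \<Rightarrow> enat \<Rightarrow> ('m, 'z::ab_group_add, 'k) mfd \<Rightarrow>
    ('e::ab_group_add, 'k) tvs \<Rightarrow> ('m \<Rightarrow> 'e, 'k) tvs" where
  "Cr_space \<F> r M E =
     \<lparr>vtop = initial_topology
        {\<gamma>. Ck_mfd \<F> r M (tvs_mfd E) \<gamma> \<and> (\<forall>x. x \<notin> topspace (mtop M) \<longrightarrow> \<gamma> x = 0)}
        {(\<lambda>\<gamma> z. if z \<in> \<kappa> ` U then \<gamma> (inv_into U \<kappa> z) else 0,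
          Cr_open_topology \<F> r (model M) (\<kappa> ` U) E) | U \<kappa>. (U, \<kappa>) \<in> charts \<F> r M},
      scale = (\<lambda>a \<gamma> x. scale E a (\<gamma> x))\<rparr>"

end

theory Submission
  imports Defs
begin

text \<open>
  A map from a space \<open>Y\<close> into \<open>C(X, T)\<close> with the compact-open topology is continuous iff the
  associated map is continuous on \<open>Y \<times> C\<close> for every compact \<open>C\<close> in \<open>X\<close>. Hence a continuous map
  from \<open>Y\<close> into \<open>C\<^sup>r(V, E)\<close> is a family of maps whose iterated difference quotients are all
  continuous in this sense, and such families obey the usual calculus: they can be composed with
  \<open>C\<^sup>r\<close> maps on either side, and they can be recognised locally on \<open>V\<close>, because on the part of
  \<open>V\<^bsup>[1]\<^esup>\<close> not covered by the local pieces \<open>t\<close> is nonzero and the difference quotient is explicit.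

  For the theorem put \<open>f\<^sub>x(e, p) = f(x, e, p)\<close>. The map \<open>\<phi>\<^bsup>[m]\<^esup>\<close> must be
  \<open>q \<mapsto> (x \<mapsto> f\<^sub>x\<^bsup>[m]\<^esup>(ev\<^sub>x q))\<close>, where \<open>ev\<^sub>x\<close> evaluates the functions occurring in \<open>q\<close> at \<open>x\<close>, and only its
  continuity into \<open>C\<^sup>r(M, F)\<close> is at stake. This is local in \<open>x\<close>. In a chart of the manifold
  containing \<open>\<sigma>(x)\<close>, \<open>f\<^sub>x\<^bsup>[m]\<^esup>\<close> is \<open>f\<^bsup>[m]\<^esup>\<close> restricted to the directions which do not move the first
  variable; as \<open>f\<^bsup>[m]\<^esup>\<close> is \<open>C\<^sup>r\<close>, the chain rule for families applies.
\<close>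

section \<open>Continuous families and the compact-open topology\<close>

text \<open>Neither \<open>M\<close> nor \<open>Z\<close> is assumed locally compact, so a
  continuous map into \<open>C(X, T)\<close> need not be jointly continuous on
  \<open>Y \<times> X\<close>; only the restrictions to \<open>Y \<times> C\<close> with compact
  \<open>C\<close> are controlled. As compact sets need not determine the topology of
  \<open>X\<close> either, continuity of each single \<open>g y\<close> on all of \<open>X\<close>
  is kept as a separate clause. The notion limits the admissible operations: families can be glued
  over open sets and composed with one fixed map, inside or outside, but one family cannot be
  evaluated in another.

  Hence the dependence of \<open>f(x, .)\<close> on \<open>x\<close> has to be removed before its
  quotients can be applied. It is moved into an argument, the coordinate of
  \<open>\<sigma>(x)\<close>, so that a single map becomes the outer map. The order
  \<open>r + k\<close> is thereby split: up to \<open>k\<close> quotients are taken in the variables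
  \<open>(e, p)\<close>, and up to \<open>r\<close> remain for \<open>x\<close>. The domain enters
  only as an open subset of a topological vector space that carries linear evaluations into
  \<open>E \<times> H\<close>.\<close>

definition continuous_family ::
    "'y topology \<Rightarrow> 'a topology \<Rightarrow> 'b topology \<Rightarrow> ('y \<Rightarrow> 'a \<Rightarrow> 'b) \<Rightarrow> bool" where
  "continuous_family Y X T g \<longleftrightarrow>
     (\<forall>y\<in>topspace Y. continuous_map X T (g y)) \<and>
     (\<forall>C. compactin X C \<longrightarrow>
        continuous_map (prod_topology Y (subtopology X C)) T (\<lambda>(y, x). g y x))"

lemma continuous_familyD:
  assumes "continuous_family Y X T g"
  shows "y \<in> topspace Y \<Longrightarrow> continuous_map X T (g y)"
    and "compactin X C \<Longrightarrow> continuous_map (prod_topology Y (subtopology X C)) T (\<lambda>(y, x). g y x)"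
    and "y \<in> topspace Y \<Longrightarrow> x \<in> topspace X \<Longrightarrow> g y x \<in> topspace T"
  using assms unfolding continuous_family_def by (auto simp: continuous_map_def)

lemma continuous_family_cong:
  assumes "continuous_family Y X T g"
    and "\<And>y x. y \<in> topspace Y \<Longrightarrow> x \<in> topspace X \<Longrightarrow> g y x = g' y x"
  shows "continuous_family Y X T g'"
  unfolding continuous_family_def
proof (intro conjI ballI allI impI)
  fix y assume "y \<in> topspace Y"
  then show "continuous_map X T (g' y)"
    using continuous_map_eq[OF continuous_familyD(1)[OF assms(1)]] assms(2) by blast
next
  fix C assume "compactin X C"
  from continuous_familyD(2)[OF assms(1) this]
  show "continuous_map (prod_topology Y (subtopology X C)) T (\<lambda>(y, x). g' y x)"
    by (rule continuous_map_eq) (auto simp: assms(2))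
qed

lemma continuous_family_outer:
  assumes g: "continuous_family Y X T g"
    and f: "continuous_map (subtopology T W) T' f"
    and sub: "\<And>y x. y \<in> topspace Y \<Longrightarrow> x \<in> topspace X \<Longrightarrow> g y x \<in> W"
  shows "continuous_family Y X T' (\<lambda>y x. f (g y x))"
  unfolding continuous_family_def
proof (intro conjI ballI allI impI)
  fix y assume y: "y \<in> topspace Y"
  have "continuous_map X (subtopology T W) (g y)"
    using continuous_familyD(1)[OF g y] sub[OF y] by (auto simp: continuous_map_in_subtopology)
  from continuous_map_compose[OF this f] show "continuous_map X T' (\<lambda>x. f (g y x))"
    by (simp add: o_def)
next
  fix C assume C: "compactin X C"
  have "continuous_map (prod_topology Y (subtopology X C)) (subtopology T W) (\<lambda>(y, x). g y x)"
    using continuous_familyD(2)[OF g C] sub by (auto simp: continuous_map_in_subtopology)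
  from continuous_map_compose[OF this f]
  show "continuous_map (prod_topology Y (subtopology X C)) T' (\<lambda>(y, x). f (g y x))"
    by (simp add: o_def case_prod_unfold)
qed

lemma continuous_family_compose_map:
  assumes "continuous_family Y X T g" "continuous_map T T' f"
  shows "continuous_family Y X T' (\<lambda>y x. f (g y x))"
  using continuous_family_outer[OF assms(1), of "topspace T"] assms continuous_familyD(3)[OF assms(1)]
  by simp

text \<open>Continuous images of compact sets are compact, so a compact set \<open>C\<close> in
  \<open>X'\<close> is handled by the hypothesis for its image under
  \<open>\<alpha>\<close>.\<close>

lemma continuous_family_inner:
  assumes g: "continuous_family Y X T g" and a: "continuous_map X' X \<alpha>"
  shows "continuous_family Y X' T (\<lambda>y x. g y (\<alpha> x))"
  unfolding continuous_family_def
proof (intro conjI ballI allI impI)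
  fix y assume y: "y \<in> topspace Y"
  show "continuous_map X' T (\<lambda>x. g y (\<alpha> x))"
    using continuous_map_compose[OF a continuous_familyD(1)[OF g y]] by (simp add: o_def)
next
  fix C assume C: "compactin X' C"
  then have C': "compactin X (\<alpha> ` C)" by (rule image_compactin[OF _ a])
  have "continuous_map (prod_topology Y (subtopology X' C)) (prod_topology Y (subtopology X (\<alpha> ` C)))
     (\<lambda>z. (fst z, \<alpha> (snd z)))"
  proof (rule continuous_map_pairedI)
    have 1: "continuous_map (subtopology X' C) (subtopology X (\<alpha> ` C)) \<alpha>"
      using a by (auto simp: continuous_map_in_subtopology continuous_map_from_subtopology)
    show "continuous_map (prod_topology Y (subtopology X' C)) (subtopology X (\<alpha> ` C)) (\<lambda>x. \<alpha> (snd x))"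
      using continuous_map_compose[OF continuous_map_snd 1] by (simp add: o_def)
    show "continuous_map (prod_topology Y (subtopology X' C)) Y (\<lambda>x. fst x)"
      by (simp add: continuous_map_fst)
  qed
  from continuous_map_compose[OF this continuous_familyD(2)[OF g C']]
  show "continuous_map (prod_topology Y (subtopology X' C)) T (\<lambda>(y, x). g y (\<alpha> x))"
    by (simp add: o_def case_prod_unfold)
qed

lemma continuous_family_subtopology:
  assumes "continuous_family Y (subtopology X S) T g" "S' \<subseteq> S"
  shows "continuous_family Y (subtopology X S') T g"
  using continuous_family_inner[OF assms(1), of "subtopology X S'" "\<lambda>x. x"] assms(2)
  by (auto simp: continuous_map_in_subtopology)

lemma continuous_family_pullback:
  assumes g: "continuous_family Y X T g" and u: "continuous_map Y' Y u"
  shows "continuous_family Y' X T (\<lambda>y x. g (u y) x)"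
  unfolding continuous_family_def
proof (intro conjI ballI allI impI)
  fix y assume y: "y \<in> topspace Y'"
  then have "u y \<in> topspace Y" using u by (auto simp: continuous_map_def)
  then show "continuous_map X T (g (u y))"
    using continuous_familyD(1)[OF g] by simp
next
  fix C assume C: "compactin X C"
  have "continuous_map (prod_topology Y' (subtopology X C)) (prod_topology Y (subtopology X C))
     (\<lambda>z. (u (fst z), snd z))"
    using continuous_map_compose[OF continuous_map_fst u]
    by (intro continuous_map_pairedI) (auto simp: o_def continuous_map_snd)
  from continuous_map_compose[OF this continuous_familyD(2)[OF g C]]
  show "continuous_map (prod_topology Y' (subtopology X C)) T (\<lambda>(y, x). g (u y) x)"
    by (simp add: o_def case_prod_unfold)
qed

lemma continuous_family_pair:
  assumes "continuous_family Y X T1 g1" "continuous_family Y X T2 g2"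
  shows "continuous_family Y X (prod_topology T1 T2) (\<lambda>y x. (g1 y x, g2 y x))"
  using assms unfolding continuous_family_def
  by (auto intro!: continuous_map_pairedI simp: case_prod_unfold)

lemma continuous_family_map:
  assumes "continuous_map X T f"
  shows "continuous_family Y X T (\<lambda>_. f)"
  unfolding continuous_family_def
proof (intro conjI ballI allI impI)
  fix C assume C: "compactin X C"
  have "continuous_map (prod_topology Y (subtopology X C)) T (f \<circ> snd)"
    using continuous_map_compose[OF continuous_map_snd continuous_map_from_subtopology[OF assms]] .
  then show "continuous_map (prod_topology Y (subtopology X C)) T (\<lambda>(y, x). f x)"
    by (simp add: o_def case_prod_unfold)
qed (use assms in auto)

lemma continuous_family_constant:
  assumes "continuous_map Y T c"
  shows "continuous_family Y X T (\<lambda>y _. c y)"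
  unfolding continuous_family_def
proof (intro conjI ballI allI impI)
  fix y assume "y \<in> topspace Y"
  then show "continuous_map X T (\<lambda>_. c y)" using assms by (auto simp: continuous_map_def)
next
  fix C assume C: "compactin X C"
  have "continuous_map (prod_topology Y (subtopology X C)) T (c \<circ> fst)"
    using continuous_map_compose[OF continuous_map_fst assms] .
  then show "continuous_map (prod_topology Y (subtopology X C)) T (\<lambda>(y, x). c y)"
    by (simp add: o_def case_prod_unfold)
qed

text \<open>A one-point set is compact, which gives continuity of evaluation at a point without
  joint continuity on the whole space.\<close>

lemma continuous_family_eval:
  assumes "continuous_family Y X T g" "x \<in> topspace X"
  shows "continuous_map Y T (\<lambda>y. g y x)"
proof -
  have 1: "continuous_map Y (prod_topology Y (subtopology X {x})) (\<lambda>y. (y, x))"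
    using assms(2) by (intro continuous_map_pairedI) auto
  have "compactin X {x}" using assms(2) by simp
  from continuous_map_compose[OF 1 continuous_familyD(2)[OF assms(1) this]] show ?thesis
    by (simp add: o_def)
qed

text \<open>A compact Hausdorff space is regular, so inside \<open>C\<close> the point has a closed,
  hence compact, neighbourhood within \<open>W\<close>. As \<open>X\<close> need not be locally
  compact, \<open>K\<close> surrounds \<open>x\<close> only relative to \<open>C\<close>.\<close>

lemma compact_neighbourhood_shrink:
  assumes "Hausdorff_space X" "compactin X C" "openin X W" "x \<in> C" "x \<in> W"
  obtains U K where "openin X U" "x \<in> U" "compactin X K" "U \<inter> C \<subseteq> K" "K \<subseteq> W"
proof -
  let ?S = "subtopology X C"
  have "regular_space ?S"
    using assms by (intro compact_Hausdorff_imp_regular_space)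
      (auto simp: compact_space_subtopology Hausdorff_space_subtopology)
  then have "neighbourhood_base_of (closedin ?S) ?S"
    by (simp add: neighbourhood_base_of_closedin)
  moreover have "openin ?S (C \<inter> W)" using assms(3) openin_subtopology_Int2 by blast
  ultimately obtain U K where UK: "openin ?S U" "closedin ?S K" "x \<in> U" "U \<subseteq> K" "K \<subseteq> C \<inter> W"
    unfolding neighbourhood_base_of using assms(4,5) by (metis IntI)
  obtain U' where U': "openin X U'" "U = U' \<inter> C" using UK(1) by (auto simp: openin_subtopology)
  have "compactin ?S K"
    using UK(2) assms(2) closedin_compact_space compact_space_subtopology by blast
  then have "compactin X K" by (simp add: compactin_subtopology)
  then show ?thesis using that[of U' K] U' UK by auto
qed

text \<open>A compact set in the union need not lie in one member of the cover, but each of its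
  points has a relative neighbourhood contained in a compact subset of a single member. These
  relatively open pieces, multiplied by all of \<open>Y\<close>, are open in the product and can be
  pasted.\<close>

lemma continuous_family_local:
  assumes H: "Hausdorff_space X"
    and ope: "\<And>V. V \<in> \<V> \<Longrightarrow> openin X V"
    and loc: "\<And>V. V \<in> \<V> \<Longrightarrow> continuous_family Y (subtopology X V) T g"
  shows "continuous_family Y (subtopology X (\<Union>\<V>)) T g"
  unfolding continuous_family_def
proof (intro conjI ballI allI impI)
  fix y assume y: "y \<in> topspace Y"
  show "continuous_map (subtopology X (\<Union>\<V>)) T (g y)"
  proof (rule pasting_lemma[where I = \<V> and T = "\<lambda>V. V" and f = "\<lambda>_. g y"])
    fix V assume V: "V \<in> \<V>"
    show "openin (subtopology X (\<Union>\<V>)) V"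
      using ope[OF V] V by (auto simp: openin_open_subtopology openin_Union ope)
    have "subtopology (subtopology X (\<Union> \<V>)) V = subtopology X V"
      using V by (auto simp: subtopology_subtopology inf.absorb2 Union_upper)
    then show "continuous_map (subtopology (subtopology X (\<Union> \<V>)) V) T (g y)"
      using continuous_familyD(1)[OF loc[OF V] y] by simp
  qed auto
next
  fix C assume C: "compactin (subtopology X (\<Union>\<V>)) C"
  then have C': "compactin X C" "C \<subseteq> \<Union>\<V>" by (auto simp: compactin_subtopology)
  have sub: "subtopology (subtopology X (\<Union>\<V>)) C = subtopology X C"
    using C' by (auto simp: subtopology_subtopology inf.absorb2)
  have ex: "\<exists>U K V. openin X U \<and> x \<in> U \<and> compactin X K \<and> U \<inter> C \<subseteq> K \<and> K \<subseteq> V \<and> V \<in> \<V>"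
    if x: "x \<in> C" for x
  proof -
    obtain V where V: "V \<in> \<V>" "x \<in> V" using x C' by auto
    show ?thesis
      by (rule compact_neighbourhood_shrink[OF H C'(1) ope[OF V(1)] x V(2)]) (use V in blast)
  qed
  define I where "I = {(U, K, V). openin X U \<and> compactin X K \<and> U \<inter> C \<subseteq> K \<and> K \<subseteq> V \<and> V \<in> \<V>}"
  have "continuous_map (prod_topology Y (subtopology X C)) T (\<lambda>(y, x). g y x)"
  proof (rule pasting_lemma[where I = I and T = "\<lambda>(U, K, V). topspace Y \<times> (U \<inter> C)"
          and f = "\<lambda>_ (y, x). g y x"])
    fix i assume i: "i \<in> I"
    obtain U K V where [simp]: "i = (U, K, V)" and UKV: "openin X U" "compactin X K" "U \<inter> C \<subseteq> K" "K \<subseteq> V" "V \<in> \<V>"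
      using i by (auto simp: I_def)
    show "openin (prod_topology Y (subtopology X C)) (case i of (U, K, V) \<Rightarrow> topspace Y \<times> (U \<inter> C))"
      using UKV by (auto simp: openin_prod_Times_iff openin_subtopology)
    have "compactin (subtopology X V) K" using UKV by (auto simp: compactin_subtopology)
    from continuous_familyD(2)[OF loc[OF UKV(5)] this]
    have "continuous_map (prod_topology Y (subtopology X K)) T (\<lambda>(y, x). g y x)"
      using UKV(4) by (simp add: subtopology_subtopology inf.absorb2)
    from continuous_map_from_subtopology[OF this, of "topspace Y \<times> (U \<inter> C)"]
    have 1: "continuous_map (subtopology (prod_topology Y (subtopology X K)) (topspace Y \<times> (U \<inter> C))) T (\<lambda>(y, x). g y x)" .
    \<comment> \<open>The hypothesis is about \<open>K\<close> and the goal about \<open>C\<close>;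
      on \<open>U \<inter> C\<close>, which lies in both, they induce the same topology.\<close>
    have "subtopology (prod_topology Y (subtopology X K)) (topspace Y \<times> (U \<inter> C)) =
       subtopology (prod_topology Y (subtopology X C)) (topspace Y \<times> (U \<inter> C))"
    proof -
      have "K \<inter> (U \<inter> C) = U \<inter> C" "C \<inter> (U \<inter> C) = U \<inter> C" using UKV(3) by auto
      then show ?thesis
        by (simp add: prod_topology_subtopology(2) subtopology_subtopology Times_Int_Times)
    qed
    then show "continuous_map (subtopology (prod_topology Y (subtopology X C)) (case i of (U, K, V) \<Rightarrow> topspace Y \<times> (U \<inter> C))) T
          (\<lambda>(y, x). g y x)"
      using 1 by simp
  next
    fix z assume z: "z \<in> topspace (prod_topology Y (subtopology X C))"
    then obtain U K V where "openin X U \<and> snd z \<in> U \<and> compactin X K \<and> U \<inter> C \<subseteq> K \<and> K \<subseteq> V \<and> V \<in> \<V>"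
      using ex[of "snd z"] by auto
    then show "\<exists>j. j \<in> I \<and> z \<in> (case j of (U, K, V) \<Rightarrow> topspace Y \<times> (U \<inter> C)) \<and>
             (case z of (y, x) \<Rightarrow> g y x) = (case z of (y, x) \<Rightarrow> g y x)"
      using z by (intro exI[of _ "(U, K, V)"]) (auto simp: I_def)
  qed auto
  then show "continuous_map (prod_topology Y (subtopology (subtopology X (\<Union> \<V>)) C)) T (\<lambda>(y, x). g y x)"
    by (simp add: sub)
qed

section \<open>Universal properties of the compact-open and the initial topology\<close>

lemma topspace_compact_open:
  "topspace (compact_open_topology X T) =
     {f. continuous_map X T f \<and> (\<forall>x. x \<notin> topspace X \<longrightarrow> f x = 0)}"
    (is "?T = ?S")
proof
  show "?T \<subseteq> ?S"
    unfolding compact_open_topology_def topology_generated_by_topspace by blast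
  \<comment> \<open>The empty compact set with the empty target yields the whole space as a member
    of the subbase.\<close>
  have "?S = {f. continuous_map X T f \<and> (\<forall>x. x \<notin> topspace X \<longrightarrow> f x = 0) \<and> f ` {} \<subseteq> {}}"
    by simp
  moreover have "compactin X {}" "openin T {}" by simp_all
  ultimately show "?S \<subseteq> ?T"
    unfolding compact_open_topology_def topology_generated_by_topspace by blast
qed

text \<open>From left to right: each \<open>G y\<close> is continuous, so near a point of
  \<open>C\<close> it maps a compact relative neighbourhood \<open>K\<close> into \<open>W\<close>,
  and the subbasic set given by \<open>K\<close> and \<open>W\<close> provides the neighbourhood of
  \<open>y\<close>. From right to left: the tube lemma along the compact \<open>C\<close> makes
  preimages of subbasic sets open. The vanishing clause comes from representing maps on
  \<open>X\<close> by total functions.\<close>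

lemma continuous_map_into_compact_open:
  assumes H: "Hausdorff_space X"
  shows "continuous_map Y (compact_open_topology X T) G \<longleftrightarrow>
     (\<forall>y\<in>topspace Y. \<forall>x. x \<notin> topspace X \<longrightarrow> G y x = 0) \<and> continuous_family Y X T G"
    (is "?L \<longleftrightarrow> ?R")
proof
  assume L: ?L
  then have top: "G y \<in> topspace (compact_open_topology X T)" if "y \<in> topspace Y" for y
    using that by (auto simp: continuous_map_def)
  have ope: "openin Y {y \<in> topspace Y. G y ` C \<subseteq> W}" if "compactin X C" "openin T W" for C W
  proof -
    have "openin Y (G -` {f. continuous_map X T f \<and> (\<forall>x. x \<notin> topspace X \<longrightarrow> f x = 0) \<and> f ` C \<subseteq> W} \<inter> topspace Y)"
      using L that unfolding compact_open_topology_def continuous_on_generated_topo_iff by blast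
    also have "\<dots> = {y \<in> topspace Y. G y ` C \<subseteq> W}"
      using top by (auto simp: topspace_compact_open)
    finally show ?thesis .
  qed
  have "continuous_family Y X T G"
    unfolding continuous_family_def
  proof (intro conjI ballI allI impI)
    fix C assume C: "compactin X C"
    have CX: "C \<subseteq> topspace X" using C compactin_subset_topspace by blast
    show "continuous_map (prod_topology Y (subtopology X C)) T (\<lambda>(y, x). G y x)"
      unfolding continuous_map_def
    proof (intro conjI allI impI)
      show "(\<lambda>(y, x). G y x) \<in> topspace (prod_topology Y (subtopology X C)) \<rightarrow> topspace T"
        using top by (auto simp: topspace_compact_open continuous_map_def)
      fix W assume W: "openin T W"
      show "openin (prod_topology Y (subtopology X C))
          {z \<in> topspace (prod_topology Y (subtopology X C)). (case z of (y, x) \<Rightarrow> G y x) \<in> W}"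
        unfolding openin_prod_topology_alt
      proof (intro allI impI)
        fix y x assume "(y, x) \<in> {z \<in> topspace (prod_topology Y (subtopology X C)). (case z of (y, x) \<Rightarrow> G y x) \<in> W}"
        then have yx: "y \<in> topspace Y" "x \<in> C" "G y x \<in> W" using CX by auto
        have "continuous_map X T (G y)" using top[OF yx(1)] by (simp add: topspace_compact_open)
        then have "openin X {x \<in> topspace X. G y x \<in> W}" using W by (auto simp: continuous_map_def)
        from compact_neighbourhood_shrink[OF H C this yx(2)] yx CX
        obtain U K where UK: "openin X U" "x \<in> U" "compactin X K" "U \<inter> C \<subseteq> K" "K \<subseteq> {x \<in> topspace X. G y x \<in> W}"
          by blast
        show "\<exists>U V. openin Y U \<and> openin (subtopology X C) V \<and> y \<in> U \<and> x \<in> V \<and>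
              U \<times> V \<subseteq> {z \<in> topspace (prod_topology Y (subtopology X C)). (case z of (y, x) \<Rightarrow> G y x) \<in> W}"
        proof (intro exI conjI)
          show "openin Y {y \<in> topspace Y. G y ` K \<subseteq> W}" by (rule ope[OF UK(3) W])
          show "openin (subtopology X C) (U \<inter> C)" using UK(1) by (auto simp: openin_subtopology)
          show "{y \<in> topspace Y. G y ` K \<subseteq> W} \<times> (U \<inter> C)
              \<subseteq> {z \<in> topspace (prod_topology Y (subtopology X C)). (case z of (y, x) \<Rightarrow> G y x) \<in> W}"
            using UK(4) CX by fastforce
        qed (use yx UK CX in auto)
      qed
    qed
  qed (use top in \<open>auto simp: topspace_compact_open\<close>)
  then show ?R using top by (auto simp: topspace_compact_open)
next
  assume R: ?R
  show ?L
    unfolding compact_open_topology_def continuous_on_generated_topo_iff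
  proof (intro conjI allI impI)
    fix S assume "S \<in> {{f. continuous_map X T f \<and> (\<forall>x. x \<notin> topspace X \<longrightarrow> f x = 0) \<and> f ` C \<subseteq> W} |C W.
              compactin X C \<and> openin T W}"
    then obtain C W where S: "S = {f. continuous_map X T f \<and> (\<forall>x. x \<notin> topspace X \<longrightarrow> f x = 0) \<and> f ` C \<subseteq> W}"
      and C: "compactin X C" and W: "openin T W" by blast
    have CX: "C \<subseteq> topspace X" using C compactin_subset_topspace by blast
    have eq: "G -` S \<inter> topspace Y = {y \<in> topspace Y. G y ` C \<subseteq> W}"
      using R by (auto simp: S continuous_familyD)
    define N where "N = {z \<in> topspace (prod_topology Y (subtopology X C)). (\<lambda>(y, x). G y x) z \<in> W}"
    have N: "openin (prod_topology Y (subtopology X C)) N"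
      using continuous_familyD(2)[OF conjunct2[OF R] C] W unfolding continuous_map_def N_def by blast
    have CC: "compactin (subtopology X C) C" using C by (simp add: compactin_subtopology)
    have "openin Y {y \<in> topspace Y. G y ` C \<subseteq> W}"
    proof (subst openin_subopen, intro ballI)
      fix y assume y: "y \<in> {y \<in> topspace Y. G y ` C \<subseteq> W}"
      then have "{y} \<times> C \<subseteq> N" using CX by (auto simp: N_def)
      from tube_lemma_right[OF N CC _ this] y
      obtain U V where UV: "openin Y U" "y \<in> U" "C \<subseteq> V" "U \<times> V \<subseteq> N" by auto
      show "\<exists>T. openin Y T \<and> y \<in> T \<and> T \<subseteq> {y \<in> topspace Y. G y ` C \<subseteq> W}"
        using UV openin_subset[OF UV(1)] by (intro exI[of _ U]) (fastforce simp: N_def)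
    qed
    then show "openin Y (G -` S \<inter> topspace Y)" by (simp add: eq)
  next
    have "G ` topspace Y \<subseteq> topspace (compact_open_topology X T)"
      using R by (auto simp: topspace_compact_open continuous_familyD)
    then show "G ` topspace Y \<subseteq> \<Union> {{f. continuous_map X T f \<and> (\<forall>x. x \<notin> topspace X \<longrightarrow> f x = 0) \<and> f ` C \<subseteq> W} |C W.
              compactin X C \<and> openin T W}"
      by (simp add: compact_open_topology_def topology_generated_by_topspace)
  qed
qed

lemma topspace_initial_topology: "topspace (initial_topology S I) = S"
  unfolding initial_topology_def topology_generated_by_topspace by auto

text \<open>\<open>continuous_map\<close> also demands values in the target space, which the
  generated topology does not control; the assumption supplies this for the maps
  \<open>g\<close>.\<close>

lemma continuous_map_into_initial_topology:
  assumes "\<And>g T s. (g, T) \<in> I \<Longrightarrow> s \<in> S \<Longrightarrow> g s \<in> topspace T"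
  shows "continuous_map Y (initial_topology S I) f \<longleftrightarrow>
     f ` topspace Y \<subseteq> S \<and> (\<forall>(g, T)\<in>I. continuous_map Y T (\<lambda>y. g (f y)))"
    (is "?L \<longleftrightarrow> ?R")
proof
  assume L: ?L
  then have sub: "f ` topspace Y \<subseteq> S"
    using continuous_map_image_subset_topspace topspace_initial_topology by metis
  moreover have "continuous_map Y T (\<lambda>y. g (f y))" if gT: "(g, T) \<in> I" for g T
    unfolding continuous_map_def
  proof (intro conjI allI impI)
    show "(\<lambda>y. g (f y)) \<in> topspace Y \<rightarrow> topspace T" using sub assms gT by blast
    fix W assume "openin T W"
    then have "openin Y (f -` (S \<inter> g -` W) \<inter> topspace Y)"
      using L gT unfolding initial_topology_def continuous_on_generated_topo_iff by blast
    also have "f -` (S \<inter> g -` W) \<inter> topspace Y = {x \<in> topspace Y. g (f x) \<in> W}"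
      using sub by auto
    finally show "openin Y {x \<in> topspace Y. g (f x) \<in> W}" .
  qed
  ultimately show ?R by blast
next
  assume R: ?R
  show ?L
    unfolding initial_topology_def continuous_on_generated_topo_iff
  proof (intro conjI allI impI)
    fix U assume "U \<in> insert S {S \<inter> g -` W |g T W. (g, T) \<in> I \<and> openin T W}"
    then consider "U = S" | g T W where "U = S \<inter> g -` W" "(g, T) \<in> I" "openin T W" by auto
    then show "openin Y (f -` U \<inter> topspace Y)"
    proof cases
      case 1
      then have "f -` U \<inter> topspace Y = topspace Y" using R by auto
      then show ?thesis by simp
    next
      case 2
      then have "openin Y {x \<in> topspace Y. g (f x) \<in> W}"
        using R unfolding continuous_map_def by blast
      moreover have "f -` U \<inter> topspace Y = {x \<in> topspace Y. g (f x) \<in> W}"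
        using 2 R by auto
      ultimately show ?thesis by simp
    qed
  qed (use R in auto)
qed

section \<open>Topological modules and towers\<close>

lemma continuous_map_ident: "continuous_map X X (\<lambda>x. x)"
  using continuous_map_id by (simp add: id_def)

declare tower_top.simps [simp del]

abbreviation tower_move :: "('v::ab_group_add, 'k::field) tvs \<Rightarrow> ('v, 'k) tower \<Rightarrow> 'k \<Rightarrow>
    ('v, 'k) tower \<Rightarrow> ('v, 'k) tower" where
  "tower_move Z x t v \<equiv> tower_add x (tower_scale (scale Z) t v)"

abbreviation tower_on :: "'k topology \<Rightarrow> ('v, 'k) tvs \<Rightarrow> nat \<Rightarrow> ('v, 'k) tower set \<Rightarrow>
    ('v, 'k) tower topology" where
  "tower_on K Z j U \<equiv> subtopology (tower_top K Z j) U"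

text \<open>
  Codomains are records with explicit operations, since \<^term>\<open>tower_add\<close> is not the addition of a
  type class, and in the chain rule the inner map takes values in towers.
\<close>

record ('w, 'k) vspace =
  vs_top :: "'w topology"
  vs_plus :: "'w \<Rightarrow> 'w \<Rightarrow> 'w"
  vs_smult :: "'k \<Rightarrow> 'w \<Rightarrow> 'w"

definition plain :: "('w::ab_group_add, 'k) tvs \<Rightarrow> ('w, 'k) vspace" where
  "plain E = \<lparr>vs_top = vtop E, vs_plus = (+), vs_smult = scale E\<rparr>"

definition tower_vs :: "'k::field topology \<Rightarrow> ('v::ab_group_add, 'k) tvs \<Rightarrow> nat \<Rightarrow>
    (('v, 'k) tower, 'k) vspace" where
  "tower_vs K E j = \<lparr>vs_top = tower_top K E j, vs_plus = tower_add, vs_smult = tower_scale (scale E)\<rparr>"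

definition scalar_vs :: "'k::field topology \<Rightarrow> ('k, 'k) vspace" where
  "scalar_vs K = \<lparr>vs_top = K, vs_plus = (+), vs_smult = (*)\<rparr>"

definition prod_vs :: "('v, 'k) vspace \<Rightarrow> ('w, 'k) vspace \<Rightarrow> ('v \<times> 'w, 'k) vspace" where
  "prod_vs A B = \<lparr>vs_top = prod_topology (vs_top A) (vs_top B),
     vs_plus = (\<lambda>u v. (vs_plus A (fst u) (fst v), vs_plus B (snd u) (snd v))),
     vs_smult = (\<lambda>t u. (vs_smult A t (fst u), vs_smult B t (snd u)))\<rparr>"

lemma vspace_simps [simp]:
  "vs_top (plain E) = vtop E" "vs_plus (plain E) = (+)" "vs_smult (plain E) = scale E"
  "vs_top (tower_vs K Z j) = tower_top K Z j" "vs_plus (tower_vs K Z j) = tower_add"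
  "vs_smult (tower_vs K Z j) = tower_scale (scale Z)"
  "vs_top (scalar_vs K) = K" "vs_plus (scalar_vs K) = (+)" "vs_smult (scalar_vs K) = (*)"
  "vs_top (prod_vs A B) = prod_topology (vs_top A) (vs_top B)"
  "vs_plus (prod_vs A B) u v = (vs_plus A (fst u) (fst v), vs_plus B (snd u) (snd v))"
  "vs_smult (prod_vs A B) t u = (vs_smult A t (fst u), vs_smult B t (snd u))"
  by (simp_all add: plain_def tower_vs_def scalar_vs_def prod_vs_def)

section \<open>Topology and coordinates of towers\<close>

lemma topspace_tower_0 [simp]: "topspace (tower_top K E 0) = Base ` carrier E"
  by (auto simp: tower_top.simps topspace_pullback_topology image_iff elim!: tower.collapse(1)[symmetric])

lemma topspace_tower_Suc:
  "topspace (tower_top K E (Suc j)) =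
     {Step x v t | x v t. x \<in> topspace (tower_top K E j) \<and> v \<in> topspace (tower_top K E j) \<and>
        t \<in> topspace K}"
proof (intro set_eqI)
  fix p
  show "p \<in> topspace (tower_top K E (Suc j)) \<longleftrightarrow> p \<in> {Step x v t | x v t.
      x \<in> topspace (tower_top K E j) \<and> v \<in> topspace (tower_top K E j) \<and> t \<in> topspace K}"
    by (cases p) (auto simp: tower_top.simps(2)[of K E j] topspace_pullback_topology)
qed

lemma Step_in_topspace [simp]:
  "Step x v t \<in> topspace (tower_top K E (Suc j)) \<longleftrightarrow>
     x \<in> topspace (tower_top K E j) \<and> v \<in> topspace (tower_top K E j) \<and> t \<in> topspace K"
  by (simp add: topspace_tower_Suc)

lemma continuous_map_base: "continuous_map (tower_top K E 0) (vtop E) base"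
  using continuous_map_pullback[of "vtop E" "vtop E" "\<lambda>x. x" "{p. is_Base p}" base]
  by (simp add: tower_top.simps o_def)

lemma continuous_map_Base:
  assumes "continuous_map X (vtop E) f"
  shows "continuous_map X (tower_top K E 0) (\<lambda>x. Base (f x))"
  unfolding tower_top.simps
  by (rule continuous_map_pullback') (use assms in \<open>auto simp: o_def\<close>)

lemma continuous_map_tower_Suc:
  "continuous_map (tower_top K E (Suc j))
     (prod_topology (tower_top K E j) (prod_topology (tower_top K E j) K))
     (\<lambda>p. (pt p, dir p, par p))"
  using continuous_map_pullback[of "prod_topology (tower_top K E j) (prod_topology (tower_top K E j) K)"
      "prod_topology (tower_top K E j) (prod_topology (tower_top K E j) K)" "\<lambda>x. x" "{p. is_Step p}"
      "\<lambda>p. (pt p, dir p, par p)"]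
  by (simp add: tower_top.simps o_def)

lemma continuous_map_pt: "continuous_map (tower_top K E (Suc j)) (tower_top K E j) pt"
  and continuous_map_dir: "continuous_map (tower_top K E (Suc j)) (tower_top K E j) dir"
  and continuous_map_par: "continuous_map (tower_top K E (Suc j)) K par"
  using continuous_map_tower_Suc[of K E j] by (simp_all add: continuous_map_pairwise o_def)

lemma continuous_map_Step:
  assumes "continuous_map X (tower_top K E j) a" "continuous_map X (tower_top K E j) b"
    and "continuous_map X K c"
  shows "continuous_map X (tower_top K E (Suc j)) (\<lambda>x. Step (a x) (b x) (c x))"
  unfolding tower_top.simps(2)[of K E j]
  by (rule continuous_map_pullback') (use assms in \<open>auto simp: o_def intro: continuous_map_pairedI\<close>)

lemma Hausdorff_tower:
  assumes "Hausdorff_space K" "Hausdorff_space (vtop E)"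
  shows "Hausdorff_space (tower_top K E j)"
proof (induction j)
  case 0
  show ?case
    by (rule Hausdorff_space_injective_preimage[OF assms(2) continuous_map_base]) (auto simp: inj_on_def)
next
  case (Suc j)
  have "Hausdorff_space (prod_topology (tower_top K E j) (prod_topology (tower_top K E j) K))"
    using Suc assms by (simp add: Hausdorff_space_prod_topology)
  then show ?case
    by (rule Hausdorff_space_injective_preimage[OF _ continuous_map_tower_Suc])
      (auto simp: inj_on_def topspace_tower_Suc)
qed

text \<open>Collects what vector spaces, towers and scalars have in common. The record names no zero
  vector, so neutrality is demanded of \<open>vs_smult A 0 u\<close> for every \<open>u\<close>;
  negatives do not occur because quotient equations are written with sums and multiples
  only.\<close>

definition topological_module :: "'k::field topology \<Rightarrow> ('w, 'k) vspace \<Rightarrow> bool" where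
  "topological_module K A \<longleftrightarrow>
     continuous_map (prod_topology (vs_top A) (vs_top A)) (vs_top A) (\<lambda>(u, v). vs_plus A u v) \<and>
     continuous_map (prod_topology K (vs_top A)) (vs_top A) (\<lambda>(t, v). vs_smult A t v) \<and>
     (\<forall>u\<in>topspace (vs_top A). \<forall>v\<in>topspace (vs_top A). \<forall>w\<in>topspace (vs_top A).
        vs_plus A (vs_plus A u v) w = vs_plus A u (vs_plus A v w)) \<and>
     (\<forall>u\<in>topspace (vs_top A). \<forall>v\<in>topspace (vs_top A).
        vs_plus A u v = vs_plus A v u \<and> vs_plus A (vs_smult A 0 u) v = v \<and>
        (\<forall>a\<in>topspace K. vs_smult A a (vs_plus A u v) = vs_plus A (vs_smult A a u) (vs_smult A a v))) \<and>
     (\<forall>u\<in>topspace (vs_top A). vs_smult A 1 u = u \<and> (\<forall>a\<in>topspace K. \<forall>b\<in>topspace K.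
        vs_smult A (a + b) u = vs_plus A (vs_smult A a u) (vs_smult A b u) \<and>
        vs_smult A (a * b) u = vs_smult A a (vs_smult A b u)))"

lemma topological_module_closed:
  assumes "topological_module K A"
  shows "u \<in> topspace (vs_top A) \<Longrightarrow> v \<in> topspace (vs_top A) \<Longrightarrow> vs_plus A u v \<in> topspace (vs_top A)"
    and "a \<in> topspace K \<Longrightarrow> v \<in> topspace (vs_top A) \<Longrightarrow> vs_smult A a v \<in> topspace (vs_top A)"
proof -
  have "continuous_map (prod_topology (vs_top A) (vs_top A)) (vs_top A) (\<lambda>(u, v). vs_plus A u v)"
    "continuous_map (prod_topology K (vs_top A)) (vs_top A) (\<lambda>(t, v). vs_smult A t v)"
    using assms by (auto simp: topological_module_def)
  then show "u \<in> topspace (vs_top A) \<Longrightarrow> v \<in> topspace (vs_top A) \<Longrightarrow> vs_plus A u v \<in> topspace (vs_top A)"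
    "a \<in> topspace K \<Longrightarrow> v \<in> topspace (vs_top A) \<Longrightarrow> vs_smult A a v \<in> topspace (vs_top A)"
    by (auto simp: continuous_map_def Pi_iff)
qed

lemma topological_module_laws:
  assumes "topological_module K A"
  shows "u \<in> topspace (vs_top A) \<Longrightarrow> v \<in> topspace (vs_top A) \<Longrightarrow> w \<in> topspace (vs_top A) \<Longrightarrow>
      vs_plus A (vs_plus A u v) w = vs_plus A u (vs_plus A v w)"
    and "u \<in> topspace (vs_top A) \<Longrightarrow> v \<in> topspace (vs_top A) \<Longrightarrow> vs_plus A u v = vs_plus A v u"
    and "u \<in> topspace (vs_top A) \<Longrightarrow> v \<in> topspace (vs_top A) \<Longrightarrow> vs_plus A (vs_smult A 0 u) v = v"
    and "u \<in> topspace (vs_top A) \<Longrightarrow> v \<in> topspace (vs_top A) \<Longrightarrow> a \<in> topspace K \<Longrightarrow>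
      vs_smult A a (vs_plus A u v) = vs_plus A (vs_smult A a u) (vs_smult A a v)"
    and "u \<in> topspace (vs_top A) \<Longrightarrow> a \<in> topspace K \<Longrightarrow> b \<in> topspace K \<Longrightarrow>
      vs_smult A (a + b) u = vs_plus A (vs_smult A a u) (vs_smult A b u)"
    and "u \<in> topspace (vs_top A) \<Longrightarrow> a \<in> topspace K \<Longrightarrow> b \<in> topspace K \<Longrightarrow>
      vs_smult A (a * b) u = vs_smult A a (vs_smult A b u)"
    and "u \<in> topspace (vs_top A) \<Longrightarrow> vs_smult A 1 u = u"
  using assms unfolding topological_module_def by blast+

lemma topological_fieldD:
  assumes "topological_field K"
  shows "0 \<in> topspace K" "1 \<in> topspace K" "Hausdorff_space K"
    and "a \<in> topspace K \<Longrightarrow> b \<in> topspace K \<Longrightarrow> a + b \<in> topspace K"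
    and "a \<in> topspace K \<Longrightarrow> b \<in> topspace K \<Longrightarrow> a * b \<in> topspace K"
    and "a \<in> topspace K \<Longrightarrow> - a \<in> topspace K"
    and "a \<in> topspace K \<Longrightarrow> inverse a \<in> topspace K"
proof -
  have *: "1 \<in> topspace K" "continuous_map (prod_topology K K) K (\<lambda>(a, b). a + b)"
    "continuous_map K K uminus" "continuous_map (prod_topology K K) K (\<lambda>(a, b). a * b)"
    "continuous_map (subtopology K (topspace K - {0})) K inverse" "Hausdorff_space K"
    using assms by (auto simp: topological_field_def)
  show 1: "1 \<in> topspace K" "Hausdorff_space K" by fact+
  show add: "a + b \<in> topspace K" if "a \<in> topspace K" "b \<in> topspace K" for a b
    using *(2) that by (auto simp: continuous_map_def Pi_iff)
  show "a * b \<in> topspace K" if "a \<in> topspace K" "b \<in> topspace K" for a b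
    using *(4) that by (auto simp: continuous_map_def Pi_iff)
  show um: "- a \<in> topspace K" if "a \<in> topspace K" for a
    using *(3) that by (auto simp: continuous_map_def Pi_iff)
  show zero: "0 \<in> topspace K" using add[OF 1(1) um[OF 1(1)]] by simp
  \<comment> \<open>The case \<open>a = 0\<close>, left out by the continuity clause, holds because
    \<open>inverse 0 = 0\<close> by convention.\<close>
  show "inverse a \<in> topspace K" if "a \<in> topspace K" for a
    using *(5) that zero by (cases "a = 0") (auto simp: continuous_map_def Pi_iff)
qed

lemma tvsD:
  assumes "topological_vector_space K E"
  shows "0 \<in> carrier E" "Hausdorff_space (vtop E)"
    and "v \<in> carrier E \<Longrightarrow> w \<in> carrier E \<Longrightarrow> v + w \<in> carrier E"
    and "a \<in> topspace K \<Longrightarrow> v \<in> carrier E \<Longrightarrow> scale E a v \<in> carrier E"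
    and "a \<in> topspace K \<Longrightarrow> v \<in> carrier E \<Longrightarrow> w \<in> carrier E \<Longrightarrow>
      scale E a (v + w) = scale E a v + scale E a w"
    and "a \<in> topspace K \<Longrightarrow> b \<in> topspace K \<Longrightarrow> v \<in> carrier E \<Longrightarrow>
      scale E (a + b) v = scale E a v + scale E b v"
    and "a \<in> topspace K \<Longrightarrow> b \<in> topspace K \<Longrightarrow> v \<in> carrier E \<Longrightarrow>
      scale E (a * b) v = scale E a (scale E b v)"
    and "v \<in> carrier E \<Longrightarrow> scale E 1 v = v"
    and "a \<in> topspace K \<Longrightarrow> scale E a 0 = 0"
proof -
  have *: "continuous_map (prod_topology (vtop E) (vtop E)) (vtop E) (\<lambda>(v, w). v + w)"
    "continuous_map (prod_topology K (vtop E)) (vtop E) (\<lambda>(a, v). scale E a v)"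
    using assms by (auto simp: topological_vector_space_def)
  show "v + w \<in> carrier E" if "v \<in> carrier E" "w \<in> carrier E" for v w
    using *(1) that by (auto simp: continuous_map_def Pi_iff)
  show "scale E a v \<in> carrier E" if "a \<in> topspace K" "v \<in> carrier E" for a v
    using *(2) that by (auto simp: continuous_map_def Pi_iff)
  show zero: "0 \<in> carrier E" using assms by (simp add: topological_vector_space_def)
  show add: "scale E a (v + w) = scale E a v + scale E a w"
    if "a \<in> topspace K" "v \<in> carrier E" "w \<in> carrier E" for a v w
    using assms that by (simp add: topological_vector_space_def)
  show "scale E a 0 = 0" if "a \<in> topspace K"
    using add[OF that zero zero] by simp
qed (use assms in \<open>auto simp: topological_vector_space_def\<close>)

text \<open>Subtraction is that of the ambient type, so closure of the carrier under it has to be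
  derived; it comes from \<open>- v\<close> being the multiple of \<open>v\<close> by
  \<open>- 1\<close>.\<close>

lemma tvs_diff:
  assumes K: "topological_field K" and E: "topological_vector_space K E"
  shows "v \<in> carrier E \<Longrightarrow> scale E 0 v = 0"
    and "v \<in> carrier E \<Longrightarrow> - v = scale E (- 1) v"
    and "v \<in> carrier E \<Longrightarrow> - v \<in> carrier E"
    and "v \<in> carrier E \<Longrightarrow> w \<in> carrier E \<Longrightarrow> v - w \<in> carrier E"
    and "a \<in> topspace K \<Longrightarrow> v \<in> carrier E \<Longrightarrow> w \<in> carrier E \<Longrightarrow>
      scale E a (v - w) = scale E a v - scale E a w"
proof -
  note E' = tvsD[OF E] and K' = topological_fieldD[OF K]
  show zero: "scale E 0 v = 0" if "v \<in> carrier E" for v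
    using E'(6)[OF K'(1) K'(1) that] by simp
  show um: "- v = scale E (- 1) v" if "v \<in> carrier E" for v
    using E'(6)[of 1 "- 1", OF K'(2) K'(6)[OF K'(2)] that] that
    by (simp add: zero E' minus_unique)
  show umc: "- v \<in> carrier E" if "v \<in> carrier E" for v
    unfolding um[OF that] by (rule E'(4)[OF K'(6)[OF K'(2)] that])
  show "v - w \<in> carrier E" if "v \<in> carrier E" "w \<in> carrier E" for v w
    using E'(3)[OF that(1) umc[OF that(2)]] by simp
  then show "scale E a (v - w) = scale E a v - scale E a w"
    if "a \<in> topspace K" "v \<in> carrier E" "w \<in> carrier E"
    using E'(5)[of a "v - w" w] that by (simp add: algebra_simps)
qed

lemma topological_module_plain:
  assumes "topological_field K" "topological_vector_space K E"
  shows "topological_module K (plain E)"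
  using assms(2) unfolding topological_module_def topological_vector_space_def
  by (auto simp: tvs_diff(1)[OF assms] add.assoc add.commute)

lemma topological_module_scalar:
  assumes "topological_field K"
  shows "topological_module K (scalar_vs K)"
  using assms unfolding topological_module_def topological_field_def
  by (auto simp: algebra_simps)

text \<open>Level \<open>Suc j\<close> is the product of two copies of level \<open>j\<close> and
  one of \<open>K\<close> with coordinatewise operations, so each law is inherited in the three
  coordinates.\<close>

lemma topological_module_tower:
  assumes K: "topological_field K" and E: "topological_vector_space K E"
  shows "topological_module K (tower_vs K E j)"
proof (induction j)
  case 0
  note E' = tvsD[OF E] and K' = topological_fieldD[OF K]
  have 1: "continuous_map (prod_topology (vtop E) (vtop E)) (vtop E) (\<lambda>(v, w). v + w)"
    "continuous_map (prod_topology K (vtop E)) (vtop E) (\<lambda>(a, v). scale E a v)"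
    using E by (auto simp: topological_vector_space_def)
  let ?T = "tower_top K E 0"
  have b1: "continuous_map (prod_topology ?T ?T) (prod_topology (vtop E) (vtop E)) (\<lambda>z. (base (fst z), base (snd z)))"
    using continuous_map_compose[OF continuous_map_fst continuous_map_base]
      continuous_map_compose[OF continuous_map_snd continuous_map_base]
    by (intro continuous_map_pairedI) (auto simp: o_def)
  have b2: "continuous_map (prod_topology K ?T) (prod_topology K (vtop E)) (\<lambda>z. (fst z, base (snd z)))"
    using continuous_map_compose[OF continuous_map_snd continuous_map_base]
    by (intro continuous_map_pairedI) (auto simp: o_def continuous_map_fst)
  have c1: "continuous_map (prod_topology ?T ?T) ?T (\<lambda>(u, v). tower_add u v)"
    by (rule continuous_map_eq[OF continuous_map_Base[OF continuous_map_compose[OF b1 1(1)]]]) auto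
  have c2: "continuous_map (prod_topology K ?T) ?T (\<lambda>(t, v). tower_scale (scale E) t v)"
    by (rule continuous_map_eq[OF continuous_map_Base[OF continuous_map_compose[OF b2 1(2)]]]) auto
  show ?case
    unfolding topological_module_def
    using c1 c2 E' by (auto simp: add.assoc add.commute tvs_diff(1)[OF K E])
next
  case (Suc j)
  note laws = topological_module_laws[OF Suc, simplified]
  let ?T = "tower_top K E j" and ?S = "tower_top K E (Suc j)"
  have a: "continuous_map (prod_topology ?T ?T) ?T (\<lambda>(u, v). tower_add u v)"
    and s: "continuous_map (prod_topology K ?T) ?T (\<lambda>(t, v). tower_scale (scale E) t v)"
    using Suc by (auto simp: topological_module_def)
  have k: "continuous_map (prod_topology K K) K (\<lambda>(a, b). a + b)"
    "continuous_map (prod_topology K K) K (\<lambda>(a, b). a * b)"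
    using K by (auto simp: topological_field_def)
  have pr: "continuous_map (prod_topology ?S ?S) (prod_topology X X) (\<lambda>z. (h (fst z), h (snd z)))"
    if "continuous_map ?S X h" for X and h :: "('b, 'a) tower \<Rightarrow> 'c"
    using continuous_map_compose[OF continuous_map_fst that] continuous_map_compose[OF continuous_map_snd that]
    by (intro continuous_map_pairedI) (auto simp: o_def)
  have pr': "continuous_map (prod_topology K ?S) (prod_topology K X) (\<lambda>z. (fst z, h (snd z)))"
    if "continuous_map ?S X h" for X and h :: "('b, 'a) tower \<Rightarrow> 'c"
    using continuous_map_compose[OF continuous_map_snd that]
    by (intro continuous_map_pairedI) (auto simp: o_def continuous_map_fst)
  have c1: "continuous_map (prod_topology ?S ?S) ?S (\<lambda>(u, v). tower_add u v)"
    by (rule continuous_map_eq[OF continuous_map_Step[OF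
            continuous_map_compose[OF pr[OF continuous_map_pt] a]
            continuous_map_compose[OF pr[OF continuous_map_dir] a]
            continuous_map_compose[OF pr[OF continuous_map_par] k(1)]]])
      (auto simp: topspace_tower_Suc)
  have c2: "continuous_map (prod_topology K ?S) ?S (\<lambda>(t, v). tower_scale (scale E) t v)"
    by (rule continuous_map_eq[OF continuous_map_Step[OF
            continuous_map_compose[OF pr'[OF continuous_map_pt] s]
            continuous_map_compose[OF pr'[OF continuous_map_dir] s]
            continuous_map_compose[OF pr'[OF continuous_map_par] k(2)]]])
      (auto simp: topspace_tower_Suc)
  show ?case
    unfolding topological_module_def vspace_simps
  proof (intro conjI ballI)
    fix u v assume "u \<in> topspace ?S" "v \<in> topspace ?S"
    then show "tower_add u v = tower_add v u"
      by (auto simp: topspace_tower_Suc laws(2) add.commute)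
  qed (use c1 c2 in \<open>auto simp: topspace_tower_Suc laws algebra_simps\<close>)
qed

lemma tvs_restrict_scalars:
  assumes "topological_field_extension F K" "topological_vector_space K E"
  shows "topological_vector_space F E"
proof -
  have F: "continuous_map F K (\<lambda>a. a)" "topspace F \<subseteq> topspace K"
    using assms(1) by (auto simp: topological_field_extension_def)
  have "continuous_map (prod_topology F (vtop E)) (prod_topology K (vtop E)) (\<lambda>z. (fst z, snd z))"
    using continuous_map_compose[OF continuous_map_fst F(1)]
    by (intro continuous_map_pairedI) (auto simp: o_def continuous_map_snd)
  moreover have "continuous_map (prod_topology K (vtop E)) (vtop E) (\<lambda>(a, v). scale E a v)"
    using assms(2) by (simp add: topological_vector_space_def)
  ultimately have "continuous_map (prod_topology F (vtop E)) (vtop E) (\<lambda>(a, v). scale E a v)"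
    using continuous_map_compose[of _ _ "\<lambda>z. (fst z, snd z)"] by (fastforce simp: o_def)
  then show ?thesis
    using assms(2) F(2) unfolding topological_vector_space_def by blast
qed

lemma tvs_prod:
  assumes "topological_vector_space K E1" "topological_vector_space K E2"
  shows "topological_vector_space K (prod_tvs E1 E2)"
proof -
  note 1 = tvsD[OF assms(1)] and 2 = tvsD[OF assms(2)]
  let ?P = "prod_topology (vtop E1) (vtop E2)"
  have c: "continuous_map (prod_topology (vtop E1) (vtop E1)) (vtop E1) (\<lambda>(v, w). v + w)"
    "continuous_map (prod_topology K (vtop E1)) (vtop E1) (\<lambda>(a, v). scale E1 a v)"
    "continuous_map (prod_topology (vtop E2) (vtop E2)) (vtop E2) (\<lambda>(v, w). v + w)"
    "continuous_map (prod_topology K (vtop E2)) (vtop E2) (\<lambda>(a, v). scale E2 a v)"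
    using assms by (auto simp: topological_vector_space_def)
  have p: "continuous_map (prod_topology X ?P) (vtop E1) (\<lambda>z. fst (snd z))"
    "continuous_map (prod_topology X ?P) (vtop E2) (\<lambda>z. snd (snd z))"
    "continuous_map (prod_topology ?P X) (vtop E1) (\<lambda>z. fst (fst z))"
    "continuous_map (prod_topology ?P X) (vtop E2) (\<lambda>z. snd (fst z))" for X :: "'z topology"
    by (rule continuous_map_compose[OF continuous_map_snd continuous_map_fst, unfolded o_def]
        continuous_map_compose[OF continuous_map_snd continuous_map_snd, unfolded o_def]
        continuous_map_compose[OF continuous_map_fst continuous_map_fst, unfolded o_def]
        continuous_map_compose[OF continuous_map_fst continuous_map_snd, unfolded o_def])+
  have "continuous_map (prod_topology ?P ?P) ?P (\<lambda>z. ((\<lambda>(v, w). v + w) (fst (fst z), fst (snd z)), (\<lambda>(v, w). v + w) (snd (fst z), snd (snd z))))"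
    using continuous_map_compose[OF continuous_map_pairedI[OF p(3) p(1)] c(1)]
      continuous_map_compose[OF continuous_map_pairedI[OF p(4) p(2)] c(3)]
    by (intro continuous_map_pairedI) (auto simp: o_def)
  moreover have "continuous_map (prod_topology K ?P) ?P (\<lambda>z. ((\<lambda>(a, v). scale E1 a v) (fst z, fst (snd z)), (\<lambda>(a, v). scale E2 a v) (fst z, snd (snd z))))"
    using continuous_map_compose[OF continuous_map_pairedI[OF continuous_map_fst p(1)] c(2)]
      continuous_map_compose[OF continuous_map_pairedI[OF continuous_map_fst p(2)] c(4)]
    by (intro continuous_map_pairedI) (auto simp: o_def)
  ultimately show ?thesis
    unfolding topological_vector_space_def
  proof (intro conjI)
    assume c: "continuous_map (prod_topology K ?P) ?P (\<lambda>z. ((\<lambda>(a, v). scale E1 a v) (fst z, fst (snd z)), (\<lambda>(a, v). scale E2 a v) (fst z, snd (snd z))))"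
    show "continuous_map (prod_topology K (vtop (prod_tvs E1 E2))) (vtop (prod_tvs E1 E2)) (\<lambda>(a, v). scale (prod_tvs E1 E2) a v)"
      using c by (simp add: prod_tvs_def case_prod_unfold)
    assume c: "continuous_map (prod_topology ?P ?P) ?P (\<lambda>z. ((\<lambda>(v, w). v + w) (fst (fst z), fst (snd z)), (\<lambda>(v, w). v + w) (snd (fst z), snd (snd z))))"
    show "continuous_map (prod_topology (vtop (prod_tvs E1 E2)) (vtop (prod_tvs E1 E2))) (vtop (prod_tvs E1 E2)) (\<lambda>(v, w). v + w)"
      using c by (simp add: prod_tvs_def case_prod_unfold plus_prod_def)
  qed (auto simp: prod_tvs_def zero_prod_def Hausdorff_space_prod_topology 1 2)
qed

section \<open>Families of differentiable maps\<close>

text \<open>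
  The equation \<open>g(x + t v) = g(x) + t h(x, v, t)\<close> needs no subtraction in the codomain, and for
  \<open>t = 0\<close> it holds trivially.
\<close>

definition difference_quotient :: "'k::field topology \<Rightarrow> ('z::ab_group_add, 'k) tvs \<Rightarrow> ('w, 'k) vspace \<Rightarrow>
    'y topology \<Rightarrow> nat \<Rightarrow> ('z, 'k) tower set \<Rightarrow> ('y \<Rightarrow> ('z, 'k) tower \<Rightarrow> 'w) \<Rightarrow>
    ('y \<Rightarrow> ('z, 'k) tower \<Rightarrow> 'w) \<Rightarrow> bool" where
  "difference_quotient F Z A Y j V g h \<longleftrightarrow>
     (\<forall>y\<in>topspace Y. \<forall>x v t. Step x v t \<in> ext_dom F Z j V \<longrightarrow>
        g y (tower_move Z x t v) =
          vs_plus A (g y x) (vs_smult A t (h y (Step x v t))))"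

text \<open>
  Here \<open>V\<close> lies in level \<open>j\<close> of the tower and the recursion peels off the first quotient, that is,
  \<open>g\<close> is \<open>C\<^bsup>n+1\<^esup>\<close> iff \<open>g\<^bsup>[1]\<^esup>\<close> is \<open>C\<^sup>n\<close>. Maps without a parameter are families over a point.
\<close>

primrec Ck_family :: "'k::field topology \<Rightarrow> ('z::ab_group_add, 'k) tvs \<Rightarrow> ('w, 'k) vspace \<Rightarrow>
    'y topology \<Rightarrow> nat \<Rightarrow> nat \<Rightarrow> ('z, 'k) tower set \<Rightarrow> ('y \<Rightarrow> ('z, 'k) tower \<Rightarrow> 'w) \<Rightarrow> bool" where
  "Ck_family F Z A Y 0 j V g \<longleftrightarrow>
     V \<subseteq> topspace (tower_top F Z j) \<and>
     continuous_family Y (tower_on F Z j V) (vs_top A) g"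
| "Ck_family F Z A Y (Suc n) j V g \<longleftrightarrow>
     V \<subseteq> topspace (tower_top F Z j) \<and>
     continuous_family Y (tower_on F Z j V) (vs_top A) g \<and>
     (\<exists>h. difference_quotient F Z A Y j V g h \<and>
          Ck_family F Z A Y n (Suc j) (ext_dom F Z j V) h)"

lemma difference_quotientD:
  assumes "difference_quotient F Z A Y j V g h" "y \<in> topspace Y" "Step x v t \<in> ext_dom F Z j V"
  shows "g y (tower_move Z x t v) =
      vs_plus A (g y x) (vs_smult A t (h y (Step x v t)))"
  using assms by (auto simp: difference_quotient_def)

lemma Step_in_ext_dom:
  "Step x v t \<in> ext_dom F Z j V \<longleftrightarrow> x \<in> V \<and> v \<in> topspace (tower_top F Z j) \<and> t \<in> topspace F \<and>
     tower_move Z x t v \<in> V"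
  by (auto simp: ext_dom_def)

lemma ext_domE:
  assumes "p \<in> ext_dom F Z j V"
  obtains x v t where "p = Step x v t" "Step x v t \<in> ext_dom F Z j V" "x \<in> V"
    "v \<in> topspace (tower_top F Z j)" "t \<in> topspace F"
    "tower_move Z x t v \<in> V"
  using assms by (auto simp: ext_dom_def)

lemma ext_dom_mono: "V \<subseteq> V' \<Longrightarrow> ext_dom F Z j V \<subseteq> ext_dom F Z j V'"
  by (auto simp: ext_dom_def)

lemma ext_dom_subset:
  "V \<subseteq> topspace (tower_top F Z j) \<Longrightarrow> ext_dom F Z j V \<subseteq> topspace (tower_top F Z (Suc j))"
  by (auto simp: ext_dom_def)

lemma Ck_family_continuous:
  assumes "Ck_family F Z A Y n j V g"
  shows "continuous_family Y (tower_on F Z j V) (vs_top A) g"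
  using assms by (cases n) auto

lemma Ck_family_subset: "Ck_family F Z A Y n j V g \<Longrightarrow> V \<subseteq> topspace (tower_top F Z j)"
  by (cases n) auto

lemma Ck_family_mem:
  assumes "Ck_family F Z A Y n j V g" "y \<in> topspace Y" "x \<in> V"
  shows "g y x \<in> topspace (vs_top A)"
  using continuous_familyD(3)[OF Ck_family_continuous[OF assms(1)] assms(2)]
    assms(3) Ck_family_subset[OF assms(1)] by auto

lemma Ck_family_SucI:
  assumes "V \<subseteq> topspace (tower_top F Z j)"
    and "continuous_family Y (tower_on F Z j V) (vs_top A) g"
    and "\<And>y x v t. y \<in> topspace Y \<Longrightarrow> Step x v t \<in> ext_dom F Z j V \<Longrightarrow>
      g y (tower_move Z x t v) =
        vs_plus A (g y x) (vs_smult A t (h y (Step x v t)))"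
    and "Ck_family F Z A Y n (Suc j) (ext_dom F Z j V) h"
  shows "Ck_family F Z A Y (Suc n) j V g"
  using assms by (auto simp: difference_quotient_def)

lemma Ck_family_SucE:
  assumes "Ck_family F Z A Y (Suc n) j V g"
  obtains h where "difference_quotient F Z A Y j V g h"
    and "Ck_family F Z A Y n (Suc j) (ext_dom F Z j V) h"
  using assms by auto

text \<open>The recursion removes quotients from the front, so lowering the order cuts the chain at
  its far end: the first quotient stays and the induction shortens the rest.\<close>

lemma Ck_family_SucD: "Ck_family F Z A Y (Suc n) j V g \<Longrightarrow> Ck_family F Z A Y n j V g"
proof (induction n arbitrary: j V g)
  case (Suc n)
  from Suc.prems obtain h where h0: "difference_quotient F Z A Y j V g h"
    "Ck_family F Z A Y (Suc n) (Suc j) (ext_dom F Z j V) h"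
    by (rule Ck_family_SucE)
  note h = difference_quotientD[OF h0(1)] h0(2)
  then show ?case
    using Suc.IH Ck_family_subset[OF Suc.prems] Ck_family_continuous[OF Suc.prems]
    by (intro Ck_family_SucI[where h = h]) auto
qed auto

text \<open>Both ends of an increment lie in \<open>V\<close>, so a quotient \<open>h\<close> of
  \<open>g\<close> also serves for \<open>g'\<close>, and the rest of the chain is
  unchanged.\<close>

lemma Ck_family_cong:
  assumes "Ck_family F Z A Y n j V g"
    and "\<And>y x. y \<in> topspace Y \<Longrightarrow> x \<in> V \<Longrightarrow> g y x = g' y x"
  shows "Ck_family F Z A Y n j V g'"
proof -
  have c: "continuous_family Y (tower_on F Z j V) (vs_top A) g'"
    by (rule continuous_family_cong[OF Ck_family_continuous[OF assms(1)]]) (auto simp: assms(2))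
  show ?thesis
  proof (cases n)
    case 0
    then show ?thesis using c assms(1) by simp
  next
    case (Suc m)
    from assms(1)[unfolded Suc] obtain h where h0: "difference_quotient F Z A Y j V g h"
    "Ck_family F Z A Y m (Suc j) (ext_dom F Z j V) h"
    by (rule Ck_family_SucE)
  note h = difference_quotientD[OF h0(1)] h0(2)
    show ?thesis
      unfolding Suc
    proof (rule Ck_family_SucI[OF Ck_family_subset[OF assms(1)] c _ h(2)])
      fix y x v t assume y: "y \<in> topspace Y" and s: "Step x v t \<in> ext_dom F Z j V"
      then show "g' y (tower_move Z x t v) =
          vs_plus A (g' y x) (vs_smult A t (h y (Step x v t)))"
        using h(1)[OF y s] assms(2)[OF y] by (simp add: Step_in_ext_dom)
    qed
  qed
qed

lemma Ck_family_mono: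
  assumes "Ck_family F Z A Y n j V g" "V' \<subseteq> V"
  shows "Ck_family F Z A Y n j V' g"
  using assms
proof (induction n arbitrary: j V V' g)
  case 0
  then show ?case using continuous_family_subtopology by (auto intro: continuous_family_subtopology)
next
  case (Suc n)
  from Suc.prems(1) obtain h where h0: "difference_quotient F Z A Y j V g h"
    "Ck_family F Z A Y n (Suc j) (ext_dom F Z j V) h"
    by (rule Ck_family_SucE)
  note h = difference_quotientD[OF h0(1)] h0(2)
  show ?case
  proof (rule Ck_family_SucI[where h = h])
    show "V' \<subseteq> topspace (tower_top F Z j)" using Ck_family_subset[OF Suc.prems(1)] Suc.prems(2) by blast
    show "continuous_family Y (tower_on F Z j V') (vs_top A) g"
      by (rule continuous_family_subtopology[OF Ck_family_continuous[OF Suc.prems(1)] Suc.prems(2)])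
    show "Ck_family F Z A Y n (Suc j) (ext_dom F Z j V') h"
      by (rule Suc.IH[OF h(2) ext_dom_mono[OF Suc.prems(2)]])
  qed (use h(1) ext_dom_mono[OF Suc.prems(2)] in blast)
qed

lemma Ck_family_pullback:
  assumes "Ck_family F Z A Y n j V g" "continuous_map Y' Y u"
  shows "Ck_family F Z A Y' n j V (\<lambda>y. g (u y))"
  using assms(1)
proof (induction n arbitrary: j V g)
  case 0
  then show ?case using continuous_family_pullback[OF _ assms(2)] by auto
next
  case (Suc n)
  from Suc.prems(1) obtain h where h0: "difference_quotient F Z A Y j V g h"
    "Ck_family F Z A Y n (Suc j) (ext_dom F Z j V) h"
    by (rule Ck_family_SucE)
  note h = difference_quotientD[OF h0(1)] h0(2)
  have "u y \<in> topspace Y" if "y \<in> topspace Y'" for y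
    using assms(2) that by (auto simp: continuous_map_def)
  then show ?case
    by (intro Ck_family_SucI[where h = "\<lambda>y. h (u y)"] Suc.IH[OF h(2)] h(1)
        Ck_family_subset[OF Suc.prems] continuous_family_pullback[OF Ck_family_continuous[OF Suc.prems] assms(2)])
qed

text \<open>As the record has no zero, \<open>z\<close> stands for a vector whose multiples are
  neutral. It is the constant value of the first quotient, to which the induction hypothesis applies
  again.\<close>

lemma Ck_family_constant:
  assumes "continuous_map Y (vs_top A) c" "V \<subseteq> topspace (tower_top F Z j)"
    and "z \<in> topspace (vs_top A)"
    and "\<And>t v. t \<in> topspace F \<Longrightarrow> v \<in> topspace (vs_top A) \<Longrightarrow> vs_plus A v (vs_smult A t z) = v"
  shows "Ck_family F Z A Y n j V (\<lambda>y _. c y)"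
  using assms(1,2)
proof (induction n arbitrary: j V c)
  case 0
  then show ?case by (auto intro: continuous_family_constant)
next
  case (Suc n)
  have z: "continuous_map Y (vs_top A) (\<lambda>_. z)" using assms(3) by simp
  show ?case
    by (rule Ck_family_SucI[OF _ _ _ Suc.IH[OF z ext_dom_subset[OF Suc.prems(2)]]])
      (use Suc.prems assms(4) in \<open>auto simp: Step_in_ext_dom continuous_map_def Pi_iff intro: continuous_family_constant\<close>)
qed

text \<open>The quotient of a linear map is the map applied to the direction,
  \<open>l (dir p)\<close>, which is linear on the next level; hence every order is reached.\<close>

lemma Ck_family_linear:
  assumes "continuous_map (tower_top F Z j) (vs_top A) l" "V \<subseteq> topspace (tower_top F Z j)"
    and "\<And>x v t. x \<in> topspace (tower_top F Z j) \<Longrightarrow> v \<in> topspace (tower_top F Z j) \<Longrightarrow>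
      t \<in> topspace F \<Longrightarrow>
      l (tower_move Z x t v) = vs_plus A (l x) (vs_smult A t (l v))"
  shows "Ck_family F Z A Y n j V (\<lambda>_. l)"
  using assms
proof (induction n arbitrary: j V l)
  case 0
  then show ?case by (auto intro: continuous_family_map continuous_map_from_subtopology)
next
  case (Suc n)
  have "Ck_family F Z A Y n (Suc j) (ext_dom F Z j V) (\<lambda>_ p. l (dir p))"
  proof (rule Suc.IH)
    show "continuous_map (tower_top F Z (Suc j)) (vs_top A) (\<lambda>p. l (dir p))"
      using continuous_map_compose[OF continuous_map_dir Suc.prems(1)] by (simp add: o_def)
  qed (use Suc.prems in \<open>auto simp: topspace_tower_Suc ext_dom_def\<close>)
  then show ?case
    by (rule Ck_family_SucI[rotated -1])
     (use Suc.prems in \<open>auto simp: Step_in_ext_dom intro!: continuous_family_map continuous_map_from_subtopology\<close>)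
qed

text \<open>The condition on \<open>l\<close> has the shape of the quotient equation, so applying
  \<open>l\<close> to a quotient of \<open>g\<close> gives a quotient of the composite.\<close>

lemma Ck_family_linop:
  assumes "Ck_family F Z A Y n j V g" "continuous_map (vs_top A) (vs_top B) l"
    and "\<And>u v t. u \<in> topspace (vs_top A) \<Longrightarrow> v \<in> topspace (vs_top A) \<Longrightarrow> t \<in> topspace F \<Longrightarrow>
      l (vs_plus A u (vs_smult A t v)) = vs_plus B (l u) (vs_smult B t (l v))"
  shows "Ck_family F Z B Y n j V (\<lambda>y x. l (g y x))"
  using assms(1)
proof (induction n arbitrary: j V g)
  case 0
  then show ?case by (auto intro: continuous_family_compose_map[OF _ assms(2)])
next
  case (Suc n)
  from Suc.prems(1) obtain h where h0: "difference_quotient F Z A Y j V g h"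
    "Ck_family F Z A Y n (Suc j) (ext_dom F Z j V) h"
    by (rule Ck_family_SucE)
  note h = difference_quotientD[OF h0(1)] h0(2)
  show ?case
  proof (rule Ck_family_SucI[OF Ck_family_subset[OF Suc.prems] _ _ Suc.IH[OF h(2)]])
    show "continuous_family Y (tower_on F Z j V) (vs_top B) (\<lambda>y x. l (g y x))"
      by (rule continuous_family_compose_map[OF Ck_family_continuous[OF Suc.prems] assms(2)])
    fix y x v t assume y: "y \<in> topspace Y" and s: "Step x v t \<in> ext_dom F Z j V"
    show "l (g y (tower_move Z x t v)) =
        vs_plus B (l (g y x)) (vs_smult B t (l (h y (Step x v t))))"
      unfolding h(1)[OF y s]
      by (rule assms(3)[OF Ck_family_mem[OF Suc.prems y] Ck_family_mem[OF h(2) y s]])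
        (use s in \<open>auto simp: Step_in_ext_dom\<close>)
  qed
qed

lemma Ck_family_pair:
  assumes "Ck_family F Z A Y n j V g1" "Ck_family F Z B Y n j V g2"
  shows "Ck_family F Z (prod_vs A B) Y n j V (\<lambda>y x. (g1 y x, g2 y x))"
  using assms
proof (induction n arbitrary: j V g1 g2)
  case 0
  then show ?case by (auto intro: continuous_family_pair)
next
  case (Suc n)
  from Suc.prems(1) obtain h1 where h10: "difference_quotient F Z A Y j V g1 h1"
    "Ck_family F Z A Y n (Suc j) (ext_dom F Z j V) h1"
    by (rule Ck_family_SucE)
  note h1 = difference_quotientD[OF h10(1)] h10(2)
  from Suc.prems(2) obtain h2 where h20: "difference_quotient F Z B Y j V g2 h2"
    "Ck_family F Z B Y n (Suc j) (ext_dom F Z j V) h2"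
    by (rule Ck_family_SucE)
  note h2 = difference_quotientD[OF h20(1)] h20(2)
  show ?case
    by (rule Ck_family_SucI[OF Ck_family_subset[OF Suc.prems(1)] _ _ Suc.IH[OF h1(2) h2(2)]])
      (use h1(1) h2(1) Ck_family_continuous[OF Suc.prems(1)] Ck_family_continuous[OF Suc.prems(2)]
        in \<open>auto intro: continuous_family_pair\<close>)
qed

text \<open>Forming the triple is a continuous linear map on the product of the three
  modules.\<close>

lemma Ck_family_Step:
  assumes "Ck_family F Z (tower_vs K E i) Y n j V a" "Ck_family F Z (tower_vs K E i) Y n j V b"
    and "Ck_family F Z (scalar_vs K) Y n j V c"
  shows "Ck_family F Z (tower_vs K E (Suc i)) Y n j V (\<lambda>y x. Step (a y x) (b y x) (c y x))"
proof -
  have "continuous_map (prod_topology (tower_top K E i) (prod_topology (tower_top K E i) K))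
      (tower_top K E (Suc i)) (\<lambda>u. Step (fst u) (fst (snd u)) (snd (snd u)))"
    using continuous_map_compose[OF continuous_map_snd continuous_map_fst]
      continuous_map_compose[OF continuous_map_snd continuous_map_snd]
    by (intro continuous_map_Step) (simp_all add: o_def continuous_map_fst)
  then show ?thesis
    using Ck_family_linop[OF Ck_family_pair[OF assms(1) Ck_family_pair[OF assms(2,3)]],
        of "tower_vs K E (Suc i)" "\<lambda>u. Step (fst u) (fst (snd u)) (snd (snd u))"] by simp
qed

text \<open>For linear \<open>\<alpha>\<close> the quotient of the composite is \<open>f^[1]\<close>
  after the map that applies \<open>\<alpha>\<close> to point and direction and keeps the parameter;
  that map is linear again. The linear case comes before the general chain rules because these
  already use the projection \<open>pt\<close>.\<close>

lemma Ck_family_inner_linear: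
  assumes "Ck_family F Z A Y n j V f" "W \<subseteq> topspace (tower_top F Z' l)" "\<alpha> ` W \<subseteq> V"
    and "continuous_map (tower_top F Z' l) (tower_top F Z j) \<alpha>"
    and "\<And>x v t. x \<in> topspace (tower_top F Z' l) \<Longrightarrow> v \<in> topspace (tower_top F Z' l) \<Longrightarrow>
      t \<in> topspace F \<Longrightarrow> \<alpha> (tower_move Z' x t v) =
        tower_move Z (\<alpha> x) t (\<alpha> v)"
  shows "Ck_family F Z' A Y n l W (\<lambda>y x. f y (\<alpha> x))"
  using assms
proof (induction n arbitrary: j V f l W \<alpha>)
  case 0
  have "continuous_map (tower_on F Z' l W) (tower_on F Z j V) \<alpha>"
    using 0 by (auto simp: continuous_map_in_subtopology continuous_map_from_subtopology)
  from continuous_family_inner[OF _ this, of Y "vs_top A" f] show ?case using 0 by simp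
next
  case (Suc n)
  from Suc.prems(1) obtain f' where f'0: "difference_quotient F Z A Y j V f f'"
    "Ck_family F Z A Y n (Suc j) (ext_dom F Z j V) f'"
    by (rule Ck_family_SucE)
  note f' = difference_quotientD[OF f'0(1)] f'0(2)
  have a: "\<alpha> x \<in> topspace (tower_top F Z j)" if "x \<in> topspace (tower_top F Z' l)" for x
    using Suc.prems(4) that by (auto simp: continuous_map_def)
  define \<beta> where "\<beta> = (\<lambda>p. Step (\<alpha> (pt p)) (\<alpha> (dir p)) (par p))"
  have "Ck_family F Z' A Y n (Suc l) (ext_dom F Z' l W) (\<lambda>y x. f' y (\<beta> x))"
  proof (rule Suc.IH[OF f'(2)])
    show "ext_dom F Z' l W \<subseteq> topspace (tower_top F Z' (Suc l))"
      by (rule ext_dom_subset[OF Suc.prems(2)])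
    show "\<beta> ` ext_dom F Z' l W \<subseteq> ext_dom F Z j V"
      using Suc.prems(2,3) a by (fastforce simp: \<beta>_def ext_dom_def subset_iff simp flip: Suc.prems(5))
    show "continuous_map (tower_top F Z' (Suc l)) (tower_top F Z (Suc j)) \<beta>"
      unfolding \<beta>_def
      using continuous_map_compose[OF continuous_map_pt Suc.prems(4)]
        continuous_map_compose[OF continuous_map_dir Suc.prems(4)]
      by (intro continuous_map_Step) (simp_all add: o_def continuous_map_par)
  qed (auto simp: \<beta>_def topspace_tower_Suc Suc.prems(5))
  then show ?case
  proof (rule Ck_family_SucI[OF Suc.prems(2), rotated -1])
    have "continuous_map (tower_on F Z' l W) (tower_on F Z j V) \<alpha>"
      using Suc.prems by (auto simp: continuous_map_in_subtopology continuous_map_from_subtopology)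
    then show "continuous_family Y (tower_on F Z' l W) (vs_top A) (\<lambda>y x. f y (\<alpha> x))"
      by (rule continuous_family_inner[OF Ck_family_continuous[OF Suc.prems(1)]])
    fix y x v t assume y: "y \<in> topspace Y" and s: "Step x v t \<in> ext_dom F Z' l W"
    then have *: "x \<in> topspace (tower_top F Z' l)" "v \<in> topspace (tower_top F Z' l)" "t \<in> topspace F"
      using Suc.prems(2) by (auto simp: Step_in_ext_dom)
    have "Step (\<alpha> x) (\<alpha> v) t \<in> ext_dom F Z j V"
      using s Suc.prems(3) a * by (auto simp: Step_in_ext_dom simp flip: Suc.prems(5))
    from f'(1)[OF y this]
    show "f y (\<alpha> (tower_move Z' x t v)) =
        vs_plus A (f y (\<alpha> x)) (vs_smult A t (f' y (\<beta> (Step x v t))))"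
      by (simp add: \<beta>_def Suc.prems(5)[OF *])
  qed
qed

lemma Ck_family_pt:
  assumes "Ck_family F Z A Y n j V g"
  shows "Ck_family F Z A Y n (Suc j) (ext_dom F Z j V) (\<lambda>y p. g y (pt p))"
  by (rule Ck_family_inner_linear[OF assms ext_dom_subset[OF Ck_family_subset[OF assms]]])
    (auto simp: continuous_map_pt topspace_tower_Suc ext_dom_def)

text \<open>The increment \<open>t\<close> lives in \<open>F\<close> but is needed as a scalar of
  \<open>K\<close>; the inclusion is continuous and linear over \<open>F\<close>.\<close>

lemma Ck_family_par:
  assumes "continuous_map F K (\<lambda>a. a)" "V \<subseteq> topspace (tower_top F Z (Suc j))"
  shows "Ck_family F Z (scalar_vs K) Y n (Suc j) V (\<lambda>_. par)"
  by (rule Ck_family_linear)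
    (use assms continuous_map_compose[OF continuous_map_par assms(1)] in \<open>auto simp: o_def topspace_tower_Suc\<close>)

abbreviation (input) point :: "unit topology" where
  "point \<equiv> discrete_topology UNIV"

lemma continuous_map_point_family:
  "continuous_family point X T (\<lambda>_. f) \<longleftrightarrow> continuous_map X T f"
  by (auto intro: continuous_family_map dest: continuous_familyD(1))

text \<open>
  In this chain rule the outer map must not depend on the parameter: evaluation is not jointly
  continuous for the compact-open topology, so two families cannot be composed.
\<close>

lemma Ck_family_outer:
  assumes FK: "continuous_map F K (\<lambda>a. a)"
    and "Ck_family K E A point n i W (\<lambda>_. f)"
    and "Ck_family F Z (tower_vs K E i) Y n j V g"
    and "\<And>y x. y \<in> topspace Y \<Longrightarrow> x \<in> V \<Longrightarrow> g y x \<in> W"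
  shows "Ck_family F Z A Y n j V (\<lambda>y x. f (g y x))"
  using assms(2-)
proof (induction n arbitrary: i W f j V g)
  case 0
  then show ?case
    using continuous_family_outer[of Y "tower_on F Z j V" "tower_top K E i" g W "vs_top A" f]
    by (auto simp: continuous_map_point_family)
next
  case (Suc n)
  from Suc.prems(1) obtain f' where f'0: "difference_quotient K E A point i W (\<lambda>_. f) f'"
    "Ck_family K E A point n (Suc i) (ext_dom K E i W) f'"
    by (rule Ck_family_SucE)
  note f' = difference_quotientD[OF f'0(1), of "()", simplified] f'0(2)
  from Suc.prems(2) obtain g' where g'0: "difference_quotient F Z (tower_vs K E i) Y j V g g'"
    "Ck_family F Z (tower_vs K E i) Y n (Suc j) (ext_dom F Z j V) g'"
    by (rule Ck_family_SucE)
  note g' = difference_quotientD[OF g'0(1), simplified] g'0(2)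
  \<comment> \<open>The quotient of the composite is \<open>f^[1](g(x), g^[1](x, v, t), t)\<close>,
    and \<open>G\<close> is this triple. It lies in the domain of \<open>f^[1]\<close> because
    \<open>g(x) + t g^[1](x, v, t) = g(x + t v)\<close>.\<close>
  define G where "G = (\<lambda>y p. Step (g y (pt p)) (g' y p) (par p))"
  have G: "G y (Step x v t) \<in> ext_dom K E i W"
    if y: "y \<in> topspace Y" and s: "Step x v t \<in> ext_dom F Z j V" for y x v t
  proof -
    have s': "x \<in> V" "tower_move Z x t v \<in> V" "t \<in> topspace F"
      using s by (auto simp: Step_in_ext_dom)
    have "t \<in> topspace K" using FK s'(3) by (auto simp: continuous_map_def Pi_iff)
    then show ?thesis
      using Suc.prems(3)[OF y s'(1)] Suc.prems(3)[OF y s'(2)] g'(1)[OF y s] Ck_family_mem[OF g'(2) y s]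
      by (simp add: G_def Step_in_ext_dom)
  qed
  have "Ck_family F Z A Y n (Suc j) (ext_dom F Z j V) (\<lambda>y x. f' () (G y x))"
  proof (rule Suc.IH)
    have "f' = (\<lambda>_. f' ())" by auto
    then show "Ck_family K E A point n (Suc i) (ext_dom K E i W) (\<lambda>_. f' ())" using f'(2) by metis
    show "Ck_family F Z (tower_vs K E (Suc i)) Y n (Suc j) (ext_dom F Z j V) G"
      unfolding G_def
      by (intro Ck_family_Step Ck_family_pt g'(2) Ck_family_SucD[OF Suc.prems(2)] Ck_family_par FK
          ext_dom_subset[OF Ck_family_subset[OF Suc.prems(2)]])
    fix y p assume y: "y \<in> topspace Y" and "p \<in> ext_dom F Z j V"
    from this(2) show "G y p \<in> ext_dom K E i W" by (rule ext_domE) (simp add: G[OF y])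
  qed
  then show ?case
  proof (rule Ck_family_SucI[rotated -1])
    show "V \<subseteq> topspace (tower_top F Z j)" by (rule Ck_family_subset[OF Suc.prems(2)])
    show "continuous_family Y (tower_on F Z j V) (vs_top A) (\<lambda>y x. f (g y x))"
      by (rule continuous_family_outer[OF Ck_family_continuous[OF Suc.prems(2)], of W])
        (use Ck_family_continuous[OF Suc.prems(1)] Suc.prems(3) in \<open>auto simp: continuous_map_point_family\<close>)
    fix y x v t assume y: "y \<in> topspace Y" and s: "Step x v t \<in> ext_dom F Z j V"
    show "f (g y (tower_move Z x t v)) =
        vs_plus A (f (g y x)) (vs_smult A t (f' () (G y (Step x v t))))"
      unfolding g'(1)[OF y s] using f'(1)[OF G[OF y s, unfolded G_def, simplified]] by (simp add: G_def)
  qed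
qed

text \<open>Here the family is outside and \<open>\<alpha>\<close> is a single map, so compact sets
  are pushed forward by one continuous map and the obstruction to composing two families does not
  arise. The quotient is given by the same triple as in \<open>Ck_family_outer\<close>.\<close>

lemma Ck_family_inner:
  assumes "Ck_family F Z A Y n j V f"
    and "Ck_family F Z' (tower_vs F Z j) point n l W (\<lambda>_. \<alpha>)"
    and "\<alpha> ` W \<subseteq> V"
  shows "Ck_family F Z' A Y n l W (\<lambda>y x. f y (\<alpha> x))"
  using assms
proof (induction n arbitrary: j V f l W \<alpha>)
  case 0
  then have "continuous_map (tower_on F Z' l W) (tower_on F Z j V) \<alpha>"
    by (auto simp: continuous_map_point_family continuous_map_in_subtopology)
  from continuous_family_inner[OF _ this, of Y "vs_top A" f] show ?case using 0 by simp
next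
  case (Suc n)
  from Suc.prems(1) obtain f' where f'0: "difference_quotient F Z A Y j V f f'"
    "Ck_family F Z A Y n (Suc j) (ext_dom F Z j V) f'"
    by (rule Ck_family_SucE)
  note f' = difference_quotientD[OF f'0(1)] f'0(2)
  from Suc.prems(2) obtain g' where g'0: "difference_quotient F Z' (tower_vs F Z j) point l W (\<lambda>_. \<alpha>) g'"
    "Ck_family F Z' (tower_vs F Z j) point n (Suc l) (ext_dom F Z' l W) g'"
    by (rule Ck_family_SucE)
  note g' = difference_quotientD[OF g'0(1), of "()", simplified] g'0(2)
  define G where "G = (\<lambda>p. Step (\<alpha> (pt p)) (g' () p) (par p))"
  have G: "G (Step x v t) \<in> ext_dom F Z j V"
    if s: "Step x v t \<in> ext_dom F Z' l W" for x v t
  proof -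
    have "g' () (Step x v t) \<in> topspace (tower_top F Z j)"
      using Ck_family_mem[OF g'(2) _ s] by simp
    then show ?thesis
      using Suc.prems(3) s g'(1)[OF s] by (auto simp: G_def Step_in_ext_dom)
  qed
  have "Ck_family F Z' A Y n (Suc l) (ext_dom F Z' l W) (\<lambda>y x. f' y (G x))"
  proof (rule Suc.IH[OF f'(2)])
    have 1: "g' = (\<lambda>_. g' ())" by auto
    have 2: "Ck_family F Z' (tower_vs F Z j) point n (Suc l) (ext_dom F Z' l W) (\<lambda>_. g' ())"
      using g'(2) 1 by metis
    show "Ck_family F Z' (tower_vs F Z (Suc j)) point n (Suc l) (ext_dom F Z' l W) (\<lambda>_. G)"
      unfolding G_def
      by (rule Ck_family_Step[OF Ck_family_pt[OF Ck_family_SucD[OF Suc.prems(2)]] 2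
            Ck_family_par[OF continuous_map_ident
              ext_dom_subset[OF Ck_family_subset[OF Suc.prems(2)]]]])
    show "G ` ext_dom F Z' l W \<subseteq> ext_dom F Z j V"
    proof clarify
      fix p assume "p \<in> ext_dom F Z' l W"
      then show "G p \<in> ext_dom F Z j V" by (rule ext_domE) (simp add: G)
    qed
  qed
  then show ?case
  proof (rule Ck_family_SucI[rotated -1])
    show "W \<subseteq> topspace (tower_top F Z' l)" by (rule Ck_family_subset[OF Suc.prems(2)])
    have "continuous_map (tower_on F Z' l W) (tower_on F Z j V) \<alpha>"
      using Ck_family_continuous[OF Suc.prems(2)] Suc.prems(3)
      by (auto simp: continuous_map_point_family continuous_map_in_subtopology)
    then show "continuous_family Y (tower_on F Z' l W) (vs_top A) (\<lambda>y x. f y (\<alpha> x))"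
      by (rule continuous_family_inner[OF Ck_family_continuous[OF Suc.prems(1)]])
    fix y x v t assume y: "y \<in> topspace Y" and s: "Step x v t \<in> ext_dom F Z' l W"
    show "f y (\<alpha> (tower_move Z' x t v)) =
        vs_plus A (f y (\<alpha> x)) (vs_smult A t (f' y (G (Step x v t))))"
      unfolding g'(1)[OF s] using f'(1)[OF y G[OF s, unfolded G_def, simplified]] by (simp add: G_def)
  qed
qed

section \<open>Sums, products and locality\<close>

text \<open>This is what makes the addition map on pairs additive, so that sums of families can be
  treated by \<open>Ck_family_linop\<close>.\<close>

lemma topological_module_interchange:
  assumes A: "topological_module K A"
    and "a \<in> topspace (vs_top A)" "b \<in> topspace (vs_top A)" "c \<in> topspace (vs_top A)" "d \<in> topspace (vs_top A)"
  shows "vs_plus A (vs_plus A a b) (vs_plus A c d) = vs_plus A (vs_plus A a c) (vs_plus A b d)"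
proof -
  note cl = topological_module_closed[OF A] and laws = topological_module_laws[OF A]
  have "vs_plus A (vs_plus A a b) (vs_plus A c d) = vs_plus A a (vs_plus A (vs_plus A b c) d)"
    using assms by (simp add: cl laws(1))
  also have "vs_plus A b c = vs_plus A c b" using assms by (intro laws(2))
  finally show ?thesis using assms by (simp add: cl laws(1))
qed

text \<open>The Leibniz rule for difference quotients: the factor after \<open>t\<close> on the
  right is the quotient of the product. Its last term keeps a further factor \<open>t\<close>
  because the increment is not infinitesimal.\<close>

lemma topological_module_product_expand:
  assumes K: "topological_field K" and A: "topological_module K A"
    and m: "c \<in> topspace K" "c' \<in> topspace K" "t \<in> topspace K" "g \<in> topspace (vs_top A)" "g' \<in> topspace (vs_top A)"
  shows "vs_smult A (c + t * c') (vs_plus A g (vs_smult A t g')) =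
    vs_plus A (vs_smult A c g) (vs_smult A t (vs_plus A
      (vs_plus A (vs_smult A c' g) (vs_smult A c g')) (vs_smult A t (vs_smult A c' g'))))"
proof -
  note cl = topological_module_closed[OF A] and laws = topological_module_laws[OF A]
    and K' = topological_fieldD[OF K]
  have tc: "vs_smult A (t * c') (vs_plus A g (vs_smult A t g')) =
      vs_smult A t (vs_plus A (vs_smult A c' g) (vs_smult A t (vs_smult A c' g')))"
    using m by (simp add: cl laws(4) K' mult.commute mult.left_commute flip: laws(6))
  have c: "vs_smult A c (vs_plus A g (vs_smult A t g')) =
      vs_plus A (vs_smult A c g) (vs_smult A t (vs_smult A c g'))"
    using m by (simp add: cl laws(4) K' mult.commute flip: laws(6))
  have i: "vs_plus A (vs_plus A (vs_smult A c' g) (vs_smult A c g')) (vs_smult A t (vs_smult A c' g')) =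
      vs_plus A (vs_smult A c g') (vs_plus A (vs_smult A c' g) (vs_smult A t (vs_smult A c' g')))"
  proof -
    have "vs_plus A (vs_smult A c' g) (vs_smult A c g') = vs_plus A (vs_smult A c g') (vs_smult A c' g)"
      using m by (intro laws(2)) (simp_all add: cl)
    then show ?thesis using m by (simp add: cl laws(1))
  qed
  show ?thesis
    unfolding i using m by (simp add: cl laws(5) K' tc c) (simp add: cl laws(1,4) K')
qed

lemma Ck_family_plus:
  assumes FK: "topspace F \<subseteq> topspace K" and A: "topological_module K A"
    and "Ck_family F Z A Y n j V g1" "Ck_family F Z A Y n j V g2"
  shows "Ck_family F Z A Y n j V (\<lambda>y x. vs_plus A (g1 y x) (g2 y x))"
proof -
  have "continuous_map (vs_top (prod_vs A A)) (vs_top A) (\<lambda>u. vs_plus A (fst u) (snd u))"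
    using A by (auto simp: topological_module_def case_prod_unfold)
  from Ck_family_linop[OF Ck_family_pair[OF assms(3,4)] this] show ?thesis
    using FK topological_module_interchange[OF A] topological_module_laws(4)[OF A]
      topological_module_closed[OF A] by (auto simp: subset_iff)
qed

text \<open>By the Leibniz rule the quotient of the product is a sum of products of
  \<open>c\<close>, \<open>g\<close>, their quotients and \<open>t\<close>. Each factor is available
  with one order less, so the induction hypothesis covers every term.\<close>

lemma Ck_family_smult:
  assumes FK: "continuous_map F K (\<lambda>a. a)" and K: "topological_field K" and A: "topological_module K A"
    and "Ck_family F Z (scalar_vs K) Y n j V c" "Ck_family F Z A Y n j V g"
  shows "Ck_family F Z A Y n j V (\<lambda>y x. vs_smult A (c y x) (g y x))"
  using assms(4,5)
proof (induction n arbitrary: j V c g)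
  have cont: "continuous_map (prod_topology K (vs_top A)) (vs_top A) (\<lambda>u. vs_smult A (fst u) (snd u))"
    using A by (auto simp: topological_module_def case_prod_unfold)
  have cf: "continuous_family Y (tower_on F Z j V) (vs_top A) (\<lambda>y x. vs_smult A (c y x) (g y x))"
    if "Ck_family F Z (scalar_vs K) Y n j V c" "Ck_family F Z A Y n j V g" for n j V c g
    using continuous_family_compose_map[OF continuous_family_pair[OF
        Ck_family_continuous[OF that(1)] Ck_family_continuous[OF that(2)]], of "vs_top A" "\<lambda>u. vs_smult A (fst u) (snd u)"]
      cont by simp
  {
    case 0
    then show ?case using cf[OF 0] by auto
  next
    case (Suc n)
    have FK': "topspace F \<subseteq> topspace K" using FK by (auto simp: continuous_map_def)
    from Suc.prems(1) obtain c' where c0: "difference_quotient F Z (scalar_vs K) Y j V c c'"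
      and c1: "Ck_family F Z (scalar_vs K) Y n (Suc j) (ext_dom F Z j V) c'"
      by (rule Ck_family_SucE)
    from Suc.prems(2) obtain g' where g0: "difference_quotient F Z A Y j V g g'"
      and g1: "Ck_family F Z A Y n (Suc j) (ext_dom F Z j V) g'"
      by (rule Ck_family_SucE)
    note cp = Ck_family_pt[OF Ck_family_SucD[OF Suc.prems(1)]]
      and gp = Ck_family_pt[OF Ck_family_SucD[OF Suc.prems(2)]]
      and V = Ck_family_subset[OF Suc.prems(1)]
    define h where "h = (\<lambda>y p. vs_plus A
      (vs_plus A (vs_smult A (c' y p) (g y (pt p))) (vs_smult A (c y (pt p)) (g' y p)))
      (vs_smult A (par p) (vs_smult A (c' y p) (g' y p))))"
    have "Ck_family F Z A Y n (Suc j) (ext_dom F Z j V) h"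
      unfolding h_def
      by (rule Ck_family_plus[OF FK' A Ck_family_plus[OF FK' A Suc.IH[OF c1 gp] Suc.IH[OF cp g1]]
            Suc.IH[OF Ck_family_par[OF FK ext_dom_subset[OF V]] Suc.IH[OF c1 g1]]])
    moreover have "vs_smult A (c y (tower_move Z x t v)) (g y (tower_move Z x t v)) =
        vs_plus A (vs_smult A (c y x) (g y x)) (vs_smult A t (h y (Step x v t)))"
      if y: "y \<in> topspace Y" and s: "Step x v t \<in> ext_dom F Z j V" for y x v t
      unfolding difference_quotientD[OF c0 y s] difference_quotientD[OF g0 y s] h_def
      using topological_module_product_expand[OF K A, of "c y x" "c' y (Step x v t)" t "g y x" "g' y (Step x v t)"]
        Ck_family_mem[OF Suc.prems(1) y, of x] Ck_family_mem[OF Suc.prems(2) y, of x]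
        Ck_family_mem[OF c1 y s] Ck_family_mem[OF g1 y s] s FK'
      by (auto simp: Step_in_ext_dom)
    ultimately show ?case
      using cf[OF Suc.prems] V by (intro Ck_family_SucI[where h = h]) auto
  }
qed

text \<open>The quotient of \<open>1 / c\<close> is
  \<open>- c'(x, v, t) / (c(x) c(x + t v))\<close>. Its denominator is a nowhere vanishing family on
  the extended domain, so the induction hypothesis inverts it and the product rule finishes.\<close>

lemma Ck_family_inverse:
  assumes FK: "continuous_map F K (\<lambda>a. a)" and K: "topological_field K"
    and "Ck_family F Z (scalar_vs K) Y n j V c"
    and "\<And>y x. y \<in> topspace Y \<Longrightarrow> x \<in> V \<Longrightarrow> c y x \<noteq> 0"
  shows "Ck_family F Z (scalar_vs K) Y n j V (\<lambda>y x. inverse (c y x))"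
  using assms(3,4)
proof (induction n arbitrary: j V c)
  have cf: "continuous_family Y (tower_on F Z j V) K (\<lambda>y x. inverse (c y x))"
    if "Ck_family F Z (scalar_vs K) Y n j V c" "\<And>y x. y \<in> topspace Y \<Longrightarrow> x \<in> V \<Longrightarrow> c y x \<noteq> 0" for n j V c
    by (rule continuous_family_outer[of _ _ K _ "topspace K - {0}"])
      (use K Ck_family_continuous[OF that(1)] that(2) Ck_family_mem[OF that(1)] in \<open>auto simp: topological_field_def\<close>)
  {
    case 0
    then show ?case using cf[OF 0] by auto
  next
    case (Suc n)
    have FK': "topspace F \<subseteq> topspace K" using FK by (auto simp: continuous_map_def)
    from Suc.prems(1) obtain c' where c0: "difference_quotient F Z (scalar_vs K) Y j V c c'"
      and c1: "Ck_family F Z (scalar_vs K) Y n (Suc j) (ext_dom F Z j V) c'"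
      by (rule Ck_family_SucE)
    note cp = Ck_family_pt[OF Ck_family_SucD[OF Suc.prems(1)]]
      and V = Ck_family_subset[OF Suc.prems(1)] and S = topological_module_scalar[OF K]
    have um: "continuous_map (vs_top (scalar_vs K)) (vs_top (scalar_vs K)) uminus"
      using K by (simp add: topological_field_def)
    have c1': "Ck_family F Z (scalar_vs K) Y n (Suc j) (ext_dom F Z j V) (\<lambda>y p. - c' y p)"
      by (rule Ck_family_linop[OF c1 um]) simp
    \<comment> \<open>The second factor is \<open>c(x + t v)\<close>, written as
      \<open>c(x) + t c'(x, v, t)\<close> so that it is built from families already known on the
      extended domain.\<close>
    define e where "e = (\<lambda>y p. c y (pt p) * (c y (pt p) + par p * c' y p))"
    have ce: "c y x + t * c' y (Step x v t) \<noteq> 0"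
      if y: "y \<in> topspace Y" and s: "Step x v t \<in> ext_dom F Z j V" for y x v t
      using difference_quotientD[OF c0 y s] Suc.prems(2)[OF y] s by (auto simp: Step_in_ext_dom)
    have e1: "Ck_family F Z (scalar_vs K) Y n (Suc j) (ext_dom F Z j V) e"
      unfolding e_def
      using Ck_family_smult[OF FK K S cp Ck_family_plus[OF FK' S cp Ck_family_smult[OF FK K S
              Ck_family_par[OF FK ext_dom_subset[OF V]] c1]]]
      by simp
    have "e y p \<noteq> 0" if y: "y \<in> topspace Y" and "p \<in> ext_dom F Z j V" for y p
      using that(2) by (rule ext_domE) (use ce[OF y] Suc.prems(2)[OF y] in \<open>simp add: e_def\<close>)
    from Suc.IH[OF e1 this]
    have "Ck_family F Z (scalar_vs K) Y n (Suc j) (ext_dom F Z j V) (\<lambda>y p. inverse (e y p))" .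
    from Ck_family_smult[OF FK K S c1' this]
    have "Ck_family F Z (scalar_vs K) Y n (Suc j) (ext_dom F Z j V) (\<lambda>y p. - c' y p * inverse (e y p))"
      by simp
    moreover have "inverse (c y (tower_move Z x t v)) =
        inverse (c y x) + t * (- c' y (Step x v t) * inverse (e y (Step x v t)))"
      if y: "y \<in> topspace Y" and s: "Step x v t \<in> ext_dom F Z j V" for y x v t
    proof -
      have "c y x \<noteq> 0" using Suc.prems(2)[OF y] s by (simp add: Step_in_ext_dom)
      moreover have "c y (tower_move Z x t v) = c y x + t * c' y (Step x v t)"
        using difference_quotientD[OF c0 y s] by simp
      moreover have "inverse d = inverse a + - (d - a) * inverse (a * d)" if "a \<noteq> 0" "d \<noteq> 0" for a d :: 'a
        using that by (simp add: field_simps)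
      ultimately show ?thesis
        using ce[OF y s] by (fastforce simp: e_def mult.assoc)
    qed
    ultimately show ?case
      using cf[OF Suc.prems] V
      by (intro Ck_family_SucI[where h = "\<lambda>y p. - c' y p * inverse (e y p)"]) auto
  }
qed

section \<open>Density of nonzero increments and uniqueness of quotients\<close>

lemma not_openin_zero:
  assumes "topological_field K"
  shows "\<not> openin K {0}"
proof
  assume o: "openin K {0}"
  note K' = topological_fieldD[OF assms]
  have add: "continuous_map (prod_topology K K) K (\<lambda>(a, b). a + b)"
    using assms by (simp add: topological_field_def)
  \<comment> \<open>Translations are continuous, so an open \<open>{0}\<close> would make every
    singleton open, that is, the field discrete.\<close>
  have "openin K {a}" if a: "a \<in> topspace K" for a
  proof -
    have "continuous_map K (prod_topology K K) (\<lambda>x. (x, - a))"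
      using a K' by (intro continuous_map_pairedI) auto
    from continuous_map_compose[OF this add] have "continuous_map K K (\<lambda>x. x - a)"
      by (simp add: o_def)
    then have "openin K {x \<in> topspace K. x - a \<in> {0}}"
      using o by (simp only: continuous_map_def)
    moreover have "{x \<in> topspace K. x - a \<in> {0}} = {a}" using a by auto
    ultimately show ?thesis by simp
  qed
  then have "discrete_topology (topspace K) = K" by (simp add: discrete_topology_unique)
  then show False using assms by (simp add: topological_field_def)
qed

lemma tower_add_zero:
  assumes "topological_field F" "topological_vector_space F Z"
    and "x \<in> topspace (tower_top F Z j)" "v \<in> topspace (tower_top F Z j)"
  shows "tower_move Z x 0 v = x"
proof -
  note M = topological_module_tower[OF assms(1,2), of j]
  have "tower_scale (scale Z) 0 v \<in> topspace (tower_top F Z j)"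
    using topological_module_closed(2)[OF M, of 0 v] assms topological_fieldD(1)[OF assms(1)] by simp
  then show ?thesis
    using topological_module_laws(2)[OF M, of x] topological_module_laws(3)[OF M, of v x] assms by simp
qed

lemma continuous_map_move:
  assumes F: "topological_field F" and Z: "topological_vector_space F Z"
    and "continuous_map X (tower_top F Z j) a" "continuous_map X (tower_top F Z j) b" "continuous_map X F c"
  shows "continuous_map X (tower_top F Z j) (\<lambda>p. tower_move Z (a p) (c p) (b p))"
proof -
  have M: "continuous_map (prod_topology (tower_top F Z j) (tower_top F Z j)) (tower_top F Z j) (\<lambda>(u, v). tower_add u v)"
    "continuous_map (prod_topology F (tower_top F Z j)) (tower_top F Z j) (\<lambda>(t, v). tower_scale (scale Z) t v)"
    using topological_module_tower[OF F Z, of j] by (auto simp: topological_module_def)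
  have "continuous_map X (tower_top F Z j) (\<lambda>p. tower_scale (scale Z) (c p) (b p))"
    using continuous_map_compose[OF continuous_map_pairedI[OF assms(5,4)] M(2)] by (simp add: o_def)
  from continuous_map_compose[OF continuous_map_pairedI[OF assms(3) this] M(1)]
  show ?thesis by (simp add: o_def)
qed

lemma openin_ext_dom:
  assumes F: "topological_field F" and Z: "topological_vector_space F Z"
    and U: "openin (tower_top F Z j) U"
  shows "openin (tower_top F Z (Suc j)) (ext_dom F Z j U)"
proof -
  let ?S = "tower_top F Z (Suc j)"
  have "openin ?S {p \<in> topspace ?S. pt p \<in> U}"
    using continuous_map_pt U by (rule openin_continuous_map_preimage)
  moreover have "openin ?S {p \<in> topspace ?S. tower_move Z (pt p) (par p) (dir p) \<in> U}"
    using continuous_map_move[OF F Z continuous_map_pt continuous_map_dir continuous_map_par] U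
    by (rule openin_continuous_map_preimage)
  moreover have "ext_dom F Z j U = {p \<in> topspace ?S. pt p \<in> U} \<inter>
      {p \<in> topspace ?S. tower_move Z (pt p) (par p) (dir p) \<in> U}"
    using openin_subset[OF U] by (auto simp: topspace_tower_Suc ext_dom_def)
  ultimately show ?thesis by (simp add: openin_Int)
qed

lemma openin_iter_dom:
  assumes F: "topological_field F" and Z: "topological_vector_space F Z"
    and U: "openin (vtop Z) U"
  shows "openin (tower_top F Z m) (iter_dom F Z U m)"
proof (induction m)
  case 0
  have "openin (tower_top F Z 0) {p \<in> topspace (tower_top F Z 0). base p \<in> U}"
    using continuous_map_base U by (rule openin_continuous_map_preimage)
  moreover have "{p \<in> topspace (tower_top F Z 0). base p \<in> U} = Base ` U"
    using openin_subset[OF U] by auto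
  ultimately show ?case by simp
next
  case (Suc m)
  then show ?case using openin_ext_dom[OF F Z] by simp
qed

text \<open>For fixed \<open>x\<close> and \<open>v\<close> the admissible \<open>t\<close> form an
  open set. If it contains 0, then 0 is a limit of its nonzero elements, the field being
  non-discrete; continuous maps into a Hausdorff space that agree at the nonzero \<open>t\<close>
  therefore agree at 0.\<close>

lemma quotient_extension_unique:
  assumes F: "topological_field F" and Z: "topological_vector_space F Z"
    and U: "openin (tower_top F Z j) U" and T: "Hausdorff_space T"
    and h: "continuous_map (tower_on F Z (Suc j) (ext_dom F Z j U)) T h1"
      "continuous_map (tower_on F Z (Suc j) (ext_dom F Z j U)) T h2"
    and eq: "\<And>x v t. Step x v t \<in> ext_dom F Z j U \<Longrightarrow> t \<noteq> 0 \<Longrightarrow> h1 (Step x v t) = h2 (Step x v t)"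
    and p: "p \<in> ext_dom F Z j U"
  shows "h1 p = h2 p"
proof -
  from p obtain x v t where p: "p = Step x v t" and s: "Step x v t \<in> ext_dom F Z j U"
    and x: "x \<in> U" and v: "v \<in> topspace (tower_top F Z j)"
    by (rule ext_domE)
  have x': "x \<in> topspace (tower_top F Z j)" using x openin_subset[OF U] by blast
  note F' = topological_fieldD[OF F]
  show ?thesis
  proof (cases "t = 0")
    case False
    then show ?thesis using eq s p by simp
  next
    case True
    define S where "S = {t \<in> topspace F. tower_move Z x t v \<in> U}"
    have m: "continuous_map F (tower_top F Z j) (\<lambda>t. tower_move Z x t v)"
      by (rule continuous_map_move[OF F Z]) (use x' v in auto)
    then have S: "openin F S" unfolding S_def by (rule openin_continuous_map_preimage[OF _ U])
    have S0: "0 \<in> S" using s True by (auto simp: S_def Step_in_ext_dom)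
    have "0 \<in> F closure_of (S - {0})"
      unfolding in_closure_of
    proof (intro conjI allI impI)
      fix N assume N: "0 \<in> N \<and> openin F N"
      then have "openin F (N \<inter> S)" using S by blast
      then have "N \<inter> S \<noteq> {0}" using not_openin_zero[OF F] by metis
      then show "\<exists>y. y \<in> S - {0} \<and> y \<in> N" using N S0 by blast
    qed (use F' in simp)
    then have cl: "0 \<in> subtopology F S closure_of (S - {0})"
      using S0 by (simp add: closure_of_subtopology Int_absorb1)
    have st: "continuous_map (subtopology F S) (tower_on F Z (Suc j) (ext_dom F Z j U)) (Step x v)"
      unfolding continuous_map_in_subtopology
    proof
      show "continuous_map (subtopology F S) (tower_top F Z (Suc j)) (Step x v)"
        by (rule continuous_map_Step) (use x' v continuous_map_from_subtopology[OF continuous_map_ident] in auto)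
    qed (use x v in \<open>auto simp: S_def Step_in_ext_dom\<close>)
    have "(h1 \<circ> Step x v) 0 = (h2 \<circ> Step x v) 0"
      by (rule forall_in_closure_of_eq[OF cl T continuous_map_compose[OF st h(1)] continuous_map_compose[OF st h(2)]])
        (use x v in \<open>auto simp: S_def Step_in_ext_dom intro!: eq\<close>)
    then show ?thesis using p True by simp
  qed
qed

section \<open>Gluing families over open covers\<close>

lemma tvs_minus:
  assumes K: "topological_field K" and E: "topological_vector_space K E"
  shows "continuous_map (prod_topology (vtop E) (vtop E)) (vtop E) (\<lambda>u. fst u - snd u)"
proof -
  note K' = topological_fieldD[OF K]
  have c: "continuous_map (prod_topology (vtop E) (vtop E)) (vtop E) (\<lambda>(v, w). v + w)"
    "continuous_map (prod_topology K (vtop E)) (vtop E) (\<lambda>(a, v). scale E a v)"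
    using E by (auto simp: topological_vector_space_def)
  have "continuous_map (prod_topology (vtop E) (vtop E)) (prod_topology K (vtop E)) (\<lambda>u. (- 1, snd u))"
    using K' by (intro continuous_map_pairedI) (auto simp: continuous_map_snd)
  from continuous_map_compose[OF this c(2)]
  have "continuous_map (prod_topology (vtop E) (vtop E)) (vtop E) (\<lambda>u. scale E (- 1) (snd u))"
    by (simp add: o_def)
  from continuous_map_compose[OF continuous_map_pairedI[OF continuous_map_fst this] c(1)]
  have "continuous_map (prod_topology (vtop E) (vtop E)) (vtop E) (\<lambda>u. fst u + scale E (- 1) (snd u))"
    by (simp add: o_def)
  then show ?thesis
    by (rule continuous_map_eq) (auto simp flip: tvs_diff(2)[OF K E])
qed

lemma Ck_family_minus:
  assumes FK: "topspace F \<subseteq> topspace K" and K: "topological_field K" and E: "topological_vector_space K E"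
    and "Ck_family F Z (plain E) Y n j V g1" "Ck_family F Z (plain E) Y n j V g2"
  shows "Ck_family F Z (plain E) Y n j V (\<lambda>y x. g1 y x - g2 y x)"
proof -
  have "continuous_map (vs_top (prod_vs (plain E) (plain E))) (vs_top (plain E)) (\<lambda>u. fst u - snd u)"
    using tvs_minus[OF K E] by simp
  from Ck_family_linop[OF Ck_family_pair[OF assms(4,5)] this] show ?thesis
    using FK tvs_diff(5)[OF K E] by (auto simp: subset_iff)
qed

text \<open>Local quotients agree on overlaps by uniqueness, so they define one global
  \<open>h\<close>. The extended domains of the members, together with the open set where
  \<open>t \<noteq> 0\<close>, form an open cover one level up, to which the induction hypothesis is
  applied; this is why cover and level vary in the induction.\<close>

lemma Ck_family_local:
  assumes ext: "topological_field_extension F K"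
    and Z: "topological_vector_space F Z" and G: "topological_vector_space K G"
    and ope: "\<And>V. V \<in> \<V> \<Longrightarrow> openin (tower_top F Z j) V"
    and loc: "\<And>V. V \<in> \<V> \<Longrightarrow> Ck_family F Z (plain G) Y n j V g"
  shows "Ck_family F Z (plain G) Y n j (\<Union>\<V>) g"
  using ope loc
proof (induction n arbitrary: j \<V> g)
  have F: "topological_field F" and K: "topological_field K" and FK: "topspace F \<subseteq> topspace K"
    "continuous_map F K (\<lambda>a. a)"
    using ext by (auto simp: topological_field_extension_def)
  note F' = topological_fieldD[OF F] and K' = topological_fieldD[OF K]
    and G' = tvsD[OF G] and Z' = tvsD[OF Z]
  have H: "Hausdorff_space (tower_top F Z j)" for j
    by (rule Hausdorff_tower[OF F'(3) Z'(2)])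
  have cf: "continuous_family Y (tower_on F Z j (\<Union>\<V>)) (vs_top (plain G)) g"
    if "\<And>V. V \<in> \<V> \<Longrightarrow> openin (tower_top F Z j) V"
      "\<And>V. V \<in> \<V> \<Longrightarrow> Ck_family F Z (plain G) Y n j V g" for n j \<V> g
    by (rule continuous_family_local[OF H that(1) Ck_family_continuous[OF that(2)]])
  {
    case 0
    then show ?case using cf[OF 0] by (auto dest: openin_subset)
  next
    case (Suc n)
    define M where "M = (\<lambda>p :: ('b, 'a) tower. tower_move Z (pt p) (par p) (dir p))"
    have sub: "\<Union>\<V> \<subseteq> topspace (tower_top F Z j)" using Suc.prems(1) by (auto dest: openin_subset)
    have ope: "openin (tower_top F Z j) (\<Union>\<V>)" using Suc.prems(1) by blast
    have ex: "\<exists>h. difference_quotient F Z (plain G) Y j V g h \<and>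
        Ck_family F Z (plain G) Y n (Suc j) (ext_dom F Z j V) h" if "V \<in> \<V>" for V
      using Suc.prems(2)[OF that] by simp
    obtain q where q: "difference_quotient F Z (plain G) Y j V g (q V)"
      "Ck_family F Z (plain G) Y n (Suc j) (ext_dom F Z j V) (q V)" if "V \<in> \<V>" for V
      using ex by metis
    \<comment> \<open>\<open>sel x\<close> is some member of the cover around \<open>x\<close>. It
      decides which local quotient is used at \<open>t = 0\<close>; uniqueness makes the choice
      immaterial.\<close>
    define sel where "sel = (\<lambda>x. SOME V. V \<in> \<V> \<and> x \<in> V)"
    have sel: "sel x \<in> \<V>" "x \<in> sel x" if "x \<in> \<Union>\<V>" for x
      using someI_ex[of "\<lambda>V. V \<in> \<V> \<and> x \<in> V"] that unfolding sel_def by auto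
    define h where "h = (\<lambda>y p. if par p \<noteq> 0 then scale G (inverse (par p)) (g y (M p) - g y (pt p))
      else q (sel (pt p)) y p)"
    have g: "Ck_family F Z (plain G) Y n j (\<Union>\<V>) g"
      by (rule Suc.IH[OF Suc.prems(1) Ck_family_SucD[OF Suc.prems(2)]])
    have gm: "g y x \<in> carrier G" if "y \<in> topspace Y" "x \<in> \<Union>\<V>" for y x
      using Ck_family_mem[OF g that] by simp
    have quot: "q V y (Step x v t) = scale G (inverse t) (g y (M (Step x v t)) - g y x)"
      if V: "V \<in> \<V>" and y: "y \<in> topspace Y" and s: "Step x v t \<in> ext_dom F Z j V" and t: "t \<noteq> 0" for V y x v t
    proof -
      have c: "q V y (Step x v t) \<in> carrier G" using Ck_family_mem[OF q(2)[OF V] y s] by simp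
      have tK: "t \<in> topspace K" using s FK(1) by (auto simp: Step_in_ext_dom)
      have "g y (M (Step x v t)) - g y x = scale G t (q V y (Step x v t))"
        using difference_quotientD[OF q(1)[OF V] y s] by (simp add: M_def)
      then have "scale G (inverse t) (g y (M (Step x v t)) - g y x) = scale G (inverse t * t) (q V y (Step x v t))"
        using G'(7)[of "inverse t" t "q V y (Step x v t)"] c tK K'(7)[OF tK] by simp
      then show ?thesis using t c G'(8) by simp
    qed
    have hq: "q V y p = h y p" if V: "V \<in> \<V>" and y: "y \<in> topspace Y" and p: "p \<in> ext_dom F Z j V" for V y p
    proof -
      from p obtain x v t where px: "p = Step x v t" and s: "Step x v t \<in> ext_dom F Z j V" and x: "x \<in> V"
        and v: "v \<in> topspace (tower_top F Z j)" and t: "t \<in> topspace F"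
        by (rule ext_domE)
      have x': "x \<in> \<Union>\<V>" using x V by auto
      show ?thesis
      proof (cases "t = 0")
        case False
        then show ?thesis using quot[OF V y s] by (simp add: h_def px)
      next
        case True
        \<comment> \<open>Since \<open>x + 0 v = x\<close>, the point lies in the extended domain of
          the intersection of the two members, and uniqueness compares their quotients
          there.\<close>
        let ?U = "V \<inter> sel x"
        have sV: "ext_dom F Z j ?U \<subseteq> ext_dom F Z j V" and ss: "ext_dom F Z j ?U \<subseteq> ext_dom F Z j (sel x)"
          by (auto intro!: ext_dom_mono)
        have c: "continuous_map (tower_on F Z (Suc j) (ext_dom F Z j ?U)) (vtop G) (q W y)"
          if "W \<in> \<V>" "ext_dom F Z j ?U \<subseteq> ext_dom F Z j W" for W
          using continuous_familyD(1)[OF Ck_family_continuous[OF Ck_family_mono[OF q(2)[OF that(1)] that(2)]] y] by simp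
        have "q V y p = q (sel x) y p"
        proof (rule quotient_extension_unique[OF F Z _ G'(2) c[OF V sV] c[OF sel(1)[OF x'] ss]])
          show "openin (tower_top F Z j) ?U" using Suc.prems(1) V sel(1)[OF x'] by blast
          show "p \<in> ext_dom F Z j ?U"
            using x v t sel(2)[OF x'] tower_add_zero[OF F Z, of x j v] sub x'
            by (auto simp: px Step_in_ext_dom True)
          fix x1 v1 t1 assume "Step x1 v1 t1 \<in> ext_dom F Z j ?U" and t1: "t1 \<noteq> 0"
          then have "Step x1 v1 t1 \<in> ext_dom F Z j V" "Step x1 v1 t1 \<in> ext_dom F Z j (sel x)"
            using sV ss by auto
          then show "q V y (Step x1 v1 t1) = q (sel x) y (Step x1 v1 t1)"
            using quot[OF V y _ t1] quot[OF sel(1)[OF x'] y _ t1] by simp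
        qed
        then show ?thesis by (simp add: h_def px True)
      qed
    qed
    define W where "W = {p \<in> ext_dom F Z j (\<Union>\<V>). par p \<noteq> 0}"
    have WS: "W \<subseteq> topspace (tower_top F Z (Suc j))"
      using ext_dom_subset[OF sub] by (auto simp: W_def)
    have Wo: "openin (tower_top F Z (Suc j)) W"
    proof -
      have "openin F (topspace F - {0})"
        using F' by (intro openin_diff openin_topspace closedin_Hausdorff_singleton)
      from openin_continuous_map_preimage[OF continuous_map_par this, of Z j]
      have "openin (tower_top F Z (Suc j)) {p \<in> topspace (tower_top F Z (Suc j)). par p \<in> topspace F - {0}}" .
      moreover have "W = {p \<in> topspace (tower_top F Z (Suc j)). par p \<in> topspace F - {0}} \<inter> ext_dom F Z j (\<Union>\<V>)"
        using WS by (auto simp: W_def topspace_tower_Suc)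
      ultimately show ?thesis using openin_ext_dom[OF F Z ope] by auto
    qed
    have FF: "continuous_map F F (\<lambda>a. a)" by (rule continuous_map_ident)
    note T = topological_module_tower[OF F Z, of j]
    have lin: "Ck_family F Z (tower_vs F Z j) point n (Suc j) W (\<lambda>_. pt)"
      "Ck_family F Z (tower_vs F Z j) point n (Suc j) W (\<lambda>_. dir)"
      by (rule Ck_family_linear; use WS continuous_map_pt continuous_map_dir in \<open>auto simp: topspace_tower_Suc\<close>)+
    have MC: "Ck_family F Z (tower_vs F Z j) point n (Suc j) W (\<lambda>_. M)"
      using Ck_family_plus[OF order_refl T lin(1) Ck_family_smult[OF FF F T Ck_family_par[OF FF WS] lin(2)]]
      by (simp add: M_def)
    have Mim: "M ` W \<subseteq> \<Union>\<V>" and pim: "pt ` W \<subseteq> \<Union>\<V>"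
      by (auto simp: M_def W_def ext_dom_def)
    have p0: "par p \<noteq> 0" if "p \<in> W" for p using that by (simp add: W_def)
    \<comment> \<open>Order \<open>n\<close> of \<open>g\<close> on the whole union is known from
      the induction hypothesis. On \<open>W\<close> the explicit formula composes \<open>g\<close>
      with \<open>M\<close> and \<open>pt\<close>, subtracts, and divides by the nonzero
      \<open>t\<close>, all of which preserve this order.\<close>
    have "Ck_family F Z (plain G) Y n (Suc j) W (\<lambda>y p. g y (M p) - g y (pt p))"
      by (rule Ck_family_minus[OF FK(1) K G Ck_family_inner[OF g MC Mim] Ck_family_inner[OF g lin(1) pim]])
    from Ck_family_smult[OF FK(2) K topological_module_plain[OF K G]
        Ck_family_inverse[OF FK(2) K Ck_family_par[OF FK(2) WS] p0] this]
    have hW: "Ck_family F Z (plain G) Y n (Suc j) W h"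
      by (rule Ck_family_cong) (auto simp: h_def p0)
    have hV: "Ck_family F Z (plain G) Y n (Suc j) (ext_dom F Z j V) h" if "V \<in> \<V>" for V
      by (rule Ck_family_cong[OF q(2)[OF that]]) (use hq that in auto)
    have "Ck_family F Z (plain G) Y n (Suc j) (\<Union>(insert W (ext_dom F Z j ` \<V>))) h"
      by (rule Suc.IH) (use hW hV Wo openin_ext_dom[OF F Z] Suc.prems(1) in auto)
    moreover have "\<Union>(insert W (ext_dom F Z j ` \<V>)) = ext_dom F Z j (\<Union>\<V>)"
    proof
      have "ext_dom F Z j V \<subseteq> ext_dom F Z j (\<Union>\<V>)" if "V \<in> \<V>" for V
        using that by (intro ext_dom_mono) auto
      then show "\<Union>(insert W (ext_dom F Z j ` \<V>)) \<subseteq> ext_dom F Z j (\<Union>\<V>)"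
        by (auto simp: W_def)
      show "ext_dom F Z j (\<Union>\<V>) \<subseteq> \<Union>(insert W (ext_dom F Z j ` \<V>))"
      proof
        fix p assume p: "p \<in> ext_dom F Z j (\<Union>\<V>)"
        then obtain x v t where px: "p = Step x v t" and x: "x \<in> \<Union>\<V>"
          and v: "v \<in> topspace (tower_top F Z j)" and t: "t \<in> topspace F"
          by (rule ext_domE)
        show "p \<in> \<Union>(insert W (ext_dom F Z j ` \<V>))"
        proof (cases "t = 0")
          case True
          have "p \<in> ext_dom F Z j (sel x)"
            using sel[OF x] v t tower_add_zero[OF F Z, of x j v] sub x by (auto simp: px Step_in_ext_dom True)
          then show ?thesis using sel[OF x] by auto
        qed (use p in \<open>auto simp: W_def px\<close>)
      qed
    qed
    ultimately have hU: "Ck_family F Z (plain G) Y n (Suc j) (ext_dom F Z j (\<Union>\<V>)) h" by simp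
    show ?case
    proof (rule Ck_family_SucI[OF sub cf[OF Suc.prems] _ hU])
      fix y x v t assume y: "y \<in> topspace Y" and s: "Step x v t \<in> ext_dom F Z j (\<Union>\<V>)"
      then have x: "x \<in> \<Union>\<V>" and mx: "M (Step x v t) \<in> \<Union>\<V>" and t: "t \<in> topspace K"
        and v: "v \<in> topspace (tower_top F Z j)"
        using FK(1) by (auto simp: Step_in_ext_dom M_def)
      have "g y (M (Step x v t)) = g y x + scale G t (h y (Step x v t))"
      proof (cases "t = 0")
        case True
        have "M (Step x v t) = x"
          using tower_add_zero[OF F Z, of x j v] sub x v by (auto simp: M_def True)
        moreover have "h y (Step x v t) \<in> carrier G" using Ck_family_mem[OF hU y s] by simp
        ultimately show ?thesis using tvs_diff(1)[OF K G] True by simp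
      next
        case False
        have d: "g y (M (Step x v t)) - g y x \<in> carrier G"
          by (rule tvs_diff(4)[OF K G gm[OF y mx] gm[OF y x]])
        have "scale G t (h y (Step x v t)) = scale G (t * inverse t) (g y (M (Step x v t)) - g y x)"
          using G'(7)[OF t K'(7)[OF t] d] False by (simp add: h_def)
        then show ?thesis using G'(8)[OF d] False by simp
      qed
      then show "g y (tower_move Z x t v) =
          vs_plus (plain G) (g y x) (vs_smult (plain G) t (h y (Step x v t)))"
        by (simp add: M_def)
    qed
  }
qed

section \<open>Differentiable maps as families over a point\<close>

text \<open>\<open>iter_ext\<close> lengthens a chain of quotients at its end, while
  \<open>Ck_family\<close> unfolds it from the front. A chain given as a sequence fits both views;
  shifting the index by one peels off the front.\<close>

lemma Ck_family_of_sequence: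
  assumes "\<And>m. m < n \<Longrightarrow> U (Suc m) = ext_dom F Z (j + m) (U m)"
    and "U 0 \<subseteq> topspace (tower_top F Z j)"
    and "\<And>m. m \<le> n \<Longrightarrow> continuous_family Y (tower_on F Z (j + m) (U m)) (vs_top A) (G m)"
    and "\<And>m. m < n \<Longrightarrow> difference_quotient F Z A Y (j + m) (U m) (G m) (G (Suc m))"
  shows "Ck_family F Z A Y n j (U 0) (G 0)"
  using assms
proof (induction n arbitrary: j U G)
  case 0
  then show ?case by force
next
  case (Suc n)
  have "Ck_family F Z A Y n (Suc j) (U (Suc 0)) (G (Suc 0))"
  proof (rule Suc.IH[of "\<lambda>m. U (Suc m)" "Suc j" "\<lambda>m. G (Suc m)"])
    show "U (Suc 0) \<subseteq> topspace (tower_top F Z (Suc j))"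
      using Suc.prems(1)[of 0] ext_dom_subset[OF Suc.prems(2)] by simp
    fix m
    show "U (Suc (Suc m)) = ext_dom F Z (Suc j + m) (U (Suc m))" if "m < n"
      using Suc.prems(1)[of "Suc m"] that by simp
    show "continuous_family Y (tower_on F Z (Suc j + m) (U (Suc m))) (vs_top A) (G (Suc m))"
      if "m \<le> n" using Suc.prems(3)[of "Suc m"] that by simp
    show "difference_quotient F Z A Y (Suc j + m) (U (Suc m)) (G (Suc m)) (G (Suc (Suc m)))"
      if "m < n" using Suc.prems(4)[of "Suc m"] that by simp
  qed
  then show ?case
    using Suc.prems(1)[of 0] Suc.prems(2) Suc.prems(3)[of 0] Suc.prems(4)[of 0] by auto
qed

text \<open>For nonzero \<open>t\<close> the two equations differ by multiplication with
  \<open>t\<close>. At \<open>t = 0\<close>, where \<open>is_quotient_ext\<close> prescribes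
  nothing, the equation on the right reduces to \<open>g(x) = g(x)\<close> by the assumption
  \<open>zero\<close>.\<close>

lemma is_quotient_ext_iff:
  assumes F: "topological_field F" and G: "topological_vector_space F G"
    and V: "V \<subseteq> topspace (tower_top F Z j)"
    and g: "continuous_map (tower_on F Z j V) (vtop G) g"
    and h: "continuous_map (tower_on F Z (Suc j) (ext_dom F Z j V)) (vtop G) h"
    and zero: "\<And>x v. Step x v 0 \<in> ext_dom F Z j V \<Longrightarrow> tower_move Z x 0 v = x"
  shows "is_quotient_ext F Z G j V g h \<longleftrightarrow>
    (\<forall>x v t. Step x v t \<in> ext_dom F Z j V \<longrightarrow>
      g (tower_move Z x t v) = g x + scale G t (h (Step x v t)))"
proof -
  note F' = topological_fieldD[OF F] and G' = tvsD[OF G]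
    and D = tvs_diff[OF F G]
  have hc: "h p \<in> carrier G" if "p \<in> ext_dom F Z j V" for p
    using h that ext_dom_subset[OF V] by (auto simp: continuous_map_def Pi_iff)
  have gc: "g x \<in> carrier G" if "x \<in> V" for x
    using g that V by (auto simp: continuous_map_def Pi_iff)
  have "h (Step x v t) = scale G (inverse t) (g (tower_move Z x t v) - g x) \<longleftrightarrow>
      g (tower_move Z x t v) = g x + scale G t (h (Step x v t))"
    if s: "Step x v t \<in> ext_dom F Z j V" and t: "t \<noteq> 0" for x v t
  proof -
    have tF: "t \<in> topspace F" and d: "g (tower_move Z x t v) - g x \<in> carrier G"
      using s gc by (auto simp: Step_in_ext_dom intro: D(4))
    have "scale G t (scale G (inverse t) (g (tower_move Z x t v) - g x)) =
        g (tower_move Z x t v) - g x"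
      using G'(7)[OF tF F'(7)[OF tF] d] G'(8)[OF d] t by simp
    moreover have "scale G (inverse t) (scale G t (h (Step x v t))) = h (Step x v t)"
      using G'(7)[OF F'(7)[OF tF] tF hc[OF s]] G'(8)[OF hc[OF s]] t by simp
    ultimately show ?thesis by (metis add_diff_cancel_left' add.commute diff_add_cancel)
  qed
  moreover have "g (tower_move Z x 0 v) = g x + scale G 0 (h (Step x v 0))"
    if s: "Step x v 0 \<in> ext_dom F Z j V" for x v
    using zero[OF s] D(1)[OF hc[OF s]] by simp
  ultimately show ?thesis
    unfolding is_quotient_ext_def using h by (metis (no_types))
qed

lemma tower_add_zero_ext_dom:
  assumes "topological_field F" "topological_vector_space F Z" "V \<subseteq> topspace (tower_top F Z j)"
    and "Step x v 0 \<in> ext_dom F Z j V"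
  shows "tower_move Z x 0 v = x"
  using assms by (intro tower_add_zero[OF assms(1,2)]) (auto simp: Step_in_ext_dom)

text \<open>Uniqueness of the continuous extension evaluates the definite description on the domain;
  the prescribed value 0 settles it elsewhere.\<close>

lemma quotient_ext_eq:
  assumes F: "topological_field F" and Z: "topological_vector_space F Z" and G: "topological_vector_space F G"
    and U: "openin (tower_top F Z j) U" and h: "is_quotient_ext F Z G j U g h"
  shows "quotient_ext F Z G j U g = (\<lambda>p. if p \<in> ext_dom F Z j U then h p else 0)"
  unfolding quotient_ext_def
proof (rule the_equality)
  have "is_quotient_ext F Z G j U g (\<lambda>p. if p \<in> ext_dom F Z j U then h p else 0)"
    using h unfolding is_quotient_ext_def
    by (auto elim!: continuous_map_eq)
  then show "is_quotient_ext F Z G j U g (\<lambda>p. if p \<in> ext_dom F Z j U then h p else 0) \<and>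
      (\<forall>p. p \<notin> ext_dom F Z j U \<longrightarrow> (if p \<in> ext_dom F Z j U then h p else 0) = 0)" by simp
  fix h' assume h': "is_quotient_ext F Z G j U g h' \<and> (\<forall>p. p \<notin> ext_dom F Z j U \<longrightarrow> h' p = 0)"
  have "h' p = h p" if "p \<in> ext_dom F Z j U" for p
    by (rule quotient_extension_unique[OF F Z U tvsD(2)[OF G] _ _ _ that])
      (use h h' in \<open>auto simp: is_quotient_ext_def\<close>)
  then show "h' = (\<lambda>p. if p \<in> ext_dom F Z j U then h p else 0)" using h' by auto
qed

lemma is_quotient_ext_quotient_ext:
  assumes F: "topological_field F" and Z: "topological_vector_space F Z" and G: "topological_vector_space F G"
    and U: "openin (tower_top F Z j) U" and h: "is_quotient_ext F Z G j U g h"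
  shows "is_quotient_ext F Z G j U g (quotient_ext F Z G j U g)"
    and "p \<notin> ext_dom F Z j U \<Longrightarrow> quotient_ext F Z G j U g p = 0"
  unfolding quotient_ext_eq[OF assms]
  using h unfolding is_quotient_ext_def by (auto elim!: continuous_map_eq)

lemma difference_quotient_is_quotient_ext:
  assumes F: "topological_field F" and Z: "topological_vector_space F Z" and G: "topological_vector_space F G"
    and V: "V \<subseteq> topspace (tower_top F Z j)"
    and g: "continuous_family Y (tower_on F Z j V) (vtop G) g"
    and h: "continuous_family Y (tower_on F Z (Suc j) (ext_dom F Z j V)) (vtop G) h"
  shows "difference_quotient F Z (plain G) Y j V g h \<longleftrightarrow>
    (\<forall>y\<in>topspace Y. is_quotient_ext F Z G j V (g y) (h y))"
  unfolding difference_quotient_def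
  using is_quotient_ext_iff[OF F G V continuous_familyD(1)[OF g] continuous_familyD(1)[OF h]
      tower_add_zero_ext_dom[OF F Z V]] by simp

lemma iter_dom_subset:
  assumes "V \<subseteq> carrier Z"
  shows "iter_dom F Z V m \<subseteq> topspace (tower_top F Z m)"
proof (induction m)
  case (Suc m)
  then show ?case by (simp add: ext_dom_subset)
qed (use assms in auto)

lemma Ck_nat_iff_C1:
  "Ck_nat F Z G V n f \<longleftrightarrow> continuous_map (subtopology (vtop Z) V) (vtop G) f \<and>
     (\<forall>m<n. C1 F Z G m (iter_dom F Z V m) (iter_ext F Z G V f m))"
  by (induction n) (auto simp: less_Suc_eq)

lemma continuous_map_Base_image:
  assumes "V \<subseteq> carrier Z"
  shows "continuous_map (tower_on F Z 0 (Base ` V)) T g \<longleftrightarrow>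
    continuous_map (subtopology (vtop Z) V) T (\<lambda>x. g (Base x))"
proof
  assume g: "continuous_map (tower_on F Z 0 (Base ` V)) T g"
  have "continuous_map (subtopology (vtop Z) V) (tower_on F Z 0 (Base ` V)) Base"
    using continuous_map_Base[OF continuous_map_from_subtopology[OF continuous_map_ident]]
    by (auto simp: continuous_map_in_subtopology)
  from continuous_map_compose[OF this g] show "continuous_map (subtopology (vtop Z) V) T (\<lambda>x. g (Base x))"
    by (simp add: o_def)
next
  assume g: "continuous_map (subtopology (vtop Z) V) T (\<lambda>x. g (Base x))"
  have "continuous_map (tower_on F Z 0 (Base ` V)) (subtopology (vtop Z) V) base"
    using continuous_map_from_subtopology[OF continuous_map_base]
    by (auto simp: continuous_map_in_subtopology)
  from continuous_map_compose[OF this g]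
  show "continuous_map (tower_on F Z 0 (Base ` V)) T g"
    by (rule continuous_map_eq) auto
qed

text \<open>A definite description has the intended properties only where its object exists;
  differentiability of order \<open>n\<close> guarantees this for the first \<open>n\<close>
  quotients, whence the bounds on \<open>m\<close>.\<close>

lemma Ck_nat_iter_ext:
  assumes F: "topological_field F" and Z: "topological_vector_space F Z" and G: "topological_vector_space F G"
    and V: "openin (vtop Z) V" and f: "Ck_nat F Z G V n f"
  shows "m < n \<Longrightarrow> is_quotient_ext F Z G m (iter_dom F Z V m) (iter_ext F Z G V f m) (iter_ext F Z G V f (Suc m))"
    and "m \<le> n \<Longrightarrow> p \<notin> iter_dom F Z V m \<Longrightarrow> iter_ext F Z G V f m p = 0"
    and "m \<le> n \<Longrightarrow> continuous_map (tower_on F Z m (iter_dom F Z V m)) (vtop G) (iter_ext F Z G V f m)"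
proof -
  have *: "is_quotient_ext F Z G m (iter_dom F Z V m) (iter_ext F Z G V f m) (iter_ext F Z G V f (Suc m))"
    "\<And>p. p \<notin> iter_dom F Z V (Suc m) \<Longrightarrow> iter_ext F Z G V f (Suc m) p = 0" if m: "m < n" for m
  proof -
    obtain h where h: "is_quotient_ext F Z G m (iter_dom F Z V m) (iter_ext F Z G V f m) h"
      using f m by (auto simp: Ck_nat_iff_C1 C1_def)
    show "is_quotient_ext F Z G m (iter_dom F Z V m) (iter_ext F Z G V f m) (iter_ext F Z G V f (Suc m))"
      using is_quotient_ext_quotient_ext(1)[OF F Z G openin_iter_dom[OF F Z V] h] by simp
    show "iter_ext F Z G V f (Suc m) p = 0" if "p \<notin> iter_dom F Z V (Suc m)" for p
      using is_quotient_ext_quotient_ext(2)[OF F Z G openin_iter_dom[OF F Z V] h] that by simp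
  qed
  show "m < n \<Longrightarrow> is_quotient_ext F Z G m (iter_dom F Z V m) (iter_ext F Z G V f m) (iter_ext F Z G V f (Suc m))"
    by (rule *)
  show "m \<le> n \<Longrightarrow> p \<notin> iter_dom F Z V m \<Longrightarrow> iter_ext F Z G V f m p = 0"
    using *(2)[of "m - 1" p] by (cases m) auto
  show "continuous_map (tower_on F Z m (iter_dom F Z V m)) (vtop G) (iter_ext F Z G V f m)" if "m \<le> n"
  proof (cases m)
    case 0
    have "continuous_map (subtopology (vtop Z) V) (vtop G) (\<lambda>x. iter_ext F Z G V f 0 (Base x))"
      by (rule continuous_map_eq[of _ _ f]) (use f in \<open>auto simp: Ck_nat_iff_C1\<close>)
    then show ?thesis
      using continuous_map_Base_image[OF openin_subset[OF V], of F "vtop G" "iter_ext F Z G V f 0"] 0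
      by (simp only: iter_dom.simps)
  next
    case (Suc l)
    then show ?thesis using *(1)[of l] that by (simp add: is_quotient_ext_def)
  qed
qed

text \<open>By uniqueness the quotients hidden in the existential quantifiers of
  \<open>Ck_family\<close> are the canonical ones. The remaining order \<open>n - m\<close> is what
  is later spent on the variable of the manifold.\<close>

lemma Ck_family_iter_ext:
  assumes F: "topological_field F" and Z: "topological_vector_space F Z" and G: "topological_vector_space F G"
    and V: "openin (vtop Z) V"
    and g: "Ck_family F Z (plain G) Y n 0 (Base ` V) (\<lambda>y p. g y (base p))"
    and m: "m \<le> n"
  shows "Ck_family F Z (plain G) Y (n - m) m (iter_dom F Z V m) (\<lambda>y. iter_ext F Z G V (g y) m)"
  using m
proof (induction m)
  case 0
  then show ?case using Ck_family_cong[OF g] by auto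
next
  case (Suc m)
  have nm: "n - m = Suc (n - Suc m)" using Suc.prems by simp
  have IH: "Ck_family F Z (plain G) Y (Suc (n - Suc m)) m (iter_dom F Z V m) (\<lambda>y. iter_ext F Z G V (g y) m)"
    using Suc nm by simp
  then obtain h where h: "difference_quotient F Z (plain G) Y m (iter_dom F Z V m) (\<lambda>y. iter_ext F Z G V (g y) m) h"
    "Ck_family F Z (plain G) Y (n - Suc m) (Suc m) (ext_dom F Z m (iter_dom F Z V m)) h"
    by (rule Ck_family_SucE)
  have q: "is_quotient_ext F Z G m (iter_dom F Z V m) (iter_ext F Z G V (g y) m) (h y)" if "y \<in> topspace Y" for y
    using h(1) difference_quotient_is_quotient_ext[OF F Z G Ck_family_subset[OF IH], of Y _ h]
      Ck_family_continuous[OF IH] Ck_family_continuous[OF h(2)] that by simp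
  have "Ck_family F Z (plain G) Y (n - Suc m) (Suc m) (ext_dom F Z m (iter_dom F Z V m)) (\<lambda>y. iter_ext F Z G V (g y) (Suc m))"
    by (rule Ck_family_cong[OF h(2)])
      (simp add: quotient_ext_eq[OF F Z G openin_iter_dom[OF F Z V] q])
  then show ?case by simp
qed

lemma Ck_family_Base_cong:
  "Ck_family F Z A Y n 0 (Base ` V) (\<lambda>y. iter_ext F Z G V (g y) 0) \<longleftrightarrow>
   Ck_family F Z A Y n 0 (Base ` V) (\<lambda>y p. g y (base p))"
  by (rule iffI; erule Ck_family_cong) auto

lemma Ck_nat_iff_family:
  assumes F: "topological_field F" and Z: "topological_vector_space F Z" and G: "topological_vector_space F G"
    and V: "openin (vtop Z) V"
  shows "Ck_nat F Z G V n f \<longleftrightarrow> Ck_family F Z (plain G) point n 0 (Base ` V) (\<lambda>_ p. f (base p))"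
proof
  assume f: "Ck_nat F Z G V n f"
  note it = Ck_nat_iter_ext[OF F Z G V f] and sub = iter_dom_subset[OF openin_subset[OF V]]
  have "Ck_family F Z (plain G) point n 0 (iter_dom F Z V 0) (\<lambda>_. iter_ext F Z G V f 0)"
  proof (rule Ck_family_of_sequence[where U = "iter_dom F Z V" and G = "\<lambda>m _. iter_ext F Z G V f m"])
    fix m
    show c: "continuous_family point (tower_on F Z (0 + m) (iter_dom F Z V m)) (vs_top (plain G))
        (\<lambda>_. iter_ext F Z G V f m)" if "m \<le> n" for m
      using it(3)[OF that] by (simp add: continuous_map_point_family)
    show "difference_quotient F Z (plain G) point (0 + m) (iter_dom F Z V m) (\<lambda>_. iter_ext F Z G V f m)
         (\<lambda>_. iter_ext F Z G V f (Suc m))" if "m < n"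
      using it(1)[OF that] c[of m] c[of "Suc m"] that sub[of F m]
      by (subst difference_quotient_is_quotient_ext[OF F Z G]) auto
  qed (use sub[of F 0] in auto)
  then show "Ck_family F Z (plain G) point n 0 (Base ` V) (\<lambda>_ p. f (base p))"
    using Ck_family_Base_cong[of F Z _ point n V G "\<lambda>_. f"] by simp
next
  assume f: "Ck_family F Z (plain G) point n 0 (Base ` V) (\<lambda>_ p. f (base p))"
  note it = Ck_family_iter_ext[OF F Z G V f]
  show "Ck_nat F Z G V n f"
    unfolding Ck_nat_iff_C1
  proof (intro conjI allI impI)
    show "continuous_map (subtopology (vtop Z) V) (vtop G) f"
      using Ck_family_continuous[OF f] continuous_map_Base_image[OF openin_subset[OF V], of F "vtop G" "\<lambda>p. f (base p)"]
      by (simp add: continuous_map_point_family)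
    fix m assume m: "m < n"
    have nm: "n - m = Suc (n - Suc m)" using m by simp
    have A: "Ck_family F Z (plain G) point (Suc (n - Suc m)) m (iter_dom F Z V m) (\<lambda>_. iter_ext F Z G V f m)"
      using it[of m] m nm by simp
    then obtain h where h: "difference_quotient F Z (plain G) point m (iter_dom F Z V m) (\<lambda>_. iter_ext F Z G V f m) h"
      "Ck_family F Z (plain G) point (n - Suc m) (Suc m) (ext_dom F Z m (iter_dom F Z V m)) h"
      by (rule Ck_family_SucE)
    have "is_quotient_ext F Z G m (iter_dom F Z V m) (iter_ext F Z G V f m) (h ())"
      using h(1) difference_quotient_is_quotient_ext[OF F Z G Ck_family_subset[OF A], of point _ h]
        Ck_family_continuous[OF A] Ck_family_continuous[OF h(2)] by simp
    then show "C1 F Z G m (iter_dom F Z V m) (iter_ext F Z G V f m)"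
      using Ck_family_continuous[OF A] by (auto simp: C1_def continuous_map_point_family)
  qed
qed

lemma Ck_iff_family:
  assumes "topological_field F" "topological_vector_space F Z" "topological_vector_space F G" "openin (vtop Z) V"
  shows "Ck F Z G V r f \<longleftrightarrow>
    (\<forall>n. enat n \<le> r \<longrightarrow> Ck_family F Z (plain G) point n 0 (Base ` V) (\<lambda>_ p. f (base p)))"
  unfolding Ck_def using Ck_nat_iff_family[OF assms] by simp

text \<open>The canonical quotients form a chain as required by \<open>Ck_family\<close> and are the
  only possible one. Orders run through the finite \<open>n\<close> below \<open>r\<close> because
  \<open>r\<close> may be infinite while \<open>Ck_family\<close> is a finite recursion.\<close>

lemma continuous_map_into_Cr_open_topology:
  assumes F: "topological_field F" and Z: "topological_vector_space F Z" and G: "topological_vector_space F G"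
    and V: "openin (vtop Z) V"
  shows "continuous_map Y (Cr_open_topology F r Z V G) g \<longleftrightarrow>
    (\<forall>y\<in>topspace Y. \<forall>z. z \<notin> V \<longrightarrow> g y z = 0) \<and>
    (\<forall>n. enat n \<le> r \<longrightarrow> Ck_family F Z (plain G) Y n 0 (Base ` V) (\<lambda>y p. g y (base p)))"
    (is "?L \<longleftrightarrow> ?R")
proof -
  let ?S = "{\<gamma>. Ck F Z G V r \<gamma> \<and> (\<forall>z. z \<notin> V \<longrightarrow> \<gamma> z = 0)}"
  let ?X = "\<lambda>m. tower_on F Z m (iter_dom F Z V m)"
  have sub: "iter_dom F Z V m \<subseteq> topspace (tower_top F Z m)" for m
    by (rule iter_dom_subset[OF openin_subset[OF V]])
  have top: "topspace (?X m) = iter_dom F Z V m" for m using sub[of m] by auto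
  have H: "Hausdorff_space (?X m)" for m
    by (intro Hausdorff_space_subtopology Hausdorff_tower topological_fieldD(3)[OF F] tvsD(2)[OF Z])
  have mem: "iter_ext F Z G V \<gamma> m \<in> topspace (compact_open_topology (?X m) (vtop G))"
    if "\<gamma> \<in> ?S" "enat m \<le> r" for \<gamma> m
  proof -
    have "Ck_nat F Z G V m \<gamma>" using that by (simp add: Ck_def)
    from Ck_nat_iter_ext(2,3)[OF F Z G V this, of m] show ?thesis
      by (simp only: topspace_compact_open top) auto
  qed
  have L: "?L \<longleftrightarrow> g ` topspace Y \<subseteq> ?S \<and>
      (\<forall>m. enat m \<le> r \<longrightarrow> continuous_map Y (compact_open_topology (?X m) (vtop G)) (\<lambda>y. iter_ext F Z G V (g y) m))"
    unfolding Cr_open_topology_def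
    unfolding setcompr_eq_image
    by (subst continuous_map_into_initial_topology) (use mem in auto)
  show ?thesis
  proof
    assume l: ?L
    then have S: "g y \<in> ?S" if "y \<in> topspace Y" for y
      using that unfolding L by auto
    have c: "continuous_family Y (?X m) (vtop G) (\<lambda>y. iter_ext F Z G V (g y) m)" if "enat m \<le> r" for m
      using l that unfolding L by (auto simp: continuous_map_into_compact_open[OF H])
    have "Ck_family F Z (plain G) Y n 0 (Base ` V) (\<lambda>y p. g y (base p))" if n: "enat n \<le> r" for n
    proof -
      have le: "enat m \<le> r" if "m \<le> n" for m
        using n that by (meson enat_ord_simps(1) order_trans)
      have "Ck_family F Z (plain G) Y n 0 (iter_dom F Z V 0) (\<lambda>y. iter_ext F Z G V (g y) 0)"
      proof (rule Ck_family_of_sequence[where U = "iter_dom F Z V" and G = "\<lambda>m y. iter_ext F Z G V (g y) m"])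
        fix m
        show "continuous_family Y (tower_on F Z (0 + m) (iter_dom F Z V m)) (vs_top (plain G))
            (\<lambda>y. iter_ext F Z G V (g y) m)" if "m \<le> n"
          using c[OF le[OF that]] by simp
        show "difference_quotient F Z (plain G) Y (0 + m) (iter_dom F Z V m) (\<lambda>y. iter_ext F Z G V (g y) m)
             (\<lambda>y. iter_ext F Z G V (g y) (Suc m))" if m: "m < n"
        proof -
          have "is_quotient_ext F Z G m (iter_dom F Z V m) (iter_ext F Z G V (g y) m) (iter_ext F Z G V (g y) (Suc m))"
            if y: "y \<in> topspace Y" for y
          proof -
            have "Ck_nat F Z G V (Suc m) (g y)"
              using S[OF y] le[of "Suc m"] m by (simp add: Ck_def del: Ck_nat.simps)
            from Ck_nat_iter_ext(1)[OF F Z G V this] show ?thesis by blast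
          qed
          then show ?thesis
            using c[OF le[of m]] c[OF le[of "Suc m"]] m
            by (subst difference_quotient_is_quotient_ext[OF F Z G]) (use sub in auto)
        qed
      qed (use sub[of 0] in auto)
      then show ?thesis using Ck_family_Base_cong[of F Z _ Y n V G g] by simp
    qed
    then show ?R using S by auto
  next
    assume R: ?R
    have S: "g y \<in> ?S" if y: "y \<in> topspace Y" for y
    proof -
      \<comment> \<open>Restricting the parameter to the single point \<open>y\<close> turns the
        family into one differentiable map.\<close>
      have "Ck_family F Z (plain G) point n 0 (Base ` V) (\<lambda>_ p. g y (base p))" if "enat n \<le> r" for n
        using Ck_family_pullback[of F Z "plain G" Y n 0 "Base ` V" "\<lambda>y p. g y (base p)" point "\<lambda>_. y"] R y that by simp
      then show ?thesis using R y by (auto simp: Ck_iff_family[OF F Z G V])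
    qed
    have "continuous_family Y (?X m) (vtop G) (\<lambda>y. iter_ext F Z G V (g y) m)" if m: "enat m \<le> r" for m
      using Ck_family_continuous[OF Ck_family_iter_ext[OF F Z G V, of Y m g m]] R m by simp
    then show ?L
      unfolding L using S mem by (auto simp: continuous_map_into_compact_open[OF H] topspace_compact_open)
  qed
qed

section \<open>Spaces of differentiable maps on manifolds\<close>

abbreviation open_family :: "'k::field topology \<Rightarrow> ('z::ab_group_add, 'k) tvs \<Rightarrow> ('w::ab_group_add, 'k) tvs \<Rightarrow>
    'y topology \<Rightarrow> nat \<Rightarrow> 'z set \<Rightarrow> ('y \<Rightarrow> 'z \<Rightarrow> 'w) \<Rightarrow> bool" where
  "open_family F Z E Y n V g \<equiv> Ck_family F Z (plain E) Y n 0 (Base ` V) (\<lambda>y p. g y (base p))"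

lemma open_family_cong:
  assumes "open_family F Z E Y n V g" "\<And>y x. y \<in> topspace Y \<Longrightarrow> x \<in> V \<Longrightarrow> g y x = g' y x"
  shows "open_family F Z E Y n V g'"
  by (rule Ck_family_cong[OF assms(1)]) (use assms(2) in auto)

lemma Ck_family_Base:
  assumes "Ck_family F Z (plain E) Y n j V g"
  shows "Ck_family F Z (tower_vs K E 0) Y n j V (\<lambda>y x. Base (g y x))"
  by (rule Ck_family_linop[OF assms]) (use continuous_map_Base[OF continuous_map_ident] in auto)

lemma open_family_outer:
  assumes "continuous_map F K (\<lambda>a. a)"
    and "open_family K E G point n W (\<lambda>_. f)"
    and "open_family F Z E Y n V g"
    and "\<And>y x. y \<in> topspace Y \<Longrightarrow> x \<in> V \<Longrightarrow> g y x \<in> W"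
  shows "open_family F Z G Y n V (\<lambda>y x. f (g y x))"
  using Ck_family_outer[OF assms(1,2) Ck_family_Base[OF assms(3)]] assms(4) by force

lemma open_family_pair:
  assumes "open_family F Z E Y n V g" "open_family F Z H Y n V h"
  shows "open_family F Z (prod_tvs E H) Y n V (\<lambda>y x. (g y x, h y x))"
  by (rule Ck_family_linop[OF Ck_family_pair[OF assms], where l = "\<lambda>u. u"])
    (auto simp: prod_tvs_def)

lemma open_family_id:
  assumes "V \<subseteq> carrier Z"
  shows "open_family F Z Z Y n V (\<lambda>_ x. x)"
  by (rule Ck_family_linear) (use assms continuous_map_base in auto)

lemma open_family_constant:
  assumes F: "topspace F \<subseteq> topspace K" and E: "topological_vector_space K E"
    and "continuous_map Y (vtop E) c" "V \<subseteq> carrier Z"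
  shows "open_family F Z E Y n V (\<lambda>y _. c y)"
  by (rule Ck_family_constant[where z = 0])
    (use assms tvsD[OF E] in auto)

lemma Ck_cong:
  assumes "topological_field F" "topological_vector_space F Z" "topological_vector_space F G" "openin (vtop Z) V"
    and "Ck F Z G V r f" "\<And>x. x \<in> V \<Longrightarrow> f x = f' x"
  shows "Ck F Z G V r f'"
  using assms(5) unfolding Ck_iff_family[OF assms(1-4)]
  by (auto intro: open_family_cong[where g = "\<lambda>_. f"] simp: assms(6))

lemma Ck_id:
  assumes "topological_field F" "topological_vector_space F Z" "openin (vtop Z) V"
  shows "Ck F Z Z V r (\<lambda>x. x)"
  unfolding Ck_iff_family[OF assms(1,2,2,3)] using open_family_id[OF openin_subset[OF assms(3)]] by blast

text \<open>The chain rule allows a larger field for the outer map. With the identity,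
  differentiable over \<open>F\<close>, as inner map it turns differentiability over
  \<open>K\<close> into differentiability over \<open>F\<close>.\<close>

lemma Ck_restrict_scalars:
  assumes ext: "topological_field_extension F K" and Z: "topological_vector_space K Z"
    and G: "topological_vector_space K G" and V: "openin (vtop Z) V"
    and f: "Ck K Z G V s f" and rs: "r \<le> s"
  shows "Ck F Z G V r f"
proof -
  have F: "topological_field F" and K: "topological_field K" and FK: "continuous_map F K (\<lambda>a. a)"
    using ext by (auto simp: topological_field_extension_def)
  note ZF = tvs_restrict_scalars[OF ext Z]
    and GF = tvs_restrict_scalars[OF ext G]
  have "open_family F Z G point n V (\<lambda>_. f)" if n: "enat n \<le> r" for n
  proof -
    have "open_family K Z G point n V (\<lambda>_. f)"
      using f rs n order_trans unfolding Ck_iff_family[OF K Z G V] by blast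
    from open_family_outer[OF FK this open_family_id[OF openin_subset[OF V]]] show ?thesis by simp
  qed
  then show ?thesis unfolding Ck_iff_family[OF F ZF GF V] by blast
qed

section \<open>Charts, and differentiable maps from a manifold to a vector space\<close>

lemma is_chartD:
  assumes "is_chart M (U, \<kappa>)"
  shows "openin (mtop M) U" "openin (vtop (model M)) (\<kappa> ` U)" "inj_on \<kappa> U"
    and "continuous_map (subtopology (mtop M) U) (vtop (model M)) \<kappa>"
    and "continuous_map (subtopology (vtop (model M)) (\<kappa> ` U)) (mtop M) (inv_into U \<kappa>)"
    and "openin (mtop M) N \<Longrightarrow> openin (vtop (model M)) (\<kappa> ` (U \<inter> N))"
proof -
  have h: "homeomorphic_map (subtopology (mtop M) U) (subtopology (vtop (model M)) (\<kappa> ` U)) \<kappa>"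
    and oU: "openin (mtop M) U" and oV: "openin (vtop (model M)) (\<kappa> ` U)"
    using assms by (auto simp: is_chart_def)
  then show "openin (mtop M) U" "openin (vtop (model M)) (\<kappa> ` U)" by auto
  have tU: "topspace (subtopology (mtop M) U) = U" using openin_subset[OF oU] by auto
  show inj: "inj_on \<kappa> U" using homeomorphic_imp_injective_map[OF h] tU by simp
  show "continuous_map (subtopology (mtop M) U) (vtop (model M)) \<kappa>"
    using homeomorphic_imp_continuous_map[OF h] by (simp add: continuous_map_in_subtopology)
  obtain g where g: "homeomorphic_maps (subtopology (mtop M) U) (subtopology (vtop (model M)) (\<kappa> ` U)) \<kappa> g"
    using h homeomorphic_map_maps by blast
  then have "continuous_map (subtopology (vtop (model M)) (\<kappa> ` U)) (mtop M) g"
    by (auto simp: homeomorphic_maps_def continuous_map_in_subtopology)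
  then show "continuous_map (subtopology (vtop (model M)) (\<kappa> ` U)) (mtop M) (inv_into U \<kappa>)"
  proof (rule continuous_map_eq)
    fix z assume "z \<in> topspace (subtopology (vtop (model M)) (\<kappa> ` U))"
    then obtain x where "x \<in> U" "z = \<kappa> x" by auto
    then show "g z = inv_into U \<kappa> z"
      using g inj tU by (auto simp: homeomorphic_maps_def)
  qed
  show "openin (vtop (model M)) (\<kappa> ` (U \<inter> N))" if N: "openin (mtop M) N"
  proof -
    have "openin (subtopology (mtop M) U) (U \<inter> N)" using N by (auto simp: openin_subtopology)
    then have "openin (subtopology (vtop (model M)) (\<kappa> ` U)) (\<kappa> ` (U \<inter> N))"
      using homeomorphic_imp_open_map[OF h] by (auto simp: open_map_def)
    then show ?thesis using openin_trans_full oV by blast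
  qed
qed

lemma atlas_subset_charts: "manifold F r Z M \<Longrightarrow> atlas M \<subseteq> charts F r M"
  by (auto simp: manifold_def charts_def)

lemma chartsD: "(U, \<kappa>) \<in> charts F r M \<Longrightarrow> is_chart M (U, \<kappa>)"
  by (simp add: charts_def)

lemma manifold_chart_at:
  assumes "manifold F r Z M" "x \<in> topspace (mtop M)"
  obtains U \<kappa> where "(U, \<kappa>) \<in> atlas M" "x \<in> U"
  using assms unfolding manifold_def by auto

lemma open_mfd_simps [simp]:
  "mtop (open_mfd E U) = subtopology (vtop E) U" "model (open_mfd E U) = E"
  "atlas (open_mfd E U) = {(U, \<lambda>x. x)}"
  by (simp_all add: open_mfd_def)

lemma inv_into_id: "x \<in> U \<Longrightarrow> inv_into U (\<lambda>x. x) x = x"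
  by (metis f_inv_into_f image_ident)

lemma is_chart_open_mfd:
  assumes "openin (vtop E) U"
  shows "is_chart (open_mfd E U) (U, \<lambda>x. x)"
  using assms homeomorphic_map_id[of "subtopology (vtop E) U" "subtopology (vtop E) U"]
  by (simp add: is_chart_def subtopology_subtopology openin_subtopology_refl openin_subset id_def)

lemma id_chart_open_mfd:
  assumes "topological_field F" "topological_vector_space F E" "openin (vtop E) U"
  shows "(U, \<lambda>x. x) \<in> charts F r (open_mfd E U)"
proof -
  have "Ck F E E U r ((\<lambda>x. x) \<circ> inv_into U (\<lambda>x. x))"
    by (rule Ck_cong[OF assms(1,2,2,3) Ck_id[OF assms]]) (simp add: inv_into_id)
  then show ?thesis
    using is_chart_open_mfd[OF assms(3)] by (simp add: charts_def compatible_def)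
qed

text \<open>Every chart \<open>\<eta>\<close> of \<open>E\<close> is compatible with the identity
  chart, so \<open>\<eta>\<close> is itself of order \<open>r\<close> and composing with it loses
  nothing; one chart on the target side is enough.\<close>

lemma Ck_mfd_into_tvs:
  assumes F: "topological_field F" and Z: "topological_vector_space F Z" and E: "topological_vector_space F E"
    and M: "manifold F r Z M"
  shows "Ck_mfd F r M (tvs_mfd E) \<gamma> \<longleftrightarrow>
    (\<forall>(U, \<kappa>)\<in>charts F r M. Ck F Z E (\<kappa> ` U) r (\<lambda>z. \<gamma> (inv_into U \<kappa> z)))"
    (is "?L \<longleftrightarrow> ?R")
proof -
  have mZ: "model M = Z" using M by (simp add: manifold_def)
  have oE: "openin (vtop E) (carrier E)" by simp
  show ?thesis
  proof
    assume L: ?L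
    show ?R
    proof clarify
      fix U \<kappa> assume c: "(U, \<kappa>) \<in> charts F r M"
      have "U \<subseteq> topspace (mtop M)" using is_chartD(1)[OF chartsD[OF c]] by (rule openin_subset)
      then have "U \<inter> \<gamma> -` carrier E = U"
        using L by (auto simp: Ck_mfd_def continuous_map_def Pi_iff)
      then show "Ck F Z E (\<kappa> ` U) r (\<lambda>z. \<gamma> (inv_into U \<kappa> z))"
        using L c id_chart_open_mfd[OF F E oE, of r] by (fastforce simp: Ck_mfd_def mZ o_def)
    qed
  next
    assume R: ?R
    have fam: "open_family F Z E point n (\<kappa> ` U) (\<lambda>_ z. \<gamma> (inv_into U \<kappa> z))"
      if c: "(U, \<kappa>) \<in> charts F r M" and n: "enat n \<le> r" for U \<kappa> n
      using R c n is_chartD(2)[OF chartsD[OF c]] Ck_iff_family[OF F Z E, of "\<kappa> ` U" r] by (auto simp: mZ)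
    have cont: "continuous_map (mtop M) (vtop E) \<gamma>"
    proof (rule pasting_lemma[where I = "atlas M" and T = fst and f = "\<lambda>_. \<gamma>"])
      fix i assume i: "i \<in> atlas M"
      obtain U \<kappa> where [simp]: "i = (U, \<kappa>)" by (cases i)
      have c: "(U, \<kappa>) \<in> charts F r M" using i atlas_subset_charts[OF M] by auto
      note ch = is_chartD[OF chartsD[OF c], unfolded mZ]
      show "openin (mtop M) (fst i)" using ch(1) by simp
      have "continuous_map (subtopology (vtop Z) (\<kappa> ` U)) (vtop E) (\<lambda>z. \<gamma> (inv_into U \<kappa> z))"
        using R c by (auto simp: Ck_def zero_enat_def[symmetric] dest!: spec[of _ 0])
      moreover have "continuous_map (subtopology (mtop M) U) (subtopology (vtop Z) (\<kappa> ` U)) \<kappa>"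
        using ch(4) by (auto simp: continuous_map_in_subtopology)
      ultimately have "continuous_map (subtopology (mtop M) U) (vtop E) ((\<lambda>z. \<gamma> (inv_into U \<kappa> z)) \<circ> \<kappa>)"
        using continuous_map_compose by blast
      then have "continuous_map (subtopology (mtop M) U) (vtop E) \<gamma>"
        by (rule continuous_map_eq) (use ch(3) in auto)
      then show "continuous_map (subtopology (mtop M) (fst i)) (vtop E) \<gamma>" by simp
    next
      fix x assume "x \<in> topspace (mtop M)"
      then show "\<exists>j. j \<in> atlas M \<and> x \<in> fst j \<and> \<gamma> x = \<gamma> x"
        using manifold_chart_at[OF M] by (metis fst_conv)
    qed auto
    have "Ck F Z E (\<kappa> ` (U \<inter> \<gamma> -` V)) r (\<eta> \<circ> \<gamma> \<circ> inv_into U \<kappa>)"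
      if c: "(U, \<kappa>) \<in> charts F r M" and d: "(V, \<eta>) \<in> charts F r (tvs_mfd E)" for U \<kappa> V \<eta>
    proof -
      note ch = is_chartD[OF chartsD[OF c], unfolded mZ] and dh = is_chartD[OF chartsD[OF d], simplified]
      have V: "V \<subseteq> carrier E" "openin (vtop E) V" using dh(1) openin_subset by auto
      have "openin (mtop M) {x \<in> topspace (mtop M). \<gamma> x \<in> V}"
        using cont V(2) by (rule openin_continuous_map_preimage)
      from ch(6)[OF this] have "openin (vtop Z) (\<kappa> ` (U \<inter> {x \<in> topspace (mtop M). \<gamma> x \<in> V}))" .
      moreover have "U \<inter> {x \<in> topspace (mtop M). \<gamma> x \<in> V} = U \<inter> \<gamma> -` V"
        using openin_subset[OF ch(1)] by auto
      ultimately have o: "openin (vtop Z) (\<kappa> ` (U \<inter> \<gamma> -` V))" by simp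
      have eta: "Ck F E E V r (\<eta> \<circ> inv_into (carrier E) (\<lambda>x. x))"
        using d V(1) by (simp add: charts_def compatible_def Int_absorb2)
      have "open_family F Z E point n (\<kappa> ` (U \<inter> \<gamma> -` V)) (\<lambda>_. \<eta> \<circ> \<gamma> \<circ> inv_into U \<kappa>)" if n: "enat n \<le> r" for n
      proof -
        have e: "open_family F E E point n V (\<lambda>_. \<eta> \<circ> inv_into (carrier E) (\<lambda>x. x))"
          using eta n unfolding Ck_iff_family[OF F E E V(2)] by blast
        have g: "open_family F Z E point n (\<kappa> ` (U \<inter> \<gamma> -` V)) (\<lambda>_ z. \<gamma> (inv_into U \<kappa> z))"
          by (rule Ck_family_mono[OF fam[OF c n]]) auto
        have "open_family F Z E point n (\<kappa> ` (U \<inter> \<gamma> -` V)) (\<lambda>_ z. (\<eta> \<circ> inv_into (carrier E) (\<lambda>x. x)) (\<gamma> (inv_into U \<kappa> z)))"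
          by (rule open_family_outer[OF continuous_map_ident e g]) (use ch(3) in auto)
        then show ?thesis
        proof (rule open_family_cong)
          fix z assume "z \<in> \<kappa> ` (U \<inter> \<gamma> -` V)"
          then show "(\<eta> \<circ> inv_into (carrier E) (\<lambda>x. x)) (\<gamma> (inv_into U \<kappa> z)) = (\<eta> \<circ> \<gamma> \<circ> inv_into U \<kappa>) z"
            using ch(3) V(1) by (auto simp: inv_into_id subset_iff)
        qed
      qed
      then show ?thesis unfolding Ck_iff_family[OF F Z E o] by blast
    qed
    then show ?L using cont by (auto simp: Ck_mfd_def mZ)
  qed
qed

section \<open>The topological vector space of differentiable maps on a manifold\<close>

lemma carrier_Cr_space:
  "carrier (Cr_space F r M E) = {\<gamma>. Ck_mfd F r M (tvs_mfd E) \<gamma> \<and> (\<forall>x. x \<notin> topspace (mtop M) \<longrightarrow> \<gamma> x = 0)}"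
  by (simp add: Cr_space_def topspace_initial_topology)

lemma scale_Cr_space [simp]: "scale (Cr_space F r M E) a \<gamma> = (\<lambda>x. scale E a (\<gamma> x))"
  by (simp add: Cr_space_def)

text \<open>Both initial topologies, over the charts and over the orders, are resolved here;
  afterwards the topology of the function space is used only through this equivalence and its
  consequences.\<close>

lemma continuous_map_into_Cr_space:
  assumes F: "topological_field F" and Z: "topological_vector_space F Z" and E: "topological_vector_space F E"
    and M: "manifold F r Z M"
  shows "continuous_map Y (vtop (Cr_space F r M E)) g \<longleftrightarrow>
    (\<forall>y\<in>topspace Y. \<forall>x. x \<notin> topspace (mtop M) \<longrightarrow> g y x = 0) \<and>
    (\<forall>(U, \<kappa>)\<in>charts F r M. \<forall>n. enat n \<le> r \<longrightarrow>
       open_family F Z E Y n (\<kappa> ` U) (\<lambda>y z. g y (inv_into U \<kappa> z)))"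
proof -
  have mZ: "model M = Z" using M by (simp add: manifold_def)
  let ?S = "{\<gamma>. Ck_mfd F r M (tvs_mfd E) \<gamma> \<and> (\<forall>x. x \<notin> topspace (mtop M) \<longrightarrow> \<gamma> x = 0)}"
  \<comment> \<open>A function read in a chart and extended by 0, since the members of the function
    space on an open set vanish outside it.\<close>
  define L where "L = (\<lambda>(U :: 'd set, \<kappa> :: 'd \<Rightarrow> 'b) (\<gamma> :: 'd \<Rightarrow> 'c) z. if z \<in> \<kappa> ` U then \<gamma> (inv_into U \<kappa> z) else 0)"
  let ?T = "\<lambda>(U, \<kappa>). Cr_open_topology F r Z (\<kappa> ` U) E"
  have top: "vtop (Cr_space F r M E) = initial_topology ?S ((\<lambda>c. (L c, ?T c)) ` charts F r M)"
    unfolding Cr_space_def mZ L_def by (auto intro!: arg_cong[where f = "initial_topology _"] image_eqI)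
  have o: "openin (vtop Z) (\<kappa> ` U)" if "(U, \<kappa>) \<in> charts F r M" for U \<kappa>
    using is_chartD(2)[OF chartsD[OF that]] mZ by simp
  have mem: "L c \<gamma> \<in> topspace (?T c)" if "\<gamma> \<in> ?S" and c: "c \<in> charts F r M" for \<gamma> c
  proof -
    obtain U \<kappa> where [simp]: "c = (U, \<kappa>)" by (cases c)
    have "Ck F Z E (\<kappa> ` U) r (\<lambda>z. \<gamma> (inv_into U \<kappa> z))"
      using that Ck_mfd_into_tvs[OF F Z E M] by auto
    from Ck_cong[OF F Z E o[of U \<kappa>] this, where f' = "L c \<gamma>"] c
    have "Ck F Z E (\<kappa> ` U) r (L c \<gamma>)" by (auto simp: L_def)
    then show ?thesis
      by (simp add: Cr_open_topology_def topspace_initial_topology) (simp add: L_def)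
  qed
  have cr: "continuous_map Y (?T (U, \<kappa>)) (\<lambda>y. L (U, \<kappa>) (g y)) \<longleftrightarrow>
      (\<forall>n. enat n \<le> r \<longrightarrow> open_family F Z E Y n (\<kappa> ` U) (\<lambda>y z. g y (inv_into U \<kappa> z)))"
    if c: "(U, \<kappa>) \<in> charts F r M" for U \<kappa>
  proof -
    have "open_family F Z E Y n (\<kappa> ` U) (\<lambda>y. L (U, \<kappa>) (g y)) \<longleftrightarrow>
        open_family F Z E Y n (\<kappa> ` U) (\<lambda>y z. g y (inv_into U \<kappa> z))" for n
      by (rule iffI; erule open_family_cong) (auto simp: L_def)
    moreover have "L (U, \<kappa>) \<gamma> z = 0" if "z \<notin> \<kappa> ` U" for \<gamma> z using that by (auto simp: L_def)
    ultimately show ?thesis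
      using continuous_map_into_Cr_open_topology[OF F Z E o[OF c], of Y r "\<lambda>y. L (U, \<kappa>) (g y)"] by simp
  qed
  have S: "g y \<in> ?S" if y: "y \<in> topspace Y" and v: "\<And>x. x \<notin> topspace (mtop M) \<Longrightarrow> g y x = 0"
    and fam: "\<And>U \<kappa> n. (U, \<kappa>) \<in> charts F r M \<Longrightarrow> enat n \<le> r \<Longrightarrow>
       open_family F Z E Y n (\<kappa> ` U) (\<lambda>y z. g y (inv_into U \<kappa> z))" for y
  proof -
    have "Ck F Z E (\<kappa> ` U) r (\<lambda>z. g y (inv_into U \<kappa> z))" if c: "(U, \<kappa>) \<in> charts F r M" for U \<kappa>
      unfolding Ck_iff_family[OF F Z E o[OF c]]
    proof (intro allI impI)
      fix n assume n: "enat n \<le> r"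
      have "continuous_map point Y (\<lambda>_. y)" using y by simp
      from Ck_family_pullback[OF fam[OF c n] this]
      show "open_family F Z E point n (\<kappa> ` U) (\<lambda>_ z. g y (inv_into U \<kappa> z))" .
    qed
    then show ?thesis using v Ck_mfd_into_tvs[OF F Z E M] by auto
  qed
  have "continuous_map Y (vtop (Cr_space F r M E)) g \<longleftrightarrow>
      g ` topspace Y \<subseteq> ?S \<and> (\<forall>c\<in>charts F r M. continuous_map Y (?T c) (\<lambda>y. L c (g y)))"
    unfolding top by (subst continuous_map_into_initial_topology) (use mem in auto)
  also have "\<dots> \<longleftrightarrow> g ` topspace Y \<subseteq> ?S \<and> (\<forall>(U, \<kappa>)\<in>charts F r M. \<forall>n. enat n \<le> r \<longrightarrow>
       open_family F Z E Y n (\<kappa> ` U) (\<lambda>y z. g y (inv_into U \<kappa> z)))"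
    using cr by (intro conj_cong refl ball_cong) auto
  also have "\<dots> \<longleftrightarrow> (\<forall>y\<in>topspace Y. \<forall>x. x \<notin> topspace (mtop M) \<longrightarrow> g y x = 0) \<and>
    (\<forall>(U, \<kappa>)\<in>charts F r M. \<forall>n. enat n \<le> r \<longrightarrow>
       open_family F Z E Y n (\<kappa> ` U) (\<lambda>y z. g y (inv_into U \<kappa> z)))"
    using S by blast
  finally show ?thesis .
qed

text \<open>The identity of the function space is continuous, so \<open>\<gamma>\<close> itself may
  serve as the parameter. This is the universal family, from which continuous maps into the space
  produce their families by pullback.\<close>

lemma Cr_space_family:
  assumes "topological_field F" "topological_vector_space F Z" "topological_vector_space F E" "manifold F r Z M"
    and "(U, \<kappa>) \<in> charts F r M" "enat n \<le> r"
  shows "open_family F Z E (vtop (Cr_space F r M E)) n (\<kappa> ` U) (\<lambda>\<gamma> z. \<gamma> (inv_into U \<kappa> z))"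
  using continuous_map_into_Cr_space[OF assms(1-4), of "vtop (Cr_space F r M E)" "\<lambda>\<gamma>. \<gamma>"] assms(5,6)
    continuous_map_ident by auto

text \<open>On \<open>M\<close> this is point evaluation of the universal family in a chart, for
  which order 0 suffices; outside \<open>M\<close> all members of the carrier vanish.\<close>

lemma continuous_map_Cr_space_eval:
  assumes F: "topological_field F" and Z: "topological_vector_space F Z" and E: "topological_vector_space F E"
    and M: "manifold F r Z M"
  shows "continuous_map (vtop (Cr_space F r M E)) (vtop E) (\<lambda>\<gamma>. \<gamma> x)"
proof (cases "x \<in> topspace (mtop M)")
  case True
  then obtain U \<kappa> where c: "(U, \<kappa>) \<in> atlas M" and x: "x \<in> U" by (rule manifold_chart_at[OF M])
  have c': "(U, \<kappa>) \<in> charts F r M" using c atlas_subset_charts[OF M] by auto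
  note ch = is_chartD[OF chartsD[OF c']]
  have "enat 0 \<le> r" by (simp add: zero_enat_def[symmetric])
  note fam = Cr_space_family[OF F Z E M c' this]
  have "Base (\<kappa> x) \<in> topspace (tower_on F Z 0 (Base ` \<kappa> ` U))"
    using Ck_family_subset[OF fam] x by auto
  from continuous_family_eval[OF Ck_family_continuous[OF fam] this] show ?thesis
    using ch(3) x by simp
next
  case False
  have "continuous_map (vtop (Cr_space F r M E)) (vtop E) (\<lambda>_. 0)"
    using tvsD(1)[OF E] by simp
  then show ?thesis
    by (rule continuous_map_eq) (use False in \<open>auto simp: carrier_Cr_space\<close>)
qed

text \<open>Sums and multiples of universal families are families again, with two functions, or a
  scalar and a function, as parameter. Scalars from \<open>K\<close> are harmless, since they enter
  as parameters and differentiation is over \<open>F\<close>. Point evaluations are continuous and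
  separate functions, which gives the Hausdorff property.\<close>

lemma tvs_Cr_space:
  assumes ext: "topological_field_extension F K" and Z: "topological_vector_space F Z"
    and E: "topological_vector_space K E" and M: "manifold F r Z M"
  shows "topological_vector_space K (Cr_space F r M E)"
proof -
  have F: "topological_field F" and K: "topological_field K" and FK: "continuous_map F K (\<lambda>a. a)"
    "topspace F \<subseteq> topspace K"
    using ext by (auto simp: topological_field_extension_def)
  note EF = tvs_restrict_scalars[OF ext E] and E' = tvsD[OF E]
  note char = continuous_map_into_Cr_space[OF F Z EF M]
  have mZ: "model M = Z" using M by (simp add: manifold_def)
  let ?C = "Cr_space F r M E"
  have ev: "\<gamma> x \<in> carrier E" if "\<gamma> \<in> carrier ?C" for \<gamma> x
    using continuous_map_Cr_space_eval[OF F Z EF M, of x] that by (auto simp: continuous_map_def)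
  have sub: "\<kappa> ` U \<subseteq> carrier Z" if "(U, \<kappa>) \<in> charts F r M" for U \<kappa>
    using is_chartD(2)[OF chartsD[OF that]] mZ openin_subset by auto
  note fam = Cr_space_family[OF F Z EF M]
  have "continuous_map point (vtop ?C) (\<lambda>_. 0)"
    unfolding char
    using open_family_constant[OF FK(2) E, of point "\<lambda>_. 0" _ Z] E'(1) sub by (auto simp: zero_fun_def)
  then have zero: "0 \<in> carrier ?C"
    by (simp only: continuous_map_def Pi_iff topspace_discrete_topology) blast
  have add: "continuous_map (prod_topology (vtop ?C) (vtop ?C)) (vtop ?C) (\<lambda>(v, w). v + w)"
    unfolding char
  proof (intro conjI ballI allI impI)
    fix y x assume "y \<in> topspace (prod_topology (vtop ?C) (vtop ?C))" "x \<notin> topspace (mtop M)"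
    then show "(case y of (v, w) \<Rightarrow> v + w) x = 0"
      by (auto simp: carrier_Cr_space plus_fun_def)
  next
    fix c assume c: "c \<in> charts F r M"
    obtain U \<kappa> where cU: "c = (U, \<kappa>)" by (cases c)
    have "open_family F Z E (prod_topology (vtop ?C) (vtop ?C)) n (\<kappa> ` U) (\<lambda>y z. (case y of (v, w) \<Rightarrow> v + w) (inv_into U \<kappa> z))"
      if n: "enat n \<le> r" for n
      using Ck_family_plus[OF FK(2) topological_module_plain[OF K E]
          Ck_family_pullback[OF fam[OF c[unfolded cU] n] continuous_map_fst]
          Ck_family_pullback[OF fam[OF c[unfolded cU] n] continuous_map_snd]]
      by (simp add: case_prod_unfold plus_fun_def)
    then show "case c of (U, \<kappa>) \<Rightarrow> \<forall>n. enat n \<le> r \<longrightarrow>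
        open_family F Z E (prod_topology (vtop ?C) (vtop ?C)) n (\<kappa> ` U)
          (\<lambda>y z. (case y of (v, w) \<Rightarrow> v + w) (inv_into U \<kappa> z))" by (simp add: cU)
  qed
  have mult: "continuous_map (prod_topology K (vtop ?C)) (vtop ?C) (\<lambda>(a, v). scale ?C a v)"
    unfolding char
  proof (intro conjI ballI allI impI)
    fix y x assume "y \<in> topspace (prod_topology K (vtop ?C))" "x \<notin> topspace (mtop M)"
    then show "(case y of (a, v) \<Rightarrow> scale ?C a v) x = 0"
      by (auto simp: carrier_Cr_space E')
  next
    fix c assume c: "c \<in> charts F r M"
    obtain U \<kappa> where cU: "c = (U, \<kappa>)" by (cases c)
    have "open_family F Z E (prod_topology K (vtop ?C)) n (\<kappa> ` U) (\<lambda>y z. (case y of (a, v) \<Rightarrow> scale ?C a v) (inv_into U \<kappa> z))"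
      if n: "enat n \<le> r" for n
    proof -
      have "Ck_family F Z (scalar_vs K) (prod_topology K (vtop ?C)) n 0 (Base ` \<kappa> ` U) (\<lambda>y _. fst y)"
        by (rule Ck_family_constant[where z = 0])
          (use sub[of U \<kappa>] c cU topological_fieldD(1)[OF K] in \<open>auto simp: continuous_map_fst\<close>)
      from Ck_family_smult[OF FK(1) K topological_module_plain[OF K E] this
          Ck_family_pullback[OF fam[OF c[unfolded cU] n] continuous_map_snd]]
      show ?thesis by (simp add: case_prod_unfold)
    qed
    then show "case c of (U, \<kappa>) \<Rightarrow> \<forall>n. enat n \<le> r \<longrightarrow>
        open_family F Z E (prod_topology K (vtop ?C)) n (\<kappa> ` U)
          (\<lambda>y z. (case y of (a, v) \<Rightarrow> scale ?C a v) (inv_into U \<kappa> z))" by (simp add: cU)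
  qed
  have haus: "Hausdorff_space (vtop ?C)"
    unfolding Hausdorff_space_def
  proof (intro allI impI, elim conjE)
    fix \<gamma> \<eta> assume g: "\<gamma> \<in> carrier ?C" "\<eta> \<in> carrier ?C" "\<gamma> \<noteq> \<eta>"
    then obtain x where x: "\<gamma> x \<noteq> \<eta> x" by auto
    then obtain A B where AB: "openin (vtop E) A" "openin (vtop E) B" "\<gamma> x \<in> A" "\<eta> x \<in> B" "disjnt A B"
      using E'(2) ev[OF g(1)] ev[OF g(2)] unfolding Hausdorff_space_def by meson
    note pre = openin_continuous_map_preimage[OF continuous_map_Cr_space_eval[OF F Z EF M, of x]]
    show "\<exists>U V. openin (vtop ?C) U \<and> openin (vtop ?C) V \<and> \<gamma> \<in> U \<and> \<eta> \<in> V \<and> disjnt U V"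
      by (rule exI[of _ "{\<gamma> \<in> carrier ?C. \<gamma> x \<in> A}"], rule exI[of _ "{\<gamma> \<in> carrier ?C. \<gamma> x \<in> B}"])
        (use AB pre g in \<open>auto simp: disjnt_def\<close>)
  qed
  show ?thesis
    unfolding topological_vector_space_def
    by (intro conjI zero add mult haus) (auto simp: plus_fun_def E' ev)
qed

section \<open>Superposition operators\<close>

text \<open>
  Freezes the first variable: it is \<open>s\<close> in the base point, and its increments are zero.
\<close>

primrec slice :: "'s::zero \<Rightarrow> ('b, 'k) tower \<Rightarrow> ('s \<times> 'b, 'k) tower" where
  "slice s (Base e) = Base (s, e)"
| "slice s (Step x v t) = Step (slice s x) (slice 0 v) t"

lemma prod_tvs_simps [simp]:
  "vtop (prod_tvs E H) = prod_topology (vtop E) (vtop H)"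
  "scale (prod_tvs E H) a u = (scale E a (fst u), scale H a (snd u))"
  by (simp_all add: prod_tvs_def case_prod_unfold)

text \<open>Directions are sliced at 0 and base points at \<open>s\<close>, so the induction ranges
  over all \<open>s\<close> and uses that 0 lies in the carrier.\<close>

lemma continuous_map_slice:
  assumes "0 \<in> carrier S" "s \<in> carrier S"
  shows "continuous_map (tower_top K B j) (tower_top K (prod_tvs S B) j) (slice s)"
  using assms(2)
proof (induction j arbitrary: s)
  case 0
  have "continuous_map (tower_top K B 0) (vtop (prod_tvs S B)) (\<lambda>p. (s, base p))"
    unfolding prod_tvs_simps
    by (rule continuous_map_pairedI[OF _ continuous_map_base]) (use 0 in simp)
  from continuous_map_Base[OF this] show ?case
    by (rule continuous_map_eq) auto
next
  case (Suc j)
  show ?case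
    by (rule continuous_map_eq[OF continuous_map_Step[OF
            continuous_map_compose[OF continuous_map_pt Suc.IH[OF Suc.prems]]
            continuous_map_compose[OF continuous_map_dir Suc.IH[OF assms(1)]]
            continuous_map_par]])
      (auto simp: topspace_tower_Suc)
qed

lemma slice_move:
  assumes "\<forall>t\<in>topspace K. scale S t 0 = 0"
    and "x \<in> topspace (tower_top K B j)" "v \<in> topspace (tower_top K B j)" "t \<in> topspace K"
  shows "slice (s :: 's::ab_group_add) (tower_move B x t v) =
    tower_move (prod_tvs S B) (slice s x) t (slice 0 v)"
  using assms(2-)
proof (induction j arbitrary: x v s)
  case 0
  then show ?case using assms(1) by auto
next
  case (Suc j)
  then show ?case using assms(1) by (auto simp: topspace_tower_Suc)
qed

lemma slice_iter_dom:
  assumes S: "0 \<in> carrier S" "\<forall>t\<in>topspace K. scale S t 0 = 0"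
    and \<Omega>: "\<Omega> \<subseteq> carrier B" and s: "s \<in> U" and e: "e \<in> iter_dom K B \<Omega> j"
  shows "slice s e \<in> iter_dom K (prod_tvs S B) (U \<times> \<Omega>) j"
  using e
proof (induction j arbitrary: e)
  case (Suc j)
  then obtain x v t where e: "e = Step x v t" "x \<in> iter_dom K B \<Omega> j" "v \<in> topspace (tower_top K B j)"
    "t \<in> topspace K" "tower_move B x t v \<in> iter_dom K B \<Omega> j"
    by (auto elim: ext_domE)
  have "x \<in> topspace (tower_top K B j)" using e(2) iter_dom_subset[OF \<Omega>] by blast
  moreover have "slice 0 v \<in> topspace (tower_top K (prod_tvs S B) j)"
    using continuous_map_slice[OF S(1) S(1)] e(3) by (auto simp: continuous_map_def Pi_iff)
  ultimately show ?case
    using Suc.IH[OF e(2)] Suc.IH[OF e(5)] e slice_move[OF S(2), of x B j v t s]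
    by (simp add: Step_in_ext_dom)
qed (use s in auto)

lemma iter_ext_cong:
  assumes "\<And>x. x \<in> U \<Longrightarrow> f x = g x"
  shows "iter_ext K E G U f m = iter_ext K E G U g m"
proof (induction m)
  case 0
  show ?case using assms by (auto simp: fun_eq_iff)
qed simp

text \<open>Slicing commutes with moving, so \<open>f^[j+1]\<close> after \<open>slice s\<close> is
  continuous and satisfies the quotient equation of \<open>f(s, .)\<close>; uniqueness identifies it
  with the canonical quotient.\<close>

lemma iter_ext_slice:
  assumes K: "topological_field K" and S: "topological_vector_space K S"
    and B: "topological_vector_space K B" and G: "topological_vector_space K G"
    and U: "openin (vtop S) U" and \<Omega>: "openin (vtop B) \<Omega>" and s: "s \<in> U"
    and f: "Ck_nat K (prod_tvs S B) G (U \<times> \<Omega>) n f"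
  shows "Ck_nat K B G \<Omega> n (\<lambda>e. f (s, e))"
    and "j \<le> n \<Longrightarrow> e \<in> iter_dom K B \<Omega> j \<Longrightarrow>
      iter_ext K B G \<Omega> (\<lambda>e. f (s, e)) j e = iter_ext K (prod_tvs S B) G (U \<times> \<Omega>) f j (slice s e)"
proof -
  note S' = tvsD[OF S] and B' = tvsD[OF B]
  note SB = tvs_prod[OF S B]
  have S0: "\<forall>t\<in>topspace K. scale S t 0 = 0" using S'(9) by blast
  have o: "openin (vtop (prod_tvs S B)) (U \<times> \<Omega>)" using U \<Omega> by (simp add: openin_prod_Times_iff)
  have sub: "\<Omega> \<subseteq> carrier B" using \<Omega> by (rule openin_subset)
  have sS: "s \<in> carrier S" using s openin_subset[OF U] by blast
  have "continuous_map point (vtop S) (\<lambda>_. s)" using sS by simp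
  then have g: "open_family K B (prod_tvs S B) point n \<Omega> (\<lambda>_ e. (s, e))"
    by (rule open_family_pair[OF open_family_constant[OF order_refl S _ sub] open_family_id[OF sub]])
  have "open_family K (prod_tvs S B) G point n (U \<times> \<Omega>) (\<lambda>_. f)"
    using f Ck_nat_iff_family[OF K SB G o] by blast
  from open_family_outer[OF continuous_map_ident this g]
  have "open_family K B G point n \<Omega> (\<lambda>_ e. f (s, e))" using s by simp
  then show N: "Ck_nat K B G \<Omega> n (\<lambda>e. f (s, e))"
    using Ck_nat_iff_family[OF K B G \<Omega>] by blast
  show "iter_ext K B G \<Omega> (\<lambda>e. f (s, e)) j e = iter_ext K (prod_tvs S B) G (U \<times> \<Omega>) f j (slice s e)"
    if "j \<le> n" "e \<in> iter_dom K B \<Omega> j"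
    using that
  proof (induction j arbitrary: e)
    case 0
    then show ?case using s by auto
  next
    case (Suc j)
    note dom = slice_iter_dom[OF S'(1) S0 sub s]
    let ?f = "iter_ext K (prod_tvs S B) G (U \<times> \<Omega>) f"
    have q: "is_quotient_ext K (prod_tvs S B) G j (iter_dom K (prod_tvs S B) (U \<times> \<Omega>) j) (?f j) (?f (Suc j))"
      using Ck_nat_iter_ext(1)[OF K SB G o f] Suc.prems by simp
    have "is_quotient_ext K B G j (iter_dom K B \<Omega> j) (iter_ext K B G \<Omega> (\<lambda>e. f (s, e)) j) (?f (Suc j) \<circ> slice s)"
      unfolding is_quotient_ext_def
    proof (intro conjI allI impI)
      have "continuous_map (tower_on K B (Suc j) (iter_dom K B \<Omega> (Suc j)))
          (tower_on K (prod_tvs S B) (Suc j) (iter_dom K (prod_tvs S B) (U \<times> \<Omega>) (Suc j))) (slice s)"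
        using continuous_map_from_subtopology[OF continuous_map_slice[OF S'(1) sS]] dom
        by (auto simp: continuous_map_in_subtopology simp del: iter_dom.simps)
      moreover have "continuous_map (tower_on K (prod_tvs S B) (Suc j) (iter_dom K (prod_tvs S B) (U \<times> \<Omega>) (Suc j)))
          (vtop G) (?f (Suc j))"
        using q by (simp add: is_quotient_ext_def)
      ultimately show "continuous_map (tower_on K B (Suc j) (ext_dom K B j (iter_dom K B \<Omega> j))) (vtop G)
          (?f (Suc j) \<circ> slice s)"
        using continuous_map_compose by (simp only: iter_dom.simps) blast
    next
      fix x v t assume a: "Step x v t \<in> ext_dom K B j (iter_dom K B \<Omega> j) \<and> t \<noteq> 0"
      then have x: "x \<in> iter_dom K B \<Omega> j" "tower_move B x t v \<in> iter_dom K B \<Omega> j"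
        "v \<in> topspace (tower_top K B j)" "t \<in> topspace K"
        by (auto simp: Step_in_ext_dom)
      then have x': "x \<in> topspace (tower_top K B j)" using iter_dom_subset[OF sub] by blast
      have "slice s (Step x v t) \<in> iter_dom K (prod_tvs S B) (U \<times> \<Omega>) (Suc j)"
        by (rule dom) (use a in simp)
      then have "?f (Suc j) (Step (slice s x) (slice 0 v) t) =
          scale G (inverse t) (?f j (tower_move (prod_tvs S B) (slice s x) t (slice 0 v)) - ?f j (slice s x))"
        using q a unfolding is_quotient_ext_def by auto
      then show "(?f (Suc j) \<circ> slice s) (Step x v t) = scale G (inverse t)
          (iter_ext K B G \<Omega> (\<lambda>e. f (s, e)) j (tower_move B x t v) -
           iter_ext K B G \<Omega> (\<lambda>e. f (s, e)) j x)"
        using Suc.IH[OF _ x(1)] Suc.IH[OF _ x(2)] Suc.prems(1) slice_move[OF S0 x' x(3,4), of s] by simp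
    qed
    from quotient_ext_eq[OF K B G openin_iter_dom[OF K B \<Omega>] this] show ?case
      using Suc.prems by simp
  qed
qed

text \<open>The tower element \<open>q\<close> over \<open>X\<close> is the parameter, and
  \<open>z\<close> is the variable of differentiation. As directions are sliced at 0, the induction
  runs over all maps \<open>a\<close> and uses the zero map for the direction part; the scalars
  stored in \<open>q\<close> do not depend on \<open>z\<close>.\<close>

lemma Ck_family_slice:
  assumes FK: "continuous_map F K (\<lambda>a. a)" and K: "topological_field K" and S: "topological_vector_space K S"
    and V: "V \<subseteq> carrier Z"
    and ev: "open_family F Z B (vtop X) n V (\<lambda>\<xi> z. ev z \<xi>)"
    and a: "open_family F Z S point n V (\<lambda>_. a)"
  shows "Ck_family F Z (tower_vs K (prod_tvs S B) j) (tower_top K X j) n 0 (Base ` V)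
    (\<lambda>q p. slice (a (base p)) (map_tower (ev (base p)) id q))"
  using a
proof (induction j arbitrary: a)
  case 0
  have "continuous_map (tower_top K X 0) point (\<lambda>_. ())" by simp
  from Ck_family_Base[OF open_family_pair[OF Ck_family_pullback[OF 0 this] Ck_family_pullback[OF ev continuous_map_base]]]
  have "Ck_family F Z (tower_vs K (prod_tvs S B) 0) (tower_top K X 0) n 0 (Base ` V)
      (\<lambda>q p. Base (a (base p), ev (base p) (base q)))" .
  then show ?case by (rule Ck_family_cong) auto
next
  case (Suc j)
  have FK': "topspace F \<subseteq> topspace K" using FK by (auto simp: continuous_map_def)
  have "continuous_map point (vtop S) (\<lambda>_. 0)" using tvsD(1)[OF S] by simp
  from open_family_constant[OF FK' S this V] have z: "open_family F Z S point n V (\<lambda>_ _. 0)" .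
  have c: "Ck_family F Z (scalar_vs K) (tower_top K X (Suc j)) n 0 (Base ` V) (\<lambda>q _. par q)"
    by (rule Ck_family_constant[where z = 0])
      (use V topological_fieldD(1)[OF K] in \<open>auto simp: continuous_map_par\<close>)
  from Ck_family_Step[OF Ck_family_pullback[OF Suc.IH[OF Suc.prems] continuous_map_pt]
      Ck_family_pullback[OF Suc.IH[OF z] continuous_map_dir] c]
  show ?case by (rule Ck_family_cong) (auto simp: topspace_tower_Suc)
qed

text \<open>Models evaluation at one point. The identity for \<open>u + t v\<close> is exactly what
  is needed to commute with the tower operations; continuity of evaluation is treated separately,
  through families.\<close>

locale linear_map_on =
  fixes K :: "'k::field topology" and X :: "('x::ab_group_add, 'k) tvs" and B :: "('b::ab_group_add, 'k) tvs"
    and l :: "'x \<Rightarrow> 'b"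
  assumes mem: "u \<in> carrier X \<Longrightarrow> l u \<in> carrier B"
    and move: "u \<in> carrier X \<Longrightarrow> v \<in> carrier X \<Longrightarrow> t \<in> topspace K \<Longrightarrow>
      l (u + scale X t v) = l u + scale B t (l v)"
begin

lemma map_tower_mem: "q \<in> topspace (tower_top K X j) \<Longrightarrow> map_tower l id q \<in> topspace (tower_top K B j)"
  by (induction j arbitrary: q) (auto simp: topspace_tower_Suc mem)

lemma map_tower_move:
  "x \<in> topspace (tower_top K X j) \<Longrightarrow> v \<in> topspace (tower_top K X j) \<Longrightarrow> t \<in> topspace K \<Longrightarrow>
   map_tower l id (tower_move X x t v) =
   tower_move B (map_tower l id x) t (map_tower l id v)"
  by (induction j arbitrary: x v) (auto simp: topspace_tower_Suc move)

lemma map_tower_iter_dom: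
  assumes "Q \<subseteq> carrier X" "l ` Q \<subseteq> \<Omega>"
  shows "q \<in> iter_dom K X Q j \<Longrightarrow> map_tower l id q \<in> iter_dom K B \<Omega> j"
proof (induction j arbitrary: q)
  case (Suc j)
  then obtain x v t where q: "q = Step x v t" "x \<in> iter_dom K X Q j" "v \<in> topspace (tower_top K X j)"
    "t \<in> topspace K" "tower_move X x t v \<in> iter_dom K X Q j"
    by (auto elim: ext_domE)
  have "x \<in> topspace (tower_top K X j)" using q(2) iter_dom_subset[OF assms(1)] by blast
  then show ?case
    using Suc.IH[OF q(2)] Suc.IH[OF q(5)] q map_tower_mem[OF q(3)] map_tower_move[of x j v t]
    by (simp add: Step_in_ext_dom id_def)
qed (use assms in auto)

end

text \<open>In the application \<open>X\<close> is the product of the function space with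
  \<open>H\<close>, \<open>B\<close> is \<open>E \<times> H\<close>, \<open>ev x\<close> evaluates
  at \<open>x\<close>, and \<open>S\<close> is the model space of the manifold in which
  \<open>\<sigma>\<close> takes its values. The hypothesis \<open>loc\<close> says that near each
  point the dependence on \<open>x\<close> factors through a coordinate \<open>a x\<close> in
  \<open>S\<close>, followed by one map \<open>f'\<close> of order \<open>r + k\<close>.\<close>

lemma superposition_Ck:
  fixes F K :: "'k::field topology" and Z :: "('z::ab_group_add, 'k) tvs"
  assumes ext: "topological_field_extension F K"
    and Z: "topological_vector_space F Z" and M: "manifold F r Z M"
    and X: "topological_vector_space K X" and B: "topological_vector_space K B"
    and S: "topological_vector_space K S" and G: "topological_vector_space K G"
    and Q: "openin (vtop X) Q" and \<Omega>: "openin (vtop B) \<Omega>"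
    and lin: "\<And>x. x \<in> topspace (mtop M) \<Longrightarrow> linear_map_on K X B (ev x)"
    and evQ: "\<And>x. x \<in> topspace (mtop M) \<Longrightarrow> ev x ` Q \<subseteq> \<Omega>"
    and ev: "\<And>U \<kappa> n. (U, \<kappa>) \<in> charts F r M \<Longrightarrow> enat n \<le> r \<Longrightarrow>
      open_family F Z B (vtop X) n (\<kappa> ` U) (\<lambda>\<xi> z. ev (inv_into U \<kappa> z) \<xi>)"
    and loc: "\<And>x. x \<in> topspace (mtop M) \<Longrightarrow> \<exists>N W a f'. openin (mtop M) N \<and> x \<in> N \<and>
      openin (vtop S) W \<and> a ` N \<subseteq> W \<and> Ck K (prod_tvs S B) G (W \<times> \<Omega>) (r + k) f' \<and>
      (\<forall>x'\<in>N. \<forall>e\<in>\<Omega>. f x' e = f' (a x', e)) \<and>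
      (\<forall>(U, \<kappa>)\<in>charts F r M. \<forall>n. enat n \<le> r \<longrightarrow>
         open_family F Z S point n (\<kappa> ` (U \<inter> N)) (\<lambda>_ z. a (inv_into U \<kappa> z)))"
  shows "Ck K X (Cr_space F r M G) Q k (\<lambda>\<xi> x. if x \<in> topspace (mtop M) then f x (ev x \<xi>) else 0)"
proof -
  have F: "topological_field F" and K: "topological_field K" and FK: "continuous_map F K (\<lambda>a. a)"
    using ext by (auto simp: topological_field_extension_def)
  note GF = tvs_restrict_scalars[OF ext G]
  note C = tvs_Cr_space[OF ext Z G M] and SB = tvs_prod[OF S B]
  note S' = tvsD[OF S] and G' = tvsD[OF G]
  have mZ: "model M = Z" using M by (simp add: manifold_def)
  have QX: "Q \<subseteq> carrier X" and \<Omega>B: "\<Omega> \<subseteq> carrier B" using Q \<Omega> by (auto dest: openin_subset)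
  have S0: "\<forall>t\<in>topspace K. scale S t 0 = 0" using S'(9) by blast
  \<comment> \<open>Bundles the local data so that one neighbourhood \<open>N x\<close> can be
    chosen for each point; the other witnesses are recovered when needed.\<close>
  define R where "R = (\<lambda>x N. openin (mtop M) N \<and> x \<in> N \<and> (\<exists>W a f'.
      openin (vtop S) W \<and> a ` N \<subseteq> W \<and> Ck K (prod_tvs S B) G (W \<times> \<Omega>) (r + k) f' \<and>
      (\<forall>x'\<in>N. \<forall>e\<in>\<Omega>. f x' e = f' (a x', e)) \<and>
      (\<forall>(U, \<kappa>)\<in>charts F r M. \<forall>n. enat n \<le> r \<longrightarrow>
         open_family F Z S point n (\<kappa> ` (U \<inter> N)) (\<lambda>_ z. a (inv_into U \<kappa> z)))))"
  have "\<exists>N. R x N" if "x \<in> topspace (mtop M)" for x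
    using loc[OF that] unfolding R_def by blast
  then obtain N where R: "R x (N x)" if "x \<in> topspace (mtop M)" for x
    by metis
  have N: "openin (mtop M) (N x)" "x \<in> N x" if "x \<in> topspace (mtop M)" for x
    using R[OF that] by (auto simp: R_def)
  have fx: "Ck_nat K B G \<Omega> n (f x)" if x: "x \<in> topspace (mtop M)" and n: "enat n \<le> k" for x n
  proof -
    obtain W a f' where N: "x \<in> N x" "openin (vtop S) W" "a ` N x \<subseteq> W"
      "Ck K (prod_tvs S B) G (W \<times> \<Omega>) (r + k) f'" "\<forall>x'\<in>N x. \<forall>e\<in>\<Omega>. f x' e = f' (a x', e)"
      using R[OF x] unfolding R_def by blast
    have "enat n \<le> r + k" using n by (simp add: add_increasing)
    then have "Ck_nat K (prod_tvs S B) G (W \<times> \<Omega>) n f'" using N(4) by (simp add: Ck_def)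
    from iter_ext_slice(1)[OF K S B G N(2) \<Omega> _ this, of "a x"] N(1,3)
    have "Ck_nat K B G \<Omega> n (\<lambda>e. f' (a x, e))" by auto
    then have "open_family K B G point n \<Omega> (\<lambda>_ e. f' (a x, e))"
      by (simp add: Ck_nat_iff_family[OF K B G \<Omega>])
    then have "open_family K B G point n \<Omega> (\<lambda>_. f x)"
      by (rule open_family_cong) (use N(1,5) in auto)
    then show ?thesis using Ck_nat_iff_family[OF K B G \<Omega>] by blast
  qed
  \<comment> \<open>Only the argument tower is evaluated; the quotients are those of
    \<open>f x\<close> on \<open>\<Omega>\<close> for each \<open>x\<close> separately. The value 0
    off \<open>M\<close> is the convention for total functions.\<close>
  define D where "D = (\<lambda>m q x. if x \<in> topspace (mtop M)
    then iter_ext K B G \<Omega> (f x) m (map_tower (ev x) id q) else 0)"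
  have cont: "continuous_map (tower_on K X m (iter_dom K X Q m)) (vtop (Cr_space F r M G)) (D m)"
    if m: "enat m \<le> k" for m
    unfolding continuous_map_into_Cr_space[OF F Z GF M]
  proof (intro conjI ballI allI impI)
    let ?Y = "tower_on K X m (iter_dom K X Q m)"
    have tY: "topspace ?Y = iter_dom K X Q m" using iter_dom_subset[OF QX] by auto
    fix c assume c: "c \<in> charts F r M"
    obtain U \<kappa> where cU: "c = (U, \<kappa>)" by (cases c)
    note cU' = c[unfolded cU]
    note ch = is_chartD[OF chartsD[OF cU'], unfolded mZ]
    have UM: "U \<subseteq> topspace (mtop M)" using ch(1) by (rule openin_subset)
    have "open_family F Z G ?Y n (\<kappa> ` U) (\<lambda>q z. D m q (inv_into U \<kappa> z))" if n: "enat n \<le> r" for n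
    proof -
      \<comment> \<open>The chart domain is covered by pieces on each of which a single
        \<open>f'\<close> describes \<open>f\<close>; the results are glued over this cover.\<close>
      let ?\<V> = "(\<lambda>x. Base ` \<kappa> ` (U \<inter> N x) :: ('z, 'k) tower set) ` U"
      have "Ck_family F Z (plain G) ?Y n 0 (\<Union>?\<V>) (\<lambda>q p. D m q (inv_into U \<kappa> (base p)))"
      proof (rule Ck_family_local[OF ext Z G])
        fix V assume "V \<in> ?\<V>"
        then obtain x where x: "x \<in> U" and V: "V = Base ` \<kappa> ` (U \<inter> N x)" by auto
        have xM: "x \<in> topspace (mtop M)" using x UM by auto
        have o: "openin (vtop Z) (\<kappa> ` (U \<inter> N x))" using ch(6) N[OF xM] by blast
        then show "openin (tower_top F Z 0) V"
          using openin_iter_dom[OF F Z o, of 0] by (simp add: V)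
        obtain W a f' where *: "openin (vtop S) W" "a ` N x \<subseteq> W" "Ck K (prod_tvs S B) G (W \<times> \<Omega>) (r + k) f'"
          and eq: "\<forall>x'\<in>N x. \<forall>e\<in>\<Omega>. f x' e = f' (a x', e)"
          and a: "open_family F Z S point n (\<kappa> ` (U \<inter> N x)) (\<lambda>_ z. a (inv_into U \<kappa> z))"
          using R[OF xM] cU' n unfolding R_def by blast
        have oW: "openin (vtop (prod_tvs S B)) (W \<times> \<Omega>)" using *(1) \<Omega> by (simp add: openin_prod_Times_iff)
        \<comment> \<open>\<open>f'\<close> has \<open>m + n\<close> quotients: \<open>m\<close> are
          used up in forming \<open>f'^[m]\<close>, which leaves order \<open>n\<close> for the
          composition below.\<close>
        have "enat (m + n) \<le> r + k" using add_mono[OF n m] by (simp add: add.commute)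
        then have f': "Ck_nat K (prod_tvs S B) G (W \<times> \<Omega>) (m + n) f'" using *(3) by (simp add: Ck_def)
        have 1: "Ck_family K (prod_tvs S B) (plain G) point n m (iter_dom K (prod_tvs S B) (W \<times> \<Omega>) m)
            (\<lambda>_. iter_ext K (prod_tvs S B) G (W \<times> \<Omega>) f' m)"
          using Ck_family_iter_ext[OF K SB G oW f'[unfolded Ck_nat_iff_family[OF K SB G oW]], of m] by simp
        have e: "open_family F Z B (vtop X) n (\<kappa> ` (U \<inter> N x)) (\<lambda>\<xi> z. ev (inv_into U \<kappa> z) \<xi>)"
          by (rule Ck_family_mono[OF ev[OF cU' n]]) auto
        have id: "continuous_map ?Y (tower_top K X m) (\<lambda>q. q)"
          by (rule continuous_map_from_subtopology[OF continuous_map_ident])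
        have 2: "Ck_family F Z (tower_vs K (prod_tvs S B) m) ?Y n 0 V
            (\<lambda>q p. slice (a (inv_into U \<kappa> (base p))) (map_tower (ev (inv_into U \<kappa> (base p))) id q))"
          unfolding V
          by (rule Ck_family_pullback[OF Ck_family_slice[OF FK K S openin_subset[OF o] e a] id])
        have pt: "inv_into U \<kappa> (base p) \<in> U \<inter> N x" "inv_into U \<kappa> (base p) \<in> topspace (mtop M)" if "p \<in> V" for p
          using that ch(3) UM by (auto simp: V)
        have md: "map_tower (ev y) id q \<in> iter_dom K B \<Omega> m" if "y \<in> topspace (mtop M)" "q \<in> iter_dom K X Q m" for y q
          by (rule linear_map_on.map_tower_iter_dom[OF lin[OF that(1)] QX evQ[OF that(1)] that(2)])
        have aW: "a (inv_into U \<kappa> (base p)) \<in> W" if "p \<in> V" for p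
          using pt(1)[OF that] *(2) by blast
        \<comment> \<open>The outer map \<open>f'^[m]\<close> is free of parameter and point; both
          occur only in the inner family, as the chain rule requires.\<close>
        have "Ck_family F Z (plain G) ?Y n 0 V (\<lambda>q p. iter_ext K (prod_tvs S B) G (W \<times> \<Omega>) f' m
            (slice (a (inv_into U \<kappa> (base p))) (map_tower (ev (inv_into U \<kappa> (base p))) id q)))"
        proof (rule Ck_family_outer[OF FK 1 2])
          fix q p assume "q \<in> topspace ?Y" and p: "p \<in> V"
          then have q: "q \<in> iter_dom K X Q m" by (simp add: tY)
          show "slice (a (inv_into U \<kappa> (base p))) (map_tower (ev (inv_into U \<kappa> (base p))) id q)
              \<in> iter_dom K (prod_tvs S B) (W \<times> \<Omega>) m"
            by (rule slice_iter_dom[OF S'(1) S0 \<Omega>B aW[OF p] md[OF pt(2)[OF p] q]])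
        qed
        then show "Ck_family F Z (plain G) ?Y n 0 V (\<lambda>q p. D m q (inv_into U \<kappa> (base p)))"
        proof (rule Ck_family_cong)
          fix q p assume "q \<in> topspace ?Y" and p: "p \<in> V"
          then have q: "q \<in> iter_dom K X Q m" by (simp add: tY)
          \<comment> \<open>\<open>f x\<close> and \<open>f'(a x, .)\<close> are known to agree on
            \<open>\<Omega>\<close> only, but the quotients formed over \<open>\<Omega>\<close> read
            no other values.\<close>
          have "iter_ext K B G \<Omega> (f (inv_into U \<kappa> (base p))) m =
              iter_ext K B G \<Omega> (\<lambda>e. f' (a (inv_into U \<kappa> (base p)), e)) m"
            by (rule iter_ext_cong) (use eq pt(1)[OF p] in auto)
          then show "iter_ext K (prod_tvs S B) G (W \<times> \<Omega>) f' m
              (slice (a (inv_into U \<kappa> (base p))) (map_tower (ev (inv_into U \<kappa> (base p))) id q)) =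
            D m q (inv_into U \<kappa> (base p))"
            using iter_ext_slice(2)[OF K S B G *(1) \<Omega> aW[OF p] f' _ md[OF pt(2)[OF p] q]]
              pt[OF p] by (simp add: D_def)
        qed
      qed
      moreover have "\<Union>?\<V> = Base ` \<kappa> ` U" using N UM by blast
      ultimately show ?thesis by simp
    qed
    then show "case c of (U, \<kappa>) \<Rightarrow> \<forall>n. enat n \<le> r \<longrightarrow>
        open_family F Z G ?Y n (\<kappa> ` U) (\<lambda>q z. D m q (inv_into U \<kappa> z))" by (simp add: cU)
  qed (simp add: D_def)
  have quot: "difference_quotient K X (plain (Cr_space F r M G)) point m (iter_dom K X Q m) (\<lambda>_. D m) (\<lambda>_. D (Suc m))"
    if m: "enat (Suc m) \<le> k" for m
    unfolding difference_quotient_def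
  proof (intro ballI allI impI)
    fix q q' t assume s: "Step q q' t \<in> ext_dom K X m (iter_dom K X Q m)"
    then have q: "q \<in> iter_dom K X Q m" "q' \<in> topspace (tower_top K X m)" "t \<in> topspace K"
      by (auto simp: Step_in_ext_dom)
    have q1: "q \<in> topspace (tower_top K X m)" using q(1) iter_dom_subset[OF QX] by blast
    \<comment> \<open>Operations in the function space are pointwise, so the quotient equation may
      be checked at each \<open>x\<close>, where it is the one of \<open>f x\<close>; linearity of
      \<open>ev x\<close> carries the increment through the evaluation.\<close>
    have "D m (tower_move X q t q') x = D m q x + scale G t (D (Suc m) (Step q q' t) x)" for x
    proof (cases "x \<in> topspace (mtop M)")
      case True
      let ?f = "iter_ext K B G \<Omega> (f x)" and ?l = "map_tower (ev x) id"
      note N = Ck_nat_iter_ext[OF K B G \<Omega> fx[OF True m]]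
      have "?l (Step q q' t) \<in> iter_dom K B \<Omega> (Suc m)"
        by (rule linear_map_on.map_tower_iter_dom[OF lin[OF True] QX evQ[OF True]]) (use s in simp)
      then have "Step (?l q) (?l q') t \<in> ext_dom K B m (iter_dom K B \<Omega> m)" by simp
      moreover have "is_quotient_ext K B G m (iter_dom K B \<Omega> m) (?f m) (?f (Suc m))"
        using N(1)[of m] by simp
      moreover have "continuous_map (tower_on K B m (iter_dom K B \<Omega> m)) (vtop G) (?f m)"
        using N(3)[of m] by simp
      moreover have "continuous_map (tower_on K B (Suc m) (ext_dom K B m (iter_dom K B \<Omega> m))) (vtop G) (?f (Suc m))"
        using N(3)[of "Suc m"] by simp
      ultimately have "?f m (tower_move B (?l q) t (?l q')) =
          ?f m (?l q) + scale G t (?f (Suc m) (Step (?l q) (?l q') t))"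
        using is_quotient_ext_iff[OF K G iter_dom_subset[OF \<Omega>B, of K m], of "?f m" "?f (Suc m)"]
          tower_add_zero_ext_dom[OF K B iter_dom_subset[OF \<Omega>B, of K m]] by blast
      then show ?thesis
        using linear_map_on.map_tower_move[OF lin[OF True] q1 q(2,3)] True
        by (simp add: D_def del: iter_ext.simps)
    qed (simp add: D_def G' q(3))
    then show "D m (tower_move X q t q') =
        vs_plus (plain (Cr_space F r M G)) (D m q) (vs_smult (plain (Cr_space F r M G)) t (D (Suc m) (Step q q' t)))"
      by (simp add: fun_eq_iff)
  qed
  show ?thesis
    unfolding Ck_iff_family[OF K X C Q]
  proof (intro allI impI)
    fix n assume n: "enat n \<le> k"
    have le: "enat m \<le> k" if "m \<le> n" for m
      using n that by (meson enat_ord_simps(1) order_trans)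
    have "Ck_family K X (plain (Cr_space F r M G)) point n 0 (iter_dom K X Q 0) (\<lambda>_. D 0)"
    proof (rule Ck_family_of_sequence[where U = "iter_dom K X Q" and G = "\<lambda>m _. D m"])
      fix m
      show "continuous_family point (tower_on K X (0 + m) (iter_dom K X Q m))
          (vs_top (plain (Cr_space F r M G))) (\<lambda>_. D m)" if "m \<le> n"
        using cont[OF le[OF that]] by (simp add: continuous_map_point_family)
      show "difference_quotient K X (plain (Cr_space F r M G)) point (0 + m) (iter_dom K X Q m) (\<lambda>_. D m) (\<lambda>_. D (Suc m))"
        if "m < n" using quot[OF le[of "Suc m"]] that by simp
    qed (use iter_dom_subset[OF QX, of K 0] in auto)
    then show "open_family K X (Cr_space F r M G) point n Q (\<lambda>_ \<xi> x. if x \<in> topspace (mtop M) then f x (ev x \<xi>) else 0)"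
      unfolding iter_dom.simps
      \<comment> \<open>\<open>D 0\<close> contains a case distinction on membership in
        \<open>\<Omega>\<close>, which \<open>evQ\<close> decides for arguments from
        \<open>Q\<close>.\<close>
      by (rule Ck_family_cong) (use evQ in \<open>fastforce simp: D_def fun_eq_iff\<close>)
  qed
qed

section \<open>Products of manifolds\<close>

lemma prod_mfd_simps [simp]:
  "mtop (prod_mfd M N) = prod_topology (mtop M) (mtop N)"
  "model (prod_mfd M N) = prod_tvs (model M) (model N)"
  by (simp_all add: prod_mfd_def)

lemma inv_into_map_prod:
  assumes "inj_on f A" "inj_on g B" "a \<in> f ` A" "b \<in> g ` B"
  shows "inv_into (A \<times> B) (map_prod f g) (a, b) = (inv_into A f a, inv_into B g b)"
  by (rule inv_into_f_eq) (use assms in \<open>auto simp: map_prod_inj_on inv_into_into f_inv_into_f\<close>)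

lemma map_prod_image_Times: "map_prod f g ` (A \<times> B) = (f ` A) \<times> (g ` B)"
  by auto

text \<open>Each component is a linear projection followed by one of the given maps, so the chain
  rule and pairing apply.\<close>

lemma Ck_map_prod:
  assumes K: "topological_field K"
    and Z1: "topological_vector_space K Z1" and Z2: "topological_vector_space K Z2"
    and G1: "topological_vector_space K G1" and G2: "topological_vector_space K G2"
    and A: "openin (vtop Z1) A" and B: "openin (vtop Z2) B"
    and f: "Ck K Z1 G1 A s f" and g: "Ck K Z2 G2 B s g"
  shows "Ck K (prod_tvs Z1 Z2) (prod_tvs G1 G2) (A \<times> B) s (map_prod f g)"
proof -
  note Z = tvs_prod[OF Z1 Z2] and G = tvs_prod[OF G1 G2]
  have o: "openin (vtop (prod_tvs Z1 Z2)) (A \<times> B)" using A B by (simp add: openin_prod_Times_iff)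
  have sub: "Base ` (A \<times> B) \<subseteq> topspace (tower_top K (prod_tvs Z1 Z2) 0)"
    using openin_subset[OF o] by auto
  have KK: "continuous_map K K (\<lambda>a. a)" by (rule continuous_map_ident)
  have "open_family K (prod_tvs Z1 Z2) (prod_tvs G1 G2) point n (A \<times> B) (\<lambda>_ z. (f (fst z), g (snd z)))"
    if n: "enat n \<le> s" for n
  proof (rule open_family_pair)
    have 1: "open_family K (prod_tvs Z1 Z2) Z1 point n (A \<times> B) (\<lambda>_. fst)"
      by (rule Ck_family_linear[OF _ sub])
        (use continuous_map_compose[OF continuous_map_base[of K "prod_tvs Z1 Z2", simplified] continuous_map_fst] in \<open>auto simp: o_def\<close>)
    have 2: "open_family K (prod_tvs Z1 Z2) Z2 point n (A \<times> B) (\<lambda>_. snd)"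
      by (rule Ck_family_linear[OF _ sub])
        (use continuous_map_compose[OF continuous_map_base[of K "prod_tvs Z1 Z2", simplified] continuous_map_snd] in \<open>auto simp: o_def\<close>)
    have f': "open_family K Z1 G1 point n A (\<lambda>_. f)" and g': "open_family K Z2 G2 point n B (\<lambda>_. g)"
      using f g n unfolding Ck_iff_family[OF K Z1 G1 A] Ck_iff_family[OF K Z2 G2 B] by auto
    show "open_family K (prod_tvs Z1 Z2) G1 point n (A \<times> B) (\<lambda>_ z. f (fst z))"
      by (rule open_family_outer[OF KK f' 1]) auto
    show "open_family K (prod_tvs Z1 Z2) G2 point n (A \<times> B) (\<lambda>_ z. g (snd z))"
      by (rule open_family_outer[OF KK g' 2]) auto
  qed
  then show ?thesis
    unfolding Ck_iff_family[OF K Z G o] by (simp add: map_prod_def case_prod_unfold)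
qed

lemma is_chart_prod:
  assumes "is_chart M (U, \<kappa>)" "is_chart N (V, \<eta>)"
  shows "is_chart (prod_mfd M N) (U \<times> V, map_prod \<kappa> \<eta>)"
proof -
  from assms obtain g h
    where "homeomorphic_maps (subtopology (mtop M) U) (subtopology (vtop (model M)) (\<kappa> ` U)) \<kappa> g"
      "homeomorphic_maps (subtopology (mtop N) V) (subtopology (vtop (model N)) (\<eta> ` V)) \<eta> h"
    by (auto simp: is_chart_def homeomorphic_map_maps)
  then have "homeomorphic_maps (prod_topology (subtopology (mtop M) U) (subtopology (mtop N) V))
      (prod_topology (subtopology (vtop (model M)) (\<kappa> ` U)) (subtopology (vtop (model N)) (\<eta> ` V)))
      (\<lambda>(x, y). (\<kappa> x, \<eta> y)) (\<lambda>(x, y). (g x, h y))"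
    by (simp add: homeomorphic_maps_prod)
  then have "homeomorphic_map (subtopology (prod_topology (mtop M) (mtop N)) (U \<times> V))
      (subtopology (prod_topology (vtop (model M)) (vtop (model N))) (\<kappa> ` U \<times> \<eta> ` V)) (map_prod \<kappa> \<eta>)"
    unfolding subtopology_Times map_prod_def by (rule homeomorphic_maps_imp_map)
  then show ?thesis
    using assms by (simp add: is_chart_def map_prod_image_Times openin_prod_Times_iff)
qed

text \<open>Inverting a product chart inverts its factors, and the overlap is a product as well; the
  transition map is therefore a product of transition maps.\<close>

lemma Ck_transition_prod:
  assumes K: "topological_field K"
    and Z1: "topological_vector_space K (model M)" and Z2: "topological_vector_space K (model N)"
    and c: "is_chart M (U, \<kappa>)" "is_chart M (U', \<kappa>')" "is_chart N (V, \<eta>)" "is_chart N (V', \<eta>')"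
    and "Ck K (model M) (model M) (\<kappa> ` (U \<inter> U')) s (\<kappa>' \<circ> inv_into U \<kappa>)"
    and "Ck K (model N) (model N) (\<eta> ` (V \<inter> V')) s (\<eta>' \<circ> inv_into V \<eta>)"
  shows "Ck K (prod_tvs (model M) (model N)) (prod_tvs (model M) (model N))
    (map_prod \<kappa> \<eta> ` ((U \<times> V) \<inter> (U' \<times> V'))) s (map_prod \<kappa>' \<eta>' \<circ> inv_into (U \<times> V) (map_prod \<kappa> \<eta>))"
proof -
  have im: "map_prod \<kappa> \<eta> ` ((U \<times> V) \<inter> (U' \<times> V')) = \<kappa> ` (U \<inter> U') \<times> \<eta> ` (V \<inter> V')"
    by (simp only: Times_Int_Times map_prod_image_Times)
  note o1 = is_chartD(6)[OF c(1) is_chartD(1)[OF c(2)]] and o2 = is_chartD(6)[OF c(3) is_chartD(1)[OF c(4)]]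
  note Z = tvs_prod[OF Z1 Z2]
  show ?thesis
    unfolding im
  proof (rule Ck_cong[OF K Z Z _ Ck_map_prod[OF K Z1 Z2 Z1 Z2 o1 o2 assms(8,9)]])
    show "openin (vtop (prod_tvs (model M) (model N))) (\<kappa> ` (U \<inter> U') \<times> \<eta> ` (V \<inter> V'))"
      using o1 o2 by (simp add: openin_prod_Times_iff)
    fix z assume "z \<in> \<kappa> ` (U \<inter> U') \<times> \<eta> ` (V \<inter> V')"
    then obtain a b where "z = (a, b)" "a \<in> \<kappa> ` U" "b \<in> \<eta> ` V" by auto
    then show "map_prod (\<kappa>' \<circ> inv_into U \<kappa>) (\<eta>' \<circ> inv_into V \<eta>) z =
        (map_prod \<kappa>' \<eta>' \<circ> inv_into (U \<times> V) (map_prod \<kappa> \<eta>)) z"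
      using inv_into_map_prod[OF is_chartD(3)[OF c(1)] is_chartD(3)[OF c(3)]] by simp
  qed
qed

text \<open>The atlas of the product consists of product charts, so compatibility reduces to that of
  the factors. These charts are the ones in which a map defined on a product manifold is read
  below.\<close>

lemma charts_prod_mfd:
  assumes K: "topological_field K"
    and Z1: "topological_vector_space K (model M)" and Z2: "topological_vector_space K (model N)"
    and M: "\<And>c. c \<in> atlas M \<Longrightarrow> is_chart M c" and N: "\<And>c. c \<in> atlas N \<Longrightarrow> is_chart N c"
    and c: "(U, \<kappa>) \<in> charts K s M" and d: "(V, \<eta>) \<in> charts K s N"
  shows "(U \<times> V, map_prod \<kappa> \<eta>) \<in> charts K s (prod_mfd M N)"
proof -
  have "compatible K s (prod_tvs (model M) (model N)) (U \<times> V, map_prod \<kappa> \<eta>) (U' \<times> V', map_prod \<kappa>' \<eta>')"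
    if a: "(U', \<kappa>') \<in> atlas M" and b: "(V', \<eta>') \<in> atlas N" for U' \<kappa>' V' \<eta>'
  proof -
    have 1: "Ck K (model M) (model M) (\<kappa> ` (U \<inter> U')) s (\<kappa>' \<circ> inv_into U \<kappa>)"
      "Ck K (model M) (model M) (\<kappa>' ` (U' \<inter> U)) s (\<kappa> \<circ> inv_into U' \<kappa>')"
      using c a by (auto simp: charts_def compatible_def Int_commute)
    have 2: "Ck K (model N) (model N) (\<eta> ` (V \<inter> V')) s (\<eta>' \<circ> inv_into V \<eta>)"
      "Ck K (model N) (model N) (\<eta>' ` (V' \<inter> V)) s (\<eta> \<circ> inv_into V' \<eta>')"
      using d b by (auto simp: charts_def compatible_def Int_commute)
    note ch = chartsD[OF c] M[OF a] chartsD[OF d] N[OF b]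
    show ?thesis
      using Ck_transition_prod[OF K Z1 Z2 ch 1(1) 2(1)]
        Ck_transition_prod[OF K Z1 Z2 ch(2,1,4,3) 1(2) 2(2)]
      by (simp add: compatible_def Int_commute)
  qed
  then show ?thesis
    using is_chart_prod[OF chartsD[OF c] chartsD[OF d]] by (auto simp: charts_def prod_mfd_def)
qed

section \<open>Specialisation to evaluation of differentiable maps on the manifold\<close>

theorem proposition4p16:
  fixes \<F> \<K> :: "'k::field topology"
    and E :: "('e::ab_group_add, 'k) tvs"
    and F :: "('f::ab_group_add, 'k) tvs"
    and H :: "('h::ab_group_add, 'k) tvs"
    and Zt :: "('zt::ab_group_add, 'k) tvs"
    and Z :: "('z::ab_group_add, 'k) tvs"
    and P :: "'h set"
    and r k :: enat
    and Mt :: "('mt, 'zt, 'k) mfd"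
    and M :: "('m, 'z, 'k) mfd"
    and ft :: "'mt \<times> 'e \<times> 'h \<Rightarrow> 'f"
    and \<sigma> :: "'m \<Rightarrow> 'mt"
  assumes "topological_field_extension \<F> \<K>"
    and "topological_vector_space \<K> E"
    and "topological_vector_space \<K> F"
    and "topological_vector_space \<K> H"
    and "topological_vector_space \<K> Zt"
    and "openin (vtop H) P"
    and "manifold \<K> (r + k) Zt Mt"
    and "Ck_mfd \<K> (r + k) (prod_mfd Mt (prod_mfd (tvs_mfd E) (open_mfd H P))) (tvs_mfd F) ft"
    and "topological_vector_space \<F> Z"
    and "manifold \<F> r Z M"
    and "Ck_mfd \<F> r M Mt \<sigma>"
  shows "let f = ft \<circ> map_prod \<sigma> (map_prod id id);
             \<phi> = (\<lambda>(\<gamma>, p) x. if x \<in> topspace (mtop M) then f (x, \<gamma> x, p) else 0)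
         in Ck \<K> (prod_tvs (Cr_space \<F> r M E) H) (Cr_space \<F> r M F)
              (carrier (Cr_space \<F> r M E) \<times> P) k \<phi>"
proof -
  have Ff: "topological_field \<F>" and K: "topological_field \<K>" and FK: "topspace \<F> \<subseteq> topspace \<K>"
    using assms(1) by (auto simp: topological_field_extension_def)
  note ext = assms(1) and E = assms(2) and F = assms(3) and H = assms(4) and Zt = assms(5) and P = assms(6)
    and Mt = assms(7) and ft = assms(8) and Z = assms(9) and M = assms(10) and \<sigma> = assms(11)
  note EF = tvs_restrict_scalars[OF ext E]
    and ZtF = tvs_restrict_scalars[OF ext Zt]
  note EH = tvs_prod[OF E H]
  let ?C = "Cr_space \<F> r M E" and ?N = "prod_mfd (tvs_mfd E) (open_mfd H P)"
  let ?\<Omega> = "carrier E \<times> P"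
  have mZ: "model M = Z" and mZt: "model Mt = Zt" using M Mt by (auto simp: manifold_def)
  have r: "r \<le> r + k" by (simp add: add_increasing2)
  have P': "P \<subseteq> carrier H" using P by (rule openin_subset)
  have \<Omega>: "openin (vtop (prod_tvs E H)) ?\<Omega>" using P by (simp add: openin_prod_Times_iff)
  \<comment> \<open>The identity is a chart on \<open>E \<times> P\<close>, so that only the
    coordinate in \<open>Mt\<close> has to be changed.\<close>
  have N: "(?\<Omega>, map_prod (\<lambda>x. x) (\<lambda>x. x)) \<in> charts \<K> (r + k) ?N"
    using E H P by (intro charts_prod_mfd K id_chart_open_mfd) (auto intro: is_chart_open_mfd)
  have aN: "is_chart ?N c" if "c \<in> atlas ?N" for c
    using that is_chart_prod[OF is_chart_open_mfd is_chart_open_mfd[OF P], of E "carrier E"]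
    by (auto simp: prod_mfd_def[of "tvs_mfd E"])
  have aMt: "is_chart Mt c" if "c \<in> atlas Mt" for c
    using Mt that by (auto simp: manifold_def)
  \<comment> \<open>Reading \<open>ft\<close> in a chart of \<open>Mt\<close>, with \<open>e\<close>
    and \<open>p\<close> untouched, gives the map of order \<open>r + k\<close> on an open subset of
    a vector space that \<open>superposition_Ck\<close> calls \<open>f'\<close>.\<close>
  have ftc: "Ck \<K> (prod_tvs Zt (prod_tvs E H)) F (\<kappa> ` U \<times> ?\<Omega>) (r + k) (\<lambda>z. ft (inv_into U \<kappa> (fst z), snd z))"
    if c: "(U, \<kappa>) \<in> atlas Mt" for U \<kappa>
  proof -
    have c': "(U, \<kappa>) \<in> charts \<K> (r + k) Mt" using c atlas_subset_charts[OF Mt] by auto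
    note ch = is_chartD[OF chartsD[OF c'], unfolded mZt]
    let ?\<kappa> = "map_prod \<kappa> (map_prod (\<lambda>x :: 'e. x) (\<lambda>x :: 'h. x))"
    have "(U \<times> ?\<Omega>, ?\<kappa>) \<in> charts \<K> (r + k) (prod_mfd Mt ?N)"
      by (rule charts_prod_mfd[OF K _ _ aMt aN c' N]) (use Zt EH mZt in auto)
    moreover have "(carrier F, \<lambda>x. x) \<in> charts \<K> (r + k) (tvs_mfd F)"
      by (rule id_chart_open_mfd[OF K F]) simp
    ultimately have "Ck \<K> (prod_tvs Zt (prod_tvs E H)) F (?\<kappa> ` ((U \<times> ?\<Omega>) \<inter> ft -` carrier F)) (r + k)
        ((\<lambda>x. x) \<circ> ft \<circ> inv_into (U \<times> ?\<Omega>) ?\<kappa>)"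
      using ft unfolding Ck_mfd_def by (fastforce simp: mZt)
    \<comment> \<open>\<open>Ck_mfd\<close> restricts to the preimage of the target chart; since
      \<open>ft\<close> takes values in the carrier of \<open>F\<close> there, this preimage
      contains the whole chart domain.\<close>
    moreover have "ft z \<in> carrier F" if z: "z \<in> U \<times> ?\<Omega>" for z
    proof -
      have "z \<in> topspace (mtop (prod_mfd Mt ?N))"
        using z P' openin_subset[OF ch(1)] by (auto simp: subset_iff)
      moreover have "continuous_map (mtop (prod_mfd Mt ?N)) (mtop (tvs_mfd F)) ft"
        using ft by (simp add: Ck_mfd_def)
      ultimately show ?thesis
        using continuous_map_funspace by fastforce
    qed
    then have "(U \<times> ?\<Omega>) \<inter> ft -` carrier F = U \<times> ?\<Omega>" by blast
    moreover have "?\<kappa> ` (U \<times> ?\<Omega>) = \<kappa> ` U \<times> ?\<Omega>" by (simp add: map_prod_image_Times)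
    ultimately have "Ck \<K> (prod_tvs Zt (prod_tvs E H)) F (\<kappa> ` U \<times> ?\<Omega>) (r + k) ((\<lambda>x. x) \<circ> ft \<circ> inv_into (U \<times> ?\<Omega>) ?\<kappa>)"
      by simp
    then show ?thesis
    proof (rule Ck_cong[OF K tvs_prod[OF Zt EH] F, rotated 1])
      show "openin (vtop (prod_tvs Zt (prod_tvs E H))) (\<kappa> ` U \<times> ?\<Omega>)"
        using ch(2) P by (simp add: openin_prod_Times_iff)
      fix z assume "z \<in> \<kappa> ` U \<times> ?\<Omega>"
      then obtain x e p where z: "z = (\<kappa> x, e, p)" "x \<in> U" "e \<in> carrier E" "p \<in> P" by auto
      have "inv_into (U \<times> ?\<Omega>) ?\<kappa> z = (x, e, p)"
        by (rule inv_into_f_eq) (use ch(3) z in \<open>auto simp: inj_on_def\<close>)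
      then show "((\<lambda>x. x) \<circ> ft \<circ> inv_into (U \<times> ?\<Omega>) ?\<kappa>) z = ft (inv_into U \<kappa> (fst z), snd z)"
        using ch(3) z by simp
    qed
  qed
  have "Ck \<K> (prod_tvs ?C H) (Cr_space \<F> r M F) (carrier ?C \<times> P) k
      (\<lambda>\<xi> x. if x \<in> topspace (mtop M) then ft (\<sigma> x, fst \<xi> x, snd \<xi>) else 0)"
  proof (rule superposition_Ck[OF ext Z M tvs_prod[OF tvs_Cr_space[OF ext Z E M] H]
        EH Zt F _ \<Omega>, where f = "\<lambda>x e. ft (\<sigma> x, e)" and ev = "\<lambda>x \<xi>. (fst \<xi> x, snd \<xi>)"])
    have ev: "\<gamma> x \<in> carrier E" if "\<gamma> \<in> carrier ?C" for \<gamma> x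
      using continuous_map_Cr_space_eval[OF Ff Z EF M, of x] that by (auto simp: continuous_map_def)
    show "openin (vtop (prod_tvs ?C H)) (carrier ?C \<times> P)" using P by (simp add: openin_prod_Times_iff)
    fix x assume x: "x \<in> topspace (mtop M)"
    show "linear_map_on \<K> (prod_tvs ?C H) (prod_tvs E H) (\<lambda>\<xi>. (fst \<xi> x, snd \<xi>))"
      by unfold_locales (auto simp: ev)
    show "(\<lambda>\<xi>. (fst \<xi> x, snd \<xi>)) ` (carrier ?C \<times> P) \<subseteq> ?\<Omega>" by (auto simp: ev)
    have "\<sigma> x \<in> topspace (mtop Mt)" using \<sigma> x by (auto simp: Ck_mfd_def continuous_map_def)
    then obtain W \<eta> where W: "(W, \<eta>) \<in> atlas Mt" "\<sigma> x \<in> W" by (rule manifold_chart_at[OF Mt])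
    note chW = is_chartD[OF aMt[OF W(1)], unfolded mZt]
    \<comment> \<open>The hypothesis on \<open>\<sigma>\<close> speaks about charts of
      \<open>Mt\<close> over \<open>\<F>\<close> of order \<open>r\<close>, whereas the atlas of
      \<open>Mt\<close> is compatible over \<open>\<K>\<close> to order \<open>r + k\<close>.
      Restricting scalars in the transition maps bridges the two.\<close>
    have WF: "(W, \<eta>) \<in> charts \<F> r Mt"
      unfolding charts_def
    proof (intro CollectI conjI ballI)
      fix d assume d: "d \<in> atlas Mt"
      obtain W' \<eta>' where dW: "d = (W', \<eta>')" by (cases d)
      have "compatible \<K> (r + k) Zt (W, \<eta>) (W', \<eta>')" using Mt W(1) d dW by (auto simp: manifold_def)
      moreover have "openin (vtop Zt) (\<eta> ` (W \<inter> W'))" "openin (vtop Zt) (\<eta>' ` (W \<inter> W'))"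
        using chW(6) is_chartD(1,6)[OF aMt[OF d[unfolded dW]], unfolded mZt] chW(1) by (auto simp: Int_commute[of W])
      ultimately show "compatible \<F> r (model Mt) (W, \<eta>) d"
        using Ck_restrict_scalars[OF ext Zt Zt _ _ r] by (simp add: compatible_def mZt dW)
    qed (rule aMt[OF W(1)])
    let ?N = "{x \<in> topspace (mtop M). \<sigma> x \<in> W}"
    have oN: "openin (mtop M) ?N"
      using \<sigma> chW(1) by (intro openin_continuous_map_preimage[of _ "mtop Mt"]) (auto simp: Ck_mfd_def)
    have fam: "open_family \<F> Z Zt point n (\<kappa> ` (U \<inter> ?N)) (\<lambda>_ z. \<eta> (\<sigma> (inv_into U \<kappa> z)))"
      if c: "(U, \<kappa>) \<in> charts \<F> r M" and n: "enat n \<le> r" for U \<kappa> n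
    proof -
      note ch = is_chartD[OF chartsD[OF c], unfolded mZ]
      have "U \<inter> ?N = U \<inter> \<sigma> -` W" using openin_subset[OF ch(1)] by auto
      moreover have "Ck \<F> Z Zt (\<kappa> ` (U \<inter> \<sigma> -` W)) r (\<eta> \<circ> \<sigma> \<circ> inv_into U \<kappa>)"
        using \<sigma> c WF by (fastforce simp: Ck_mfd_def mZ mZt)
      ultimately show ?thesis
        using Ck_iff_family[OF Ff Z ZtF ch(6)[OF oN]] n by (simp add: o_def)
    qed
    show "\<exists>N W a f'. openin (mtop M) N \<and> x \<in> N \<and> openin (vtop Zt) W \<and> a ` N \<subseteq> W \<and>
      Ck \<K> (prod_tvs Zt (prod_tvs E H)) F (W \<times> ?\<Omega>) (r + k) f' \<and>
      (\<forall>x'\<in>N. \<forall>e\<in>?\<Omega>. ft (\<sigma> x', e) = f' (a x', e)) \<and>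
      (\<forall>(U, \<kappa>)\<in>charts \<F> r M. \<forall>n. enat n \<le> r \<longrightarrow>
         open_family \<F> Z Zt point n (\<kappa> ` (U \<inter> N)) (\<lambda>_ z. a (inv_into U \<kappa> z)))"
      \<comment> \<open>The neighbourhood is the preimage under \<open>\<sigma>\<close> of the chart
        domain, the coordinate \<open>a\<close> is \<open>\<eta>\<close> after
        \<open>\<sigma>\<close>, and \<open>f'\<close> is \<open>ft\<close> read in the chart
        \<open>\<eta>\<close>.\<close>
      by (rule exI[of _ ?N], rule exI[of _ "\<eta> ` W"], rule exI[of _ "\<lambda>x. \<eta> (\<sigma> x)"],
          rule exI[of _ "\<lambda>z. ft (inv_into W \<eta> (fst z), snd z)"])
        (use oN x W chW(2,3) ftc[OF W(1)] fam in auto)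
  next
    fix U \<kappa> n assume c: "(U, \<kappa>) \<in> charts \<F> r M" and n: "enat n \<le> r"
    have sub: "\<kappa> ` U \<subseteq> carrier Z" using is_chartD(2)[OF chartsD[OF c]] mZ openin_subset by auto
    \<comment> \<open>The component in \<open>H\<close> is a pure parameter and constant in
      \<open>z\<close>, while the function component is evaluated through the universal
      family.\<close>
    have "continuous_map (vtop (prod_tvs ?C H)) (vtop H) snd" by (simp add: continuous_map_snd)
    from open_family_constant[OF FK H this sub]
    have 2: "open_family \<F> Z H (vtop (prod_tvs ?C H)) n (\<kappa> ` U) (\<lambda>\<xi> _. snd \<xi>)" .
    have "continuous_map (vtop (prod_tvs ?C H)) (vtop ?C) fst" by (simp add: continuous_map_fst)
    from open_family_pair[OF Ck_family_pullback[OF Cr_space_family[OF Ff Z EF M c n] this] 2]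
    show "open_family \<F> Z (prod_tvs E H) (vtop (prod_tvs ?C H)) n (\<kappa> ` U)
        (\<lambda>\<xi> z. (fst \<xi> (inv_into U \<kappa> z), snd \<xi>))" .
  qed
  then show ?thesis by (simp add: Let_def case_prod_unfold cong: if_cong)
qed

end
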